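(* Let $n \ge 1$ be an integer, let $A, B \subseteq \mathbb{R}^n$ be symmetric convex sets, and let $s \ge 0$ and $t$ be real numbers with $\sqrt{s} \le t < 1$. Then $$ \gamma(A)\,\gamma(B) \le (1-s)^{-n/2}\; \gamma\left( \sqrt{\tfrac{2(1-s)}{1+t}}\,(A \cap B) \right)\; \gamma\left( \sqrt{\tfrac{1-s}{2(1-t)}}\,(A+B) \right). $$
   Context: $\gamma$ denotes the standard Gaussian measure on $\mathbb{R}^n$, i.e. $\gamma(K) = \int_K (2\pi)^{-n/2} e^{-\frac12 \|x\|^2}\,dx$ for Lebesgue measurable $K \subseteq \mathbb{R}^n$, where $\|\cdot\|$ is the Euclidean norm. A set $A \subseteq \mathbb{R}^n$ is symmetric if $A = -A$. $A + B = \{a+b : a \in A,\ b \in B\}$ is the Minkowski sum, and for a real number $c$, $cK = \{cx : x \in K\}$. *)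

theory Defs
  imports "HOL-Analysis.Analysis"
begin

text \<open>The base measure is \<^const>\<open>lebesgue\<close> rather than \<^const>\<open>lborel\<close>: convex sets are Lebesgue
  measurable but need not be Borel, and \<^const>\<open>measure\<close> is 0 outside the sigma-algebra.\<close>

definition gaussian :: "(real ^ 'n) measure" where
  "gaussian = density lebesgue
     (\<lambda>x. ennreal ((2 * pi) powr (- real CARD('n) / 2) * exp (- (1 / 2) * (norm x)\<^sup>2)))"

definition symmetric_set :: "'a::real_vector set \<Rightarrow> bool" where
  "symmetric_set A \<longleftrightarrow> A = uminus ` A"

lemma sets_gaussian [simp]: "sets gaussian = sets lebesgue"
  by (simp add: gaussian_def)

end

theory Submission
  imports Defs "HOL-Probability.Probability"
begin

text \<open>The case \<open>s = 0\<close>, \<open>t \<rightarrow> 1\<close> is Royen's Gaussian correlation inequality, so the core is a proof of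
  \<open>J(f, g) \<ge> \<integral>f \<cdot> \<integral>g\<close> (integrals against the Gaussian measure \<open>\<gamma>\<close>) for even log-concave \<open>f\<close>, \<open>g\<close>, where
  \<open>J(f, g) = \<integral>\<integral> f(x) g(r x + s z) d\<gamma> d\<gamma>\<close> with \<open>r\<^sup>2 + s\<^sup>2 = 1\<close>. It follows Nakamura and Tsuji, and Milman.
  Write \<open>J(f, g)\<^sup>2\<close> as an integral over a doubled space and rotate by 45 degrees. With one new variable
  frozen, the functions of the other are again even and log-concave, so if \<open>c\<close> is the best constant in
  \<open>J(f, g) \<ge> c \<integral>f \<integral>g\<close>, then \<open>J(f, g)\<^sup>2 \<ge> c J(Tf, Tg)\<close>, where \<open>Tf\<close> is the density with respect to \<open>\<gamma>\<close> of
  \<open>(X + X') / \<surd>2\<close> for independent \<open>X\<close>, \<open>X'\<close> distributed as \<open>f d\<gamma>\<close>; it is log-concave by Prekopa-Leindler.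
  Iterating \<open>n\<close> times, with \<open>N = 2\<^sup>n\<close>, gives \<open>J(f, g)\<^sup>N \<ge> c\<^sup>N\<^sup>-\<^sup>1 J(T\<^sup>nf, T\<^sup>ng)\<close>.
  A Lindeberg replacement argument shows \<open>J(T\<^sup>nf, T\<^sup>ng) \<ge> (1 - O(1/N)) (\<integral>f \<integral>g)\<^sup>N\<close> uniformly in \<open>f\<close>, \<open>g\<close>:
  replacing one summand by a Gaussian one costs nothing to second order, because the covariance of an even
  density that is log-concave relative to \<open>\<gamma>\<close> is at most the identity and the trace of a product of two positive
  semidefinite matrices is nonnegative. Hence \<open>c \<ge> 1 - O(1/N)\<close> for all \<open>N\<close>.

  For general \<open>s\<close> take the correlation \<open>\<surd>((t\<^sup>2 - s) / (1 - s)) \<le> t\<close>. In terms of densities, symmetrising in \<open>x\<close>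
  turns the correlation term into a hyperbolic cosine, so the correlation may be increased to \<open>t\<close>.
  Passing to \<open>x - y\<close> and \<open>x + y\<close> then separates \<open>A + B\<close> from \<open>A \<inter> B\<close>.\<close>

section \<open>The Prekopa-Leindler inequality\<close>

lemma borel_translate:
  fixes A :: "real set"
  assumes "A \<in> sets borel"
  shows "(+) c ` A \<in> sets borel"
proof -
  have "(+) c ` A = (\<lambda>x. x - c) -` A"
    by (force simp: image_iff)
  then show ?thesis
    using measurable_sets[of "\<lambda>x. x - c" borel borel A] assms by simp
qed

lemma emeasure_lborel_translate:
  fixes A :: "real set"
  assumes "A \<in> sets borel"
  shows "emeasure lborel ((\<lambda>x. c + x) ` A) = emeasure lborel A"
  using emeasure_lebesgue_affine[of 1 c A] assms borel_translate[OF assms, of c]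
  by (simp add: add.commute[of c])

text \<open>If \<open>a\<close> were the largest point of \<open>A\<close> and \<open>b\<close> the
  smallest of \<open>B\<close>, the translates \<open>b + A\<close> and \<open>a + B\<close> would
  lie in \<open>D\<close> on opposite sides of \<open>a + b\<close>. Neither extremum need be
  attained, so near-extremal points are used and the rest is cut off at an arbitrarily small
  cost.\<close>

lemma Brunn_Minkowski_real_bounded:
  fixes A B D :: "real set"
  assumes [measurable]: "A \<in> sets borel" "B \<in> sets borel" "D \<in> sets borel"
    and ne: "A \<noteq> {}" "B \<noteq> {}" and bd: "bdd_above A" "bdd_below B"
    and D: "\<And>a b. a \<in> A \<Longrightarrow> b \<in> B \<Longrightarrow> a + b \<in> D"
  shows "emeasure lborel A + emeasure lborel B \<le> emeasure lborel D"
proof (rule ennreal_le_epsilon)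
  fix e :: real assume e: "0 < e"
  define d where "d = e / 2"
  have d: "d > 0" using e by (simp add: d_def)
  obtain a where a: "a \<in> A" "Sup A - d < a"
    using less_cSup_iff[OF ne(1) bd(1), of "Sup A - d"] d by auto
  obtain b where b: "b \<in> B" "b < Inf B + d"
    using cInf_less_iff[OF ne(2) bd(2), of "Inf B + d"] d by auto
  \<comment> \<open>Since \<open>Sup A < a + d\<close>, cutting \<open>A\<close> at \<open>a\<close>
    loses a set inside an interval of length \<open>d\<close>; the same is done for \<open>B\<close>
    to the left of \<open>b\<close>.\<close>
  have "emeasure lborel A \<le> emeasure lborel ((A \<inter> {..a}) \<union> {a..a + d})"
    using a cSup_upper[OF _ bd(1)] by (intro emeasure_mono) (auto, force)
  also have "\<dots> \<le> emeasure lborel (A \<inter> {..a}) + emeasure lborel {a..a + d}"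
    by (intro emeasure_subadditive) auto
  finally have A: "emeasure lborel A \<le> emeasure lborel (A \<inter> {..a}) + ennreal d"
    using d by simp
  have "emeasure lborel B \<le> emeasure lborel ((B \<inter> {b<..}) \<union> {b - d..b})"
    using b cInf_lower[OF _ bd(2)] by (intro emeasure_mono) (auto, force)
  also have "\<dots> \<le> emeasure lborel (B \<inter> {b<..}) + emeasure lborel {b - d..b}"
    by (intro emeasure_subadditive) auto
  finally have B: "emeasure lborel B \<le> emeasure lborel (B \<inter> {b<..}) + ennreal d"
    using d by simp
  \<comment> \<open>The cut of \<open>A\<close> keeps its endpoint and the cut of \<open>B\<close>
    drops it, so the translates lie in \<open>{..a + b}\<close> and \<open>{a + b<..}\<close> and
    are disjoint.\<close>
  let ?P = "(+) b ` (A \<inter> {..a})" and ?Q = "(+) a ` (B \<inter> {b<..})"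
  have PQ: "?P \<in> sets borel" "?Q \<in> sets borel"
    by (simp_all add: borel_translate)
  have "emeasure lborel (A \<inter> {..a}) + emeasure lborel (B \<inter> {b<..}) = emeasure lborel ?P + emeasure lborel ?Q"
    by (simp add: emeasure_lborel_translate)
  also have "\<dots> = emeasure lborel (?P \<union> ?Q)"
    using PQ by (intro plus_emeasure) auto
  also have "\<dots> \<le> emeasure lborel D"
    using a b D PQ by (intro emeasure_mono) (auto simp: add.commute[of b])
  finally have *: "emeasure lborel (A \<inter> {..a}) + emeasure lborel (B \<inter> {b<..}) \<le> emeasure lborel D" .
  have "emeasure lborel A + emeasure lborel B \<le>
      (emeasure lborel (A \<inter> {..a}) + ennreal d) + (emeasure lborel (B \<inter> {b<..}) + ennreal d)"
    by (intro add_mono A B)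
  also have "\<dots> = (emeasure lborel (A \<inter> {..a}) + emeasure lborel (B \<inter> {b<..})) + ennreal e"
    using d by (simp add: d_def ac_simps flip: ennreal_plus)
  also have "\<dots> \<le> emeasure lborel D + ennreal e"
    by (intro add_mono * order_refl)
  finally show "emeasure lborel A + emeasure lborel B \<le> emeasure lborel D + ennreal e" .
qed

text \<open>The midpoints are doubled, so that \<open>D\<close>, the dilate of \<open>C\<close> by
  2, contains all sums; intersecting with the intervals from \<open>-n\<close> to \<open>n\<close>
  reduces to the bounded case, and continuity from below removes the truncation.\<close>

lemma Brunn_Minkowski_real:
  fixes A B C :: "real set"
  assumes [measurable]: "A \<in> sets borel" "B \<in> sets borel" "C \<in> sets borel"
    and ne: "A \<noteq> {}" "B \<noteq> {}"
    and C: "\<And>a b. a \<in> A \<Longrightarrow> b \<in> B \<Longrightarrow> midpoint a b \<in> C"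
  shows "emeasure lborel A + emeasure lborel B \<le> 2 * emeasure lborel C"
proof -
  define D where "D = (\<lambda>x. x / 2) -` C"
  have D[measurable]: "D \<in> sets borel"
    unfolding D_def using measurable_sets[of "\<lambda>x. x / 2" borel borel C] by auto
  have "(\<lambda>x. 0 + 2 *\<^sub>R x) ` C = D"
    by (auto simp: D_def image_iff intro!: bexI[of _ "_ / 2"])
  then have eD: "emeasure lborel D = 2 * emeasure lborel C"
    using emeasure_lebesgue_affine[of 2 0 C] by (simp add: emeasure_completion sets_completionI_sets)
  obtain a b where ab: "a \<in> A" "b \<in> B" using ne by auto
  obtain n0 :: nat where n0: "\<bar>a\<bar> \<le> n0" "\<bar>b\<bar> \<le> n0"
    by (metis linear order_trans real_arch_simple)
  let ?I = "\<lambda>n. {- real n..real n}"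
  have lim: "(\<lambda>n. emeasure lborel (S \<inter> ?I n)) \<longlonglongrightarrow> emeasure lborel S" if [measurable]: "S \<in> sets borel" for S
  proof -
    have "(\<Union>n. S \<inter> ?I n) = S"
      by (auto simp: ) (metis abs_le_iff minus_le_iff real_arch_simple)
    moreover have "(\<lambda>n. emeasure lborel (S \<inter> ?I n)) \<longlonglongrightarrow> emeasure lborel (\<Union>n. S \<inter> ?I n)"
      by (intro Lim_emeasure_incseq) (auto simp: incseq_def)
    ultimately show ?thesis by simp
  qed
  have "(\<lambda>n. emeasure lborel (A \<inter> ?I n) + emeasure lborel (B \<inter> ?I n)) \<longlonglongrightarrow> emeasure lborel A + emeasure lborel B"
    by (intro tendsto_add lim) auto
  moreover have "emeasure lborel (A \<inter> ?I n) + emeasure lborel (B \<inter> ?I n) \<le> emeasure lborel D" if "n \<ge> n0" for n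
  proof (rule Brunn_Minkowski_real_bounded)
    show "A \<inter> ?I n \<noteq> {}" "B \<inter> ?I n \<noteq> {}" using ab n0 that by (auto, force+)
    show "a + b \<in> D" if "a \<in> A \<inter> ?I n" "b \<in> B \<inter> ?I n" for a b
      using that C[of a b] by (auto simp: D_def midpoint_def field_simps)
  qed (auto intro!: bdd_above_Int2 bdd_below_Int2)
  ultimately have "emeasure lborel A + emeasure lborel B \<le> emeasure lborel D"
    by (intro LIMSEQ_le_const2) auto
  then show ?thesis by (simp add: eD)
qed

section \<open>From level sets to one-dimensional integrals\<close>

text \<open>The value \<open>f x\<close> is the length of the set of \<open>t \<ge> 0\<close> below
  it, also when \<open>f x\<close> is infinite; exchanging the two integrations gives the
  formula.\<close>

lemma nn_integral_layer_cake:
  fixes f :: "'a \<Rightarrow> ennreal"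
  assumes "sigma_finite_measure M" and [measurable]: "f \<in> borel_measurable M"
  shows "(\<integral>\<^sup>+x. f x \<partial>M) = (\<integral>\<^sup>+t. emeasure M {x\<in>space M. ennreal t < f x} * indicator {0..} t \<partial>lborel)"
proof -
  interpret sigma_finite_measure M by fact
  interpret pair_sigma_finite M lborel ..
  have f: "f x = (\<integral>\<^sup>+t. indicator {x\<in>space M. ennreal t < f x} x * indicator {0..} t \<partial>lborel)"
    if x: "x \<in> space M" for x
  proof (cases "f x")
    case (real r)
    have "(\<integral>\<^sup>+t. indicator {x\<in>space M. ennreal t < f x} x * indicator {0..} t \<partial>lborel) =
      (\<integral>\<^sup>+t. indicator {0..<r} t \<partial>lborel)"
      using real x by (intro nn_integral_cong) (auto simp: indicator_def ennreal_less_iff)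
    then show ?thesis using real by simp
  next
    case top
    have "(\<integral>\<^sup>+t. indicator {x\<in>space M. ennreal t < f x} x * indicator {0..} t \<partial>lborel) =
      (\<integral>\<^sup>+t. indicator {0::real..} t \<partial>lborel)"
      using top x by (intro nn_integral_cong) (auto simp: indicator_def)
    also have "\<dots> = emeasure lborel {0::real..}" by simp
    \<comment> \<open>A finite length \<open>r\<close> of the half-line is contradicted by the
      interval \<open>{0..r + 1}\<close> inside it.\<close>
    also have "\<dots> = \<infinity>"
    proof (rule ccontr)
      assume *: "emeasure lborel {0::real..} \<noteq> \<infinity>"
      then obtain r where r: "emeasure lborel {0::real..} = ennreal r" "r \<ge> 0"
        by (cases "emeasure lborel {0::real..}") auto
      have "emeasure lborel {0..r + 1} \<le> emeasure lborel {0::real..}"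
        by (intro emeasure_mono) auto
      then show False using r by simp
    qed
    finally show ?thesis using top by simp
  qed
  have "(\<integral>\<^sup>+x. f x \<partial>M) = (\<integral>\<^sup>+x. (\<integral>\<^sup>+t. indicator {x\<in>space M. ennreal t < f x} x * indicator {0..} t \<partial>lborel) \<partial>M)"
    by (intro nn_integral_cong f)
  also have "\<dots> = (\<integral>\<^sup>+t. (\<integral>\<^sup>+x. indicator {x\<in>space M. ennreal t < f x} x * indicator {0..} t \<partial>M) \<partial>lborel)"
    by (intro Fubini'[symmetric]) measurable
  also have "\<dots> = (\<integral>\<^sup>+t. emeasure M {x\<in>space M. ennreal t < f x} * indicator {0..} t \<partial>lborel)"
    by (intro nn_integral_cong) (simp add: nn_integral_multc)
  finally show ?thesis .
qed

lemma ennreal_AM_GM: "4 * (a * b) \<le> ((a + b)\<^sup>2 :: ennreal)"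
proof (cases "a = top \<or> b = top")
  case True
  then show ?thesis by (auto simp: power2_eq_square ennreal_top_mult ennreal_mult_top)
next
  case False
  then obtain x y where xy: "a = ennreal x" "b = ennreal y" "x \<ge> 0" "y \<ge> 0"
    by (cases a; cases b) auto
  have "4 * (x * y) \<le> (x + y)\<^sup>2" using sum_squares_bound[of x y] by (simp add: power2_sum)
  then have "ennreal (4 * (x * y)) \<le> ennreal ((x + y)\<^sup>2)" by (intro ennreal_leI)
  then show ?thesis using xy by (simp add: ennreal_mult' ennreal_power[symmetric] ennreal_plus)
qed

lemma ennreal_power2_le_iff: "(a::ennreal)\<^sup>2 \<le> b\<^sup>2 \<longleftrightarrow> a \<le> b"
proof (cases a; cases b)
  fix x y assume "a = ennreal x" "b = ennreal y" "0 \<le> x" "0 \<le> y"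
  then show ?thesis
    by (simp add: ennreal_power power2_le_iff_abs_le)
qed (auto simp: power2_eq_square ennreal_mult_top ennreal_top_mult top_unique ennreal_mult_eq_top_iff)

text \<open>With both suprema equal to 1, the level sets of \<open>f\<close> and \<open>g\<close> at
  a height \<open>t\<close> are nonempty for \<open>t < 1\<close> and empty for
  \<open>t \<ge> 1\<close>. So at every height either Brunn-Minkowski applies or the left side
  vanishes, and integrating over \<open>t\<close> gives even an additive inequality.\<close>

lemma Prekopa_Leindler_normalized:
  fixes f g h :: "real \<Rightarrow> ennreal"
  assumes [measurable]: "f \<in> borel_measurable borel" "g \<in> borel_measurable borel" "h \<in> borel_measurable borel"
    and fgh: "\<And>x y. f x * g y \<le> (h (midpoint x y))\<^sup>2"
    and f: "(SUP x. f x) = 1" and g: "(SUP x. g x) = 1"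
  shows "(\<integral>\<^sup>+x. f x \<partial>lborel) + (\<integral>\<^sup>+x. g x \<partial>lborel) \<le> 2 * (\<integral>\<^sup>+x. h x \<partial>lborel)"
proof -
  let ?L = "\<lambda>f t. emeasure lborel {x\<in>space lborel. ennreal t < f x} * indicator {0..} (t::real)"
  have f1: "f x \<le> 1" and g1: "g x \<le> 1" for x
    using f g SUP_upper[of x UNIV f] SUP_upper[of x UNIV g] by auto
  have *: "?L f t + ?L g t \<le> 2 * ?L h t" for t
  proof (cases "0 \<le> t \<and> t < 1")
    case True
    then have "ennreal t < 1" by (simp add: ennreal_less_one_iff)
    then obtain x y where xy: "ennreal t < f x" "ennreal t < g y"
      using f g less_SUP_iff[of "ennreal t"] by metis
    have "ennreal t < h (midpoint a b)" if "ennreal t < f a" "ennreal t < g b" for a b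
    proof -
      obtain r s where rs: "f a = ennreal r" "g b = ennreal s" "0 \<le> r" "0 \<le> s"
        using f1[of a] g1[of b] by (cases "f a"; cases "g b") (auto simp: top_unique)
      have "t * t < r * s"
        using that True rs by (intro mult_strict_mono) (auto simp: ennreal_less_iff)
      then have "(ennreal t)\<^sup>2 < f a * g b"
        using True rs by (simp add: power2_eq_square ennreal_less_iff flip: ennreal_mult)
      also have "\<dots> \<le> (h (midpoint a b))\<^sup>2" by (rule fgh)
      finally show ?thesis
        by (metis ennreal_power2_le_iff linorder_not_le)
    qed
    then have "emeasure lborel {x\<in>space lborel. ennreal t < f x} + emeasure lborel {x\<in>space lborel. ennreal t < g x}
        \<le> 2 * emeasure lborel {x\<in>space lborel. ennreal t < h x}"
      using xy by (intro Brunn_Minkowski_real) auto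
    then show ?thesis using True by simp
  next
    case False
    then have "t < 0 \<or> 1 \<le> ennreal t" by (auto simp: ennreal_ge_1)
    then have "t < 0 \<or> (\<forall>x. \<not> ennreal t < f x \<and> \<not> ennreal t < g x)"
      using f1 g1 by (meson linorder_not_less order_trans)
    then show ?thesis by auto
  qed
  have sf: "sigma_finite_measure lborel" ..
  have "(\<integral>\<^sup>+x. f x \<partial>lborel) + (\<integral>\<^sup>+x. g x \<partial>lborel) = (\<integral>\<^sup>+t. ?L f t + ?L g t \<partial>lborel)"
    by (subst (1 2) nn_integral_layer_cake[OF sf]) (simp_all add: nn_integral_add)
  also have "\<dots> \<le> (\<integral>\<^sup>+t. 2 * ?L h t \<partial>lborel)"
    by (intro nn_integral_mono *)
  also have "\<dots> = 2 * (\<integral>\<^sup>+x. h x \<partial>lborel)"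
    by (subst nn_integral_layer_cake[OF sf, of h]) (simp_all add: nn_integral_cmult)
  finally show ?thesis .
qed

text \<open>Dividing \<open>f\<close> and \<open>g\<close> by their suprema, and \<open>h\<close> by
  the geometric mean \<open>c\<close> of these, preserves the hypothesis. The additive inequality
  then becomes multiplicative by the arithmetic-geometric mean inequality.\<close>

lemma Prekopa_Leindler_bounded:
  fixes f g h :: "real \<Rightarrow> ennreal"
  assumes [measurable]: "f \<in> borel_measurable borel" "g \<in> borel_measurable borel" "h \<in> borel_measurable borel"
    and fgh: "\<And>x y. f x * g y \<le> (h (midpoint x y))\<^sup>2"
    and f: "\<And>x. f x \<le> ennreal K" and g: "\<And>x. g x \<le> ennreal K"
  shows "(\<integral>\<^sup>+x. f x \<partial>lborel) * (\<integral>\<^sup>+x. g x \<partial>lborel) \<le> (\<integral>\<^sup>+x. h x \<partial>lborel)\<^sup>2"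
proof -
  have "(SUP x. f x) \<le> ennreal K" "(SUP x. g x) \<le> ennreal K" using f g by (auto intro: SUP_least)
  then obtain a b where a: "(SUP x. f x) = ennreal a" "a \<ge> 0" and b: "(SUP x. g x) = ennreal b" "b \<ge> 0"
    by (cases "SUP x. f x"; cases "SUP x. g x") (auto simp: top_unique)
  show ?thesis
  proof (cases "a = 0 \<or> b = 0")
    case True
    then have "(\<forall>x. f x = 0) \<or> (\<forall>x. g x = 0)"
      using a b SUP_upper[of _ UNIV f] SUP_upper[of _ UNIV g] by (metis ennreal_0 iso_tuple_UNIV_I le_zero_eq)
    then show ?thesis by auto
  next
    case False
    then have ab: "a > 0" "b > 0" using a b by auto
    define c where "c = sqrt (a * b)"
    have c: "c > 0" "c\<^sup>2 = a * b" using ab by (auto simp: c_def)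
    let ?F = "\<integral>\<^sup>+x. f x \<partial>lborel" and ?G = "\<integral>\<^sup>+x. g x \<partial>lborel" and ?H = "\<integral>\<^sup>+x. h x \<partial>lborel"
    have "(\<integral>\<^sup>+x. f x * ennreal (1 / a) \<partial>lborel) + (\<integral>\<^sup>+x. g x * ennreal (1 / b) \<partial>lborel)
      \<le> 2 * (\<integral>\<^sup>+x. h x * ennreal (1 / c) \<partial>lborel)"
    proof (rule Prekopa_Leindler_normalized)
      show "(SUP x. f x * ennreal (1 / a)) = 1" "(SUP x. g x * ennreal (1 / b)) = 1"
        using a b ab by (simp_all add: SUP_mult_right_ennreal[symmetric] flip: ennreal_mult)
      fix x y
      have "f x * ennreal (1 / a) * (g y * ennreal (1 / b)) = (f x * g y) * ennreal (1 / (a * b))"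
        using ab by (simp add: ac_simps flip: ennreal_mult)
      also have "\<dots> \<le> (h (midpoint x y))\<^sup>2 * ennreal (1 / (a * b))"
        by (intro mult_right_mono fgh) auto
      also have "\<dots> = (h (midpoint x y) * ennreal (1 / c))\<^sup>2"
        using c by (simp add: power_mult_distrib ennreal_power power_one_over)
      finally show "f x * ennreal (1 / a) * (g y * ennreal (1 / b)) \<le> (h (midpoint x y) * ennreal (1 / c))\<^sup>2" .
    qed measurable
    then have le: "?F * ennreal (1 / a) + ?G * ennreal (1 / b) \<le> 2 * (?H * ennreal (1 / c))"
      by (simp add: nn_integral_multc)
    have "?F * ?G = ((?F * ennreal (1 / a)) * (?G * ennreal (1 / b))) * ennreal (c\<^sup>2)"
    proof -
      have "ennreal (1 / a) * (ennreal (1 / b) * ennreal (c\<^sup>2)) = 1"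
        using ab c by (simp flip: ennreal_mult)
      then show ?thesis by (metis (no_types, lifting) mult.assoc mult.commute mult.right_neutral)
    qed
    also have "4 * \<dots> \<le> (2 * (?H * ennreal (1 / c)))\<^sup>2 * ennreal (c\<^sup>2)"
      unfolding mult.assoc[symmetric, of 4]
      by (intro mult_right_mono order.trans[OF _ power_mono[OF le]])
        (auto intro!: order.trans[OF _ ennreal_AM_GM] simp: mult.assoc)
    also have "\<dots> = 4 * ?H\<^sup>2"
    proof -
      have "ennreal (1 / c) * ennreal c = 1"
        using c by (simp flip: ennreal_mult)
      then have "(ennreal (1 / c))\<^sup>2 * ennreal (c\<^sup>2) = 1"
        using c by (metis ennreal_power less_imp_le power_mult_distrib power_one)
      then show ?thesis by (simp add: power_mult_distrib mult.assoc)
    qed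
    finally have "4 * (?F * ?G) \<le> 4 * ?H\<^sup>2" .
    then show ?thesis
      by (subst (asm) ennreal_mult_le_mult_iff) auto
  qed
qed

lemma Prekopa_Leindler_real:
  fixes f g h :: "real \<Rightarrow> ennreal"
  assumes [measurable]: "f \<in> borel_measurable borel" "g \<in> borel_measurable borel" "h \<in> borel_measurable borel"
    and fgh: "\<And>x y. f x * g y \<le> (h (midpoint x y))\<^sup>2"
  shows "(\<integral>\<^sup>+x. f x \<partial>lborel) * (\<integral>\<^sup>+x. g x \<partial>lborel) \<le> (\<integral>\<^sup>+x. h x \<partial>lborel)\<^sup>2"
proof -
  have lim: "(\<lambda>n. \<integral>\<^sup>+x. min (u x) (of_nat n) \<partial>lborel) \<longlonglongrightarrow> (\<integral>\<^sup>+x. u x \<partial>lborel)"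
    if [measurable]: "u \<in> borel_measurable borel" for u :: "real \<Rightarrow> ennreal"
  proof (rule nn_integral_LIMSEQ)
    show "incseq (\<lambda>n x. min (u x) (of_nat n))"
      by (auto simp: incseq_def le_fun_def min_def) (meson of_nat_mono order.trans)+
    have "(\<lambda>n. min (u x) (of_nat n)) \<longlonglongrightarrow> min (u x) top" for x
      by (intro tendsto_min tendsto_const of_nat_tendsto_top_ennreal)
    then show "(\<lambda>n. min (u x) (of_nat n)) \<longlonglongrightarrow> u x" for x by simp
  qed measurable
  let ?F = "\<lambda>n. \<integral>\<^sup>+x. min (f x) (of_nat n) \<partial>lborel" and ?G = "\<lambda>n. \<integral>\<^sup>+x. min (g x) (of_nat n) \<partial>lborel"
  \<comment> \<open>Independent truncation levels \<open>n\<close> and \<open>m\<close> allow the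
    two suprema to be taken one after the other.\<close>
  have *: "?F n * ?G m \<le> (\<integral>\<^sup>+x. h x \<partial>lborel)\<^sup>2" for n m
  proof (rule Prekopa_Leindler_bounded[where K="max n m"])
    show "min (f x) (of_nat n) * min (g y) (of_nat m) \<le> (h (midpoint x y))\<^sup>2" for x y
      by (rule order.trans[OF mult_mono fgh]) auto
    show "min (f x) (of_nat n) \<le> ennreal (max n m)" "min (g x) (of_nat m) \<le> ennreal (max n m)" for x
      by (auto simp: ennreal_of_nat_eq_real_of_nat min_le_iff_disj intro!: ennreal_leI)
  qed measurable
  have mono: "mono (\<lambda>n. \<integral>\<^sup>+x. min (u x) (of_nat n) \<partial>lborel)" for u :: "real \<Rightarrow> ennreal"
    by (intro monoI nn_integral_mono min.mono order_refl of_nat_mono)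
  have sup: "(SUP n. ?F n) = (\<integral>\<^sup>+x. f x \<partial>lborel)" "(SUP n. ?G n) = (\<integral>\<^sup>+x. g x \<partial>lborel)"
    by (rule LIMSEQ_unique[OF LIMSEQ_SUP[OF mono] lim]; simp)+
  show ?thesis
    unfolding sup[symmetric]
    by (subst SUP_mult_right_ennreal, intro SUP_least, subst SUP_mult_left_ennreal, intro SUP_least *)
qed

section \<open>Several dimensions, by induction on the coordinates\<close>

text \<open>Integrating out one coordinate with the one-dimensional inequality yields functions of
  the remaining coordinates that satisfy the hypothesis again. The hypothesis speaks of extensional
  points because these are the points of the product space, where the sections \<open>sec\<close>
  are measurable.\<close>

lemma Prekopa_Leindler_PiM:
  fixes f g h :: "('i \<Rightarrow> real) \<Rightarrow> ennreal"
  assumes "finite I"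
    and "f \<in> borel_measurable (Pi\<^sub>M I (\<lambda>_. lborel))" "g \<in> borel_measurable (Pi\<^sub>M I (\<lambda>_. lborel))"
    and "h \<in> borel_measurable (Pi\<^sub>M I (\<lambda>_. lborel))"
    and "\<And>x y. x \<in> extensional I \<Longrightarrow> y \<in> extensional I \<Longrightarrow>
      f x * g y \<le> (h (\<lambda>i\<in>I. midpoint (x i) (y i)))\<^sup>2"
  shows "(\<integral>\<^sup>+x. f x \<partial>Pi\<^sub>M I (\<lambda>_. lborel)) * (\<integral>\<^sup>+x. g x \<partial>Pi\<^sub>M I (\<lambda>_. lborel))
    \<le> (\<integral>\<^sup>+x. h x \<partial>Pi\<^sub>M I (\<lambda>_. lborel))\<^sup>2"
  using assms
proof (induction I arbitrary: f g h rule: finite_induct)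
  case empty
  interpret product_sigma_finite "\<lambda>_::'i. lborel :: real measure" ..
  show ?case
    using empty.prems(4)[of "\<lambda>_. undefined" "\<lambda>_. undefined"]
    by (simp add: nn_integral_empty restrict_def)
next
  case (insert i I)
  interpret product_sigma_finite "\<lambda>_::'i. lborel :: real measure" ..
  let ?M = "Pi\<^sub>M I (\<lambda>_. lborel :: real measure)"
  have sec: "(\<lambda>y. u (x(i := y))) \<in> borel_measurable borel"
    if u: "u \<in> borel_measurable (Pi\<^sub>M (insert i I) (\<lambda>_. lborel))" and x: "x \<in> extensional I" for u :: "_ \<Rightarrow> ennreal" and x
    using measurable_comp[OF measurable_component_update u, of x] x \<open>i \<notin> I\<close>
    by (simp add: comp_def space_PiM PiE_def fun_upd_def)
  have meas: "(\<lambda>x. \<integral>\<^sup>+y. u (x(i := y)) \<partial>lborel) \<in> borel_measurable ?M"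
    if [measurable]: "u \<in> borel_measurable (Pi\<^sub>M (insert i I) (\<lambda>_. lborel))" for u :: "_ \<Rightarrow> ennreal"
    by measurable
  have "(\<integral>\<^sup>+x. \<integral>\<^sup>+t. f (x(i := t)) \<partial>lborel \<partial>?M) * (\<integral>\<^sup>+x. \<integral>\<^sup>+t. g (x(i := t)) \<partial>lborel \<partial>?M)
    \<le> (\<integral>\<^sup>+x. \<integral>\<^sup>+t. h (x(i := t)) \<partial>lborel \<partial>?M)\<^sup>2"
  proof (rule insert.IH)
    fix x y :: "'i \<Rightarrow> real" assume xy: "x \<in> extensional I" "y \<in> extensional I"
    show "(\<integral>\<^sup>+t. f (x(i := t)) \<partial>lborel) * (\<integral>\<^sup>+t. g (y(i := t)) \<partial>lborel)
      \<le> (\<integral>\<^sup>+t. h ((\<lambda>i\<in>I. midpoint (x i) (y i))(i := t)) \<partial>lborel)\<^sup>2"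
    proof (rule Prekopa_Leindler_real)
      fix s t :: real
      have "f (x(i := s)) * g (y(i := t)) \<le>
          (h (\<lambda>j\<in>insert i I. midpoint ((x(i := s)) j) ((y(i := t)) j)))\<^sup>2"
        using xy by (intro insert.prems(4)) (auto simp: extensional_def)
      also have "(\<lambda>j\<in>insert i I. midpoint ((x(i := s)) j) ((y(i := t)) j)) =
          (\<lambda>i\<in>I. midpoint (x i) (y i))(i := midpoint s t)"
        using \<open>i \<notin> I\<close> by (auto simp: fun_eq_iff)
      finally show "f (x(i := s)) * g (y(i := t)) \<le> (h ((\<lambda>i\<in>I. midpoint (x i) (y i))(i := midpoint s t)))\<^sup>2" .
    qed (use xy insert.prems in \<open>auto intro!: sec\<close>)
  qed (rule meas, fact)+
  then show ?case
    using insert by (simp add: product_nn_integral_insert)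
qed

theorem Prekopa_Leindler:
  fixes f g h :: "'a::euclidean_space \<Rightarrow> ennreal"
  assumes [measurable]: "f \<in> borel_measurable borel" "g \<in> borel_measurable borel" "h \<in> borel_measurable borel"
    and fgh: "\<And>x y. f x * g y \<le> (h (midpoint x y))\<^sup>2"
  shows "(\<integral>\<^sup>+x. f x \<partial>lborel) * (\<integral>\<^sup>+x. g x \<partial>lborel) \<le> (\<integral>\<^sup>+x. h x \<partial>lborel)\<^sup>2"
proof -
  let ?T = "\<lambda>p. \<Sum>b\<in>Basis. p b *\<^sub>R b :: 'a" and ?M = "Pi\<^sub>M (Basis :: 'a set) (\<lambda>_. lborel :: real measure)"
  have T[measurable]: "?T \<in> measurable ?M borel"
    by measurable
  have *: "(\<integral>\<^sup>+x. u x \<partial>lborel) = (\<integral>\<^sup>+p. u (?T p) \<partial>?M)" if "u \<in> borel_measurable borel" for u :: "'a \<Rightarrow> ennreal"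
    using that by (subst lborel_eq) (simp add: nn_integral_distr)
  show ?thesis
    unfolding assms(1-3)[THEN *]
  proof (rule Prekopa_Leindler_PiM)
    fix p q :: "'a \<Rightarrow> real"
    have "?T (\<lambda>b\<in>Basis. midpoint (p b) (q b)) = midpoint (?T p) (?T q)"
      by (simp add: midpoint_def scaleR_sum_right sum.distrib[symmetric] algebra_simps add_divide_distrib)
    then show "f (?T p) * g (?T q) \<le> (h (?T (\<lambda>b\<in>Basis. midpoint (p b) (q b))))\<^sup>2"
      using fgh[of "?T p" "?T q"] by simp
  qed measurable
qed

section \<open>The standard Gaussian measure\<close>

definition std_gauss_density :: "'a::euclidean_space \<Rightarrow> real" where
  "std_gauss_density x = (\<Prod>b\<in>Basis. std_normal_density (x \<bullet> b))"

text \<open>A version of \<open>gaussian\<close> over \<open>lborel\<close> and on any Euclidean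
  space, so that Fubini applies with Borel sigma-algebras; \<open>emeasure_gaussian_borel\<close>
  links the two.\<close>

definition std_gauss :: "'a::euclidean_space measure" where
  "std_gauss = density lborel (\<lambda>x. ennreal (std_gauss_density x))"

lemma std_gauss_density_eq:
  "std_gauss_density (x::'a::euclidean_space) = (1 / sqrt (2 * pi)) ^ DIM('a) * exp (- (norm x)\<^sup>2 / 2)"
proof -
  have "(norm x)\<^sup>2 = (\<Sum>b\<in>Basis. (x \<bullet> b)\<^sup>2)"
    unfolding power2_norm_eq_inner by (subst euclidean_inner) (simp add: power2_eq_square)
  then show ?thesis
    by (simp add: std_gauss_density_def std_normal_density_def prod_dividef exp_sum[symmetric]
        sum_negf sum_divide_distrib power_one_over)
qed

lemma std_gauss_density_pos: "0 < std_gauss_density x"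
  by (simp add: std_gauss_density_eq)

lemma measurable_std_gauss_density[measurable]: "std_gauss_density \<in> borel_measurable borel"
  unfolding std_gauss_density_def[abs_def] by measurable

lemma sets_std_gauss[simp, measurable_cong]: "sets std_gauss = sets borel"
  by (simp add: std_gauss_def)

lemma space_std_gauss[simp]: "space std_gauss = UNIV"
  by (simp add: std_gauss_def)

lemma nn_integral_std_gauss:
  "f \<in> borel_measurable borel \<Longrightarrow>
    (\<integral>\<^sup>+x. f x \<partial>std_gauss) = (\<integral>\<^sup>+x. ennreal (std_gauss_density x) * f x \<partial>lborel)"
  unfolding std_gauss_def by (rule nn_integral_density) auto

lemma prob_space_std_gauss: "prob_space (std_gauss :: 'a::euclidean_space measure)"
proof
  have "(\<integral>\<^sup>+x. ennreal (std_gauss_density x) \<partial>(lborel :: 'a measure)) =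
      (\<integral>\<^sup>+x. (\<Prod>b\<in>Basis. ennreal (std_normal_density (x \<bullet> b))) \<partial>(lborel :: 'a measure))"
    by (simp add: std_gauss_density_def prod_ennreal)
  also have "\<dots> = (\<Prod>b\<in>(Basis::'a set). \<integral>\<^sup>+x. ennreal (std_normal_density x) \<partial>lborel)"
    by (rule nn_integral_lborel_prod) auto
  also have "(\<integral>\<^sup>+x. ennreal (std_normal_density x) \<partial>lborel) = 1"
    using prob_space.emeasure_space_1[OF prob_space_normal_density[of 1 0]] by (simp add: emeasure_density)
  finally show "emeasure (std_gauss :: 'a measure) (space std_gauss) = 1"
    by (simp add: std_gauss_def emeasure_density)
qed

interpretation std_gauss: prob_space "std_gauss :: 'a::euclidean_space measure"
  by (rule prob_space_std_gauss)

lemma std_gauss_density_log_concave: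
  "ennreal (std_gauss_density x) * ennreal (std_gauss_density y) \<le> (ennreal (std_gauss_density (midpoint x y)))\<^sup>2"
proof -
  have "std_gauss_density x * std_gauss_density y \<le> (std_gauss_density (midpoint x y))\<^sup>2"
  proof -
    \<comment> \<open>The parallelogram law: the defect is half the squared distance of
      \<open>x\<close> and \<open>y\<close>.\<close>
    have "2 * (norm (midpoint x y))\<^sup>2 \<le> (norm x)\<^sup>2 + (norm y)\<^sup>2"
    proof -
      have "(norm x)\<^sup>2 + (norm y)\<^sup>2 - 2 * (norm (midpoint x y))\<^sup>2 = (norm (x - y))\<^sup>2 / 2"
        unfolding power2_norm_eq_inner midpoint_def
        by (simp add: inner_add_left inner_add_right inner_diff_left inner_diff_right inner_commute field_simps)
      then show ?thesis by (smt (verit) zero_le_power2 divide_nonneg_nonneg)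
    qed
    then have "exp (- (norm x)\<^sup>2 / 2 + - (norm y)\<^sup>2 / 2) \<le> exp (- (norm (midpoint x y))\<^sup>2 / 2 + - (norm (midpoint x y))\<^sup>2 / 2)"
      by simp
    then show ?thesis
      unfolding std_gauss_density_eq power2_eq_square[of "_ * exp _"]
      by (simp add: exp_add[symmetric] mult_ac)
  qed
  then show ?thesis
    by (simp add: less_imp_le[OF std_gauss_density_pos] ennreal_leI ennreal_power flip: ennreal_mult)
qed

lemma Prekopa_Leindler_std_gauss:
  fixes f g h :: "'a::euclidean_space \<Rightarrow> ennreal"
  assumes [measurable]: "f \<in> borel_measurable borel" "g \<in> borel_measurable borel" "h \<in> borel_measurable borel"
    and fgh: "\<And>x y. f x * g y \<le> (h (midpoint x y))\<^sup>2"
  shows "(\<integral>\<^sup>+x. f x \<partial>std_gauss) * (\<integral>\<^sup>+x. g x \<partial>std_gauss) \<le> (\<integral>\<^sup>+x. h x \<partial>std_gauss)\<^sup>2"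
  unfolding assms(1-3)[THEN nn_integral_std_gauss]
proof (rule Prekopa_Leindler)
  fix x y :: 'a
  have "ennreal (std_gauss_density x) * f x * (ennreal (std_gauss_density y) * g y) =
      (ennreal (std_gauss_density x) * ennreal (std_gauss_density y)) * (f x * g y)"
    by (simp add: ac_simps)
  also have "\<dots> \<le> (ennreal (std_gauss_density (midpoint x y)))\<^sup>2 * (h (midpoint x y))\<^sup>2"
    by (intro mult_mono fgh std_gauss_density_log_concave) auto
  finally show "ennreal (std_gauss_density x) * f x * (ennreal (std_gauss_density y) * g y) \<le>
      (ennreal (std_gauss_density (midpoint x y)) * h (midpoint x y))\<^sup>2"
    by (simp add: power_mult_distrib)
qed measurable

section \<open>Changes of variables for the Gaussian measure\<close>

lemma nn_integral_lborel_affine: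
  fixes f :: "'a::euclidean_space \<Rightarrow> ennreal"
  assumes [measurable]: "f \<in> borel_measurable borel" and c: "c \<noteq> 0"
  shows "(\<integral>\<^sup>+x. f x \<partial>lborel) = ennreal (\<bar>c\<bar> ^ DIM('a)) * (\<integral>\<^sup>+x. f (t + c *\<^sub>R x) \<partial>lborel)"
  by (subst lborel_affine[OF c, of t])
    (simp add: nn_integral_density nn_integral_distr nn_integral_cmult)

lemma nn_integral_std_gauss_uminus:
  fixes f :: "'a::euclidean_space \<Rightarrow> ennreal"
  assumes [measurable]: "f \<in> borel_measurable borel"
  shows "(\<integral>\<^sup>+x. f (- x) \<partial>std_gauss) = (\<integral>\<^sup>+x. f x \<partial>std_gauss)"
proof -
  have "(\<integral>\<^sup>+x. f x \<partial>std_gauss) = (\<integral>\<^sup>+x. ennreal (std_gauss_density (-x)) * f (-x) \<partial>lborel)"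
    by (subst nn_integral_std_gauss, simp, subst nn_integral_lborel_affine[of _ "-1" 0]) auto
  also have "\<dots> = (\<integral>\<^sup>+x. f (- x) \<partial>std_gauss)"
    by (subst nn_integral_std_gauss) (simp_all add: std_gauss_density_eq)
  finally show ?thesis ..
qed

lemma std_gauss_density_shift:
  "std_gauss_density (x - t) = std_gauss_density x * exp (t \<bullet> x - (norm t)\<^sup>2 / 2)"
proof -
  have "- (norm (x - t))\<^sup>2 / 2 = - (norm x)\<^sup>2 / 2 + (t \<bullet> x - (norm t)\<^sup>2 / 2)"
    unfolding power2_norm_eq_inner
    by (simp add: inner_diff_left inner_diff_right inner_commute field_simps)
  then show ?thesis
    unfolding std_gauss_density_eq by (simp only: exp_add mult.assoc)
qed

text \<open>The Cameron-Martin formula: the exponential factor is the quotient of the translated and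
  the original density.\<close>

lemma nn_integral_std_gauss_shift:
  fixes f :: "'a::euclidean_space \<Rightarrow> ennreal"
  assumes [measurable]: "f \<in> borel_measurable borel"
  shows "(\<integral>\<^sup>+x. f (x + t) \<partial>std_gauss) = (\<integral>\<^sup>+x. ennreal (exp (t \<bullet> x - (norm t)\<^sup>2 / 2)) * f x \<partial>std_gauss)"
proof -
  have "(\<integral>\<^sup>+x. f (x + t) \<partial>std_gauss) = (\<integral>\<^sup>+x. ennreal (std_gauss_density ((t + 1 *\<^sub>R x) - t)) * f (t + 1 *\<^sub>R x) \<partial>lborel)"
    by (subst nn_integral_std_gauss) (simp_all add: add.commute)
  also have "\<dots> = (\<integral>\<^sup>+x. ennreal (std_gauss_density (x - t)) * f x \<partial>lborel)"
    using nn_integral_lborel_affine[of "\<lambda>x. ennreal (std_gauss_density (x - t)) * f x" 1 t] by simp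
  also have "\<dots> = (\<integral>\<^sup>+x. ennreal (exp (t \<bullet> x - (norm t)\<^sup>2 / 2)) * f x \<partial>std_gauss)"
    by (subst nn_integral_std_gauss)
      (simp_all add: std_gauss_density_shift ennreal_mult less_imp_le[OF std_gauss_density_pos] mult.assoc)
  finally show ?thesis .
qed

text \<open>The shift formula applied to the constant 1, multiplied by
  \<open>exp ((norm t)\<^sup>2 / 2)\<close>.\<close>

lemma nn_integral_exp_std_gauss:
  fixes t :: "'a::euclidean_space"
  shows "(\<integral>\<^sup>+x. ennreal (exp (t \<bullet> x)) \<partial>std_gauss) = ennreal (exp ((norm t)\<^sup>2 / 2))"
proof -
  have "1 = (\<integral>\<^sup>+x. ennreal (exp (t \<bullet> x - (norm t)\<^sup>2 / 2)) \<partial>std_gauss)"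
    using nn_integral_std_gauss_shift[of "\<lambda>_. 1" t] std_gauss.emeasure_space_1[where 'a='a] by simp
  also have "\<dots> = (\<integral>\<^sup>+x. ennreal (exp (t \<bullet> x)) * ennreal (exp (- (norm t)\<^sup>2 / 2)) \<partial>std_gauss)"
    by (intro nn_integral_cong) (simp flip: ennreal_mult exp_add)
  also have "\<dots> = (\<integral>\<^sup>+x. ennreal (exp (t \<bullet> x)) \<partial>std_gauss) * ennreal (exp (- (norm t)\<^sup>2 / 2))"
    by (subst nn_integral_multc) auto
  finally have "ennreal (exp ((norm t)\<^sup>2 / 2)) =
      (\<integral>\<^sup>+x. ennreal (exp (t \<bullet> x)) \<partial>std_gauss) * (ennreal (exp (- (norm t)\<^sup>2 / 2)) * ennreal (exp ((norm t)\<^sup>2 / 2)))"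
    by (metis mult.assoc mult_1)
  also have "ennreal (exp (- (norm t)\<^sup>2 / 2)) * ennreal (exp ((norm t)\<^sup>2 / 2)) = 1"
    by (simp add: exp_minus flip: ennreal_mult)
  finally show ?thesis by simp
qed

text \<open>Moving a point towards the origin increases the density, so only the Jacobian of the
  contraction is lost.\<close>

lemma nn_integral_std_gauss_scale_le:
  fixes f :: "'a::euclidean_space \<Rightarrow> ennreal"
  assumes [measurable]: "f \<in> borel_measurable borel" and c: "0 < c" "c \<le> 1"
  shows "ennreal (c ^ DIM('a)) * (\<integral>\<^sup>+x. f (c *\<^sub>R x) \<partial>std_gauss) \<le> (\<integral>\<^sup>+x. f x \<partial>std_gauss)"
proof -
  have "std_gauss_density x \<le> std_gauss_density (c *\<^sub>R x)" for x :: 'a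
  proof -
    have "norm (c *\<^sub>R x) \<le> norm x" using c by (simp add: mult_left_le_one_le)
    then have "(norm (c *\<^sub>R x))\<^sup>2 \<le> (norm x)\<^sup>2" by (intro power_mono) auto
    then show ?thesis
      unfolding std_gauss_density_eq by (intro mult_left_mono) auto
  qed
  then have "(\<integral>\<^sup>+x. f (c *\<^sub>R x) \<partial>std_gauss) \<le>
      (\<integral>\<^sup>+x. ennreal (std_gauss_density (0 + c *\<^sub>R x)) * f (0 + c *\<^sub>R x) \<partial>lborel)"
    by (subst nn_integral_std_gauss) (auto intro!: nn_integral_mono mult_right_mono ennreal_leI)
  then have "ennreal (c ^ DIM('a)) * (\<integral>\<^sup>+x. f (c *\<^sub>R x) \<partial>std_gauss) \<le> 
     ennreal (\<bar>c\<bar> ^ DIM('a)) * (\<integral>\<^sup>+x. ennreal (std_gauss_density (0 + c *\<^sub>R x)) * f (0 + c *\<^sub>R x) \<partial>lborel)"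
    using c by (intro mult_mono) auto
  also have "\<dots> = (\<integral>\<^sup>+x. ennreal (std_gauss_density x) * f x \<partial>lborel)"
    using c by (subst nn_integral_lborel_affine[of _ c 0]) auto
  also have "\<dots> = (\<integral>\<^sup>+x. f x \<partial>std_gauss)"
    by (subst nn_integral_std_gauss) auto
  finally show ?thesis .
qed

text \<open>The rotation is carried out as two substitutions in one variable each: \<open>y\<close>
  is replaced by the first rotated coordinate \<open>p\<close> while \<open>x\<close> is fixed, then
  \<open>x\<close> by the second one \<open>q\<close> while \<open>p\<close> is fixed. Their
  Jacobians are reciprocal, and the product density is invariant because the sum of the squared
  norms is.\<close>

lemma nn_integral_std_gauss_rotate:
  fixes F :: "'a::euclidean_space \<Rightarrow> 'a \<Rightarrow> ennreal"
  assumes [measurable]: "case_prod F \<in> borel_measurable (borel \<Otimes>\<^sub>M borel)"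
    and cs: "c\<^sup>2 + s\<^sup>2 = 1" "s \<noteq> 0"
  shows "(\<integral>\<^sup>+x. \<integral>\<^sup>+y. F (c *\<^sub>R x + s *\<^sub>R y) (c *\<^sub>R y - s *\<^sub>R x) \<partial>std_gauss \<partial>std_gauss) =
    (\<integral>\<^sup>+x. \<integral>\<^sup>+y. F x y \<partial>std_gauss \<partial>std_gauss)"
proof -
  define G where "G p q = ennreal (std_gauss_density p) * ennreal (std_gauss_density q) * F p q" for p q
  have [measurable]: "case_prod G \<in> borel_measurable (borel \<Otimes>\<^sub>M borel)"
    unfolding G_def by measurable
  let ?p = "\<lambda>x y. c *\<^sub>R x + s *\<^sub>R y" and ?q = "\<lambda>x y. c *\<^sub>R y - s *\<^sub>R x"
  have iso: "std_gauss_density (?p x y) * std_gauss_density (?q x y) = std_gauss_density x * std_gauss_density y" for x y :: 'a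
  proof -
    have "(norm (?p x y))\<^sup>2 + (norm (?q x y))\<^sup>2 = (c\<^sup>2 + s\<^sup>2) * ((norm x)\<^sup>2 + (norm y)\<^sup>2)"
      unfolding power2_norm_eq_inner
      by (simp add: inner_add_left inner_add_right inner_diff_left inner_diff_right inner_commute
          algebra_simps power2_eq_square)
    then have "- (norm (?p x y))\<^sup>2 / 2 + - (norm (?q x y))\<^sup>2 / 2 = - (norm x)\<^sup>2 / 2 + - (norm y)\<^sup>2 / 2"
      using cs by simp
    then have "exp (- (norm (?p x y))\<^sup>2 / 2) * exp (- (norm (?q x y))\<^sup>2 / 2) = exp (- (norm x)\<^sup>2 / 2) * exp (- (norm y)\<^sup>2 / 2)"
      by (simp only: exp_add[symmetric])
    then show ?thesis unfolding std_gauss_density_eq by (simp add: mult_ac)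
  qed
  have two: "(\<integral>\<^sup>+x. \<integral>\<^sup>+y. H x y \<partial>std_gauss \<partial>std_gauss) =
      (\<integral>\<^sup>+x. \<integral>\<^sup>+y. ennreal (std_gauss_density x) * ennreal (std_gauss_density y) * H x y \<partial>lborel \<partial>lborel)"
    if [measurable]: "case_prod H \<in> borel_measurable (borel \<Otimes>\<^sub>M borel)" for H :: "'a \<Rightarrow> 'a \<Rightarrow> ennreal"
    by (simp add: nn_integral_std_gauss mult.assoc nn_integral_cmult)
  have "(\<integral>\<^sup>+x. \<integral>\<^sup>+y. F (?p x y) (?q x y) \<partial>std_gauss \<partial>std_gauss) =
      (\<integral>\<^sup>+x. \<integral>\<^sup>+y. G (?p x y) (?q x y) \<partial>lborel \<partial>lborel)"
    by (subst two) (simp_all add: G_def iso less_imp_le[OF std_gauss_density_pos] flip: ennreal_mult)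
  \<comment> \<open>The equation \<open>p = c x + s y\<close> is solved for \<open>y\<close>, which
    is where \<open>s \<noteq> 0\<close> enters.\<close>
  also have "\<dots> = (\<integral>\<^sup>+x. ennreal (\<bar>1 / s\<bar> ^ DIM('a)) * (\<integral>\<^sup>+p. G p ((c / s) *\<^sub>R p - (1 / s) *\<^sub>R x) \<partial>lborel) \<partial>lborel)"
  proof (intro nn_integral_cong)
    fix x :: 'a
    have q: "?q x ((- c / s) *\<^sub>R x + (1 / s) *\<^sub>R p) = (c / s) *\<^sub>R p - (1 / s) *\<^sub>R x" for p
    proof -
      have "?q x ((- c / s) *\<^sub>R x + (1 / s) *\<^sub>R p) = (c / s) *\<^sub>R p - (c * c / s + s) *\<^sub>R x"
        by (simp add: algebra_simps)
      also have "c * c / s + s = 1 / s" using cs by (simp add: field_simps power2_eq_square)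
      finally show ?thesis .
    qed
    have p: "?p x ((- c / s) *\<^sub>R x + (1 / s) *\<^sub>R p) = p" for p
      using cs by (simp add: algebra_simps)
    show "(\<integral>\<^sup>+y. G (?p x y) (?q x y) \<partial>lborel) =
        ennreal (\<bar>1 / s\<bar> ^ DIM('a)) * (\<integral>\<^sup>+p. G p ((c / s) *\<^sub>R p - (1 / s) *\<^sub>R x) \<partial>lborel)"
      using nn_integral_lborel_affine[of "\<lambda>y. G (?p x y) (?q x y)" "1 / s" "(- c / s) *\<^sub>R x"] cs
      by (simp only: p q) simp
  qed
  also have "\<dots> = ennreal (\<bar>1 / s\<bar> ^ DIM('a)) * (\<integral>\<^sup>+p. \<integral>\<^sup>+x. G p ((c / s) *\<^sub>R p - (1 / s) *\<^sub>R x) \<partial>lborel \<partial>lborel)"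
    by (subst nn_integral_cmult) (simp_all, subst lborel_pair.Fubini', simp_all)
  also have "(\<integral>\<^sup>+p. \<integral>\<^sup>+x. G p ((c / s) *\<^sub>R p - (1 / s) *\<^sub>R x) \<partial>lborel \<partial>lborel) =
    (\<integral>\<^sup>+p. ennreal (\<bar>s\<bar> ^ DIM('a)) * (\<integral>\<^sup>+q. G p q \<partial>lborel) \<partial>lborel)"
  proof (intro nn_integral_cong)
    fix p :: 'a
    have q: "(c / s) *\<^sub>R p - (1 / s) *\<^sub>R (c *\<^sub>R p + (- s) *\<^sub>R q) = q" for q
      using cs by (simp add: algebra_simps)
    show "(\<integral>\<^sup>+x. G p ((c / s) *\<^sub>R p - (1 / s) *\<^sub>R x) \<partial>lborel) =
        ennreal (\<bar>s\<bar> ^ DIM('a)) * (\<integral>\<^sup>+q. G p q \<partial>lborel)"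
      using nn_integral_lborel_affine[of "\<lambda>x. G p ((c / s) *\<^sub>R p - (1 / s) *\<^sub>R x)" "- s" "c *\<^sub>R p"] cs
      by (simp only: q) simp
  qed
  also have "\<dots> = ennreal (\<bar>s\<bar> ^ DIM('a)) * (\<integral>\<^sup>+p. \<integral>\<^sup>+q. G p q \<partial>lborel \<partial>lborel)"
    by (subst nn_integral_cmult) simp_all
  also have "ennreal (\<bar>1 / s\<bar> ^ DIM('a)) * \<dots> = (\<integral>\<^sup>+p. \<integral>\<^sup>+q. G p q \<partial>lborel \<partial>lborel)"
  proof -
    have "ennreal (\<bar>1 / s\<bar> ^ DIM('a)) * ennreal (\<bar>s\<bar> ^ DIM('a)) = 1"
      using cs by (simp flip: ennreal_mult power_mult_distrib)
    then show ?thesis by (simp add: mult.assoc[symmetric])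
  qed
  also have "\<dots> = (\<integral>\<^sup>+x. \<integral>\<^sup>+y. F x y \<partial>std_gauss \<partial>std_gauss)"
    by (subst two) (simp_all add: G_def[abs_def])
  finally show ?thesis .
qed

section \<open>Subgaussian measures\<close>

text \<open>The fourth-order Maclaurin expansions of \<open>exp\<close> at \<open>t\<close> and
  \<open>- t\<close> are averaged; the odd terms cancel, and the remainder factors
  \<open>exp a\<close>, \<open>exp b\<close> are at most \<open>2 * cosh t\<close>.\<close>

lemma cosh_Taylor:
  fixes t :: real
  shows "1 + t\<^sup>2 / 2 \<le> cosh t" and "cosh t \<le> 1 + t\<^sup>2 / 2 + t ^ 4 * cosh t"
proof -
  obtain a where a: "\<bar>a\<bar> \<le> \<bar>t\<bar>" "exp t = (\<Sum>m<4. t ^ m / fact m) + exp a / fact 4 * t ^ 4"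
    using Maclaurin_exp_le by blast
  obtain b where b: "\<bar>b\<bar> \<le> \<bar>- t\<bar>" "exp (- t) = (\<Sum>m<4. (- t) ^ m / fact m) + exp b / fact 4 * (- t) ^ 4"
    using Maclaurin_exp_le by blast
  have eq: "cosh t = 1 + t\<^sup>2 / 2 + (exp a + exp b) / 48 * t ^ 4"
    using a(2) b(2) by (simp add: cosh_field_def numeral_eq_Suc fact_numeral field_simps)
  have "0 \<le> (exp a + exp b) / 48 * t ^ 4" by simp
  then show "1 + t\<^sup>2 / 2 \<le> cosh t" using eq by linarith
  have e: "exp \<bar>t\<bar> \<le> 2 * cosh t" by (cases "t \<ge> 0") (auto simp: cosh_field_def)
  have "exp a \<le> 2 * cosh t" "exp b \<le> 2 * cosh t"
    using a(1) b(1) by (auto intro!: order.trans[OF _ e])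
  then have "exp a + exp b \<le> 48 * cosh t" using cosh_real_pos[of t] by linarith
  then have "(exp a + exp b) / 48 \<le> cosh t" by (simp only: pos_divide_le_eq mult.commute zero_less_numeral)
  then have "(exp a + exp b) / 48 * t ^ 4 \<le> cosh t * t ^ 4" by (intro mult_right_mono) auto
  then show "cosh t \<le> 1 + t\<^sup>2 / 2 + t ^ 4 * cosh t" using eq by (simp add: mult.commute)
qed

lemma exp_minus_cosh_Taylor:
  fixes s t :: real
  assumes "0 \<le> s"
  shows "\<bar>exp (- s) * cosh t - (1 - s + t\<^sup>2 / 2)\<bar> \<le> s\<^sup>2 + s * t\<^sup>2 + t ^ 4 * cosh t"
proof -
  have l: "1 - s \<le> exp (- s)" using exp_ge_add_one_self[of "- s"] by simp
  have u: "exp (- s) \<le> 1 - s + s\<^sup>2"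
  proof -
    have "exp (- s) * (1 + s) \<le> exp (- s) * exp s" by (intro mult_left_mono) auto
    then have "exp (- s) \<le> 1 / (1 + s)" using assms by (simp add: field_simps flip: exp_add)
    also have "\<dots> \<le> 1 - s + s\<^sup>2" using assms by (simp add: field_simps power2_eq_square power3_eq_cube)
    finally show ?thesis .
  qed
  have "exp (- s) \<le> 1" using assms by simp
  have "exp (- s) * cosh t \<le> exp (- s) * (1 + t\<^sup>2 / 2 + t ^ 4 * cosh t)"
    by (intro mult_left_mono cosh_Taylor) auto
  also have "\<dots> = exp (- s) + exp (- s) * (t\<^sup>2 / 2 + t ^ 4 * cosh t)" by (simp add: algebra_simps)
  also have "\<dots> \<le> (1 - s + s\<^sup>2) + 1 * (t\<^sup>2 / 2 + t ^ 4 * cosh t)"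
    using assms u cosh_real_pos[of t] by (intro add_mono mult_right_mono) (auto simp: less_imp_le)
  finally have 1: "exp (- s) * cosh t \<le> 1 - s + t\<^sup>2 / 2 + (s\<^sup>2 + t ^ 4 * cosh t)" by simp
  have "1 - s + t\<^sup>2 / 2 - s * t\<^sup>2 \<le> (1 - s) * (1 + t\<^sup>2 / 2)"
    using assms by (simp add: field_simps)
  also have "\<dots> \<le> exp (- s) * (1 + t\<^sup>2 / 2)" by (intro mult_right_mono l) auto
  also have "\<dots> \<le> exp (- s) * cosh t" by (intro mult_left_mono cosh_Taylor) auto
  finally have 2: "1 - s + t\<^sup>2 / 2 - s * t\<^sup>2 \<le> exp (- s) * cosh t" .
  have "0 \<le> s * t\<^sup>2" "0 \<le> s\<^sup>2 + t ^ 4 * cosh t" using assms cosh_real_pos[of t] by (auto simp: less_imp_le)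
  then show ?thesis using 1 2 by linarith
qed

text \<open>The error is bounded by a product of functions of \<open>x\<close> and of
  \<open>w\<close> whose integrals over subgaussian measures are controlled by
  \<open>subgaussian_exp_norm\<close>. The constant dominates the sum 32 + 512 + 16384 of the three
  remainder bounds below.\<close>

lemma exp_minus_cosh_inner_Taylor:
  fixes x w :: "'a::euclidean_space"
  assumes k: "0 \<le> k" "k \<le> 1 / 4"
  shows "\<bar>exp (- (k\<^sup>2 * (norm x)\<^sup>2 / 2)) * cosh (k * (w \<bullet> x)) - (1 - k\<^sup>2 / 2 * ((norm x)\<^sup>2 - (w \<bullet> x)\<^sup>2))\<bar>
    \<le> 20000 * k ^ 4 * exp ((norm x)\<^sup>2 / 4) * exp ((norm w)\<^sup>2 / 4)"
proof -
  define a b s t where "a = norm x" and "b = norm w" and "s = k\<^sup>2 * a\<^sup>2 / 2" and "t = k * (w \<bullet> x)"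
  have ab: "0 \<le> a" "0 \<le> b" by (auto simp: a_def b_def)
  have t: "\<bar>t\<bar> \<le> k * (a * b)"
    using Cauchy_Schwarz_ineq2[of w x] k by (auto simp: t_def a_def b_def abs_mult mult.commute intro!: mult_left_mono)
  have t2: "t\<^sup>2 \<le> k\<^sup>2 * (a\<^sup>2 * b\<^sup>2)" using power_mono[OF t, of 2] by (simp add: power_mult_distrib)
  have t4: "t ^ 4 \<le> k ^ 4 * (a ^ 4 * b ^ 4)" using power_mono[OF t, of 4] by (simp add: power_mult_distrib)
  \<comment> \<open>Half of the allowed exponents: one copy of \<open>?A\<close> and
    \<open>?B\<close> absorbs polynomial growth, the other absorbs \<open>cosh t\<close>.\<close>
  let ?A = "exp (a\<^sup>2 / 8)" and ?B = "exp (b\<^sup>2 / 8)"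
  have p4: "u ^ 4 \<le> 128 * exp (u\<^sup>2 / 8)" for u :: real
  proof -
    have "(u\<^sup>2 / 8)\<^sup>2 = u ^ 4 / 64" by (simp add: power_divide)
    moreover have "1 + u\<^sup>2 / 8 + (u\<^sup>2 / 8)\<^sup>2 / 2 \<le> exp (u\<^sup>2 / 8)" by (rule exp_lower_Taylor_quadratic) simp
    moreover have "0 \<le> u\<^sup>2" by simp
    ultimately show ?thesis by linarith
  qed
  have p2: "u\<^sup>2 \<le> 8 * exp (u\<^sup>2 / 8)" for u :: real
    using exp_ge_add_one_self[of "u\<^sup>2 / 8"] by linarith
  have one: "1 \<le> exp (u\<^sup>2 / 8)" for u :: real by simp
  \<comment> \<open>The bound \<open>k \<le> 1 / 4\<close> is what makes \<open>k * (a * b)\<close>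
    at most the sum of the two exponents.\<close>
  have ch: "cosh t \<le> ?A * ?B"
  proof -
    have "\<bar>t\<bar> \<le> 1 / 4 * (a * b)" using t mult_right_mono[OF k(2), of "a * b"] ab by auto
    also have "\<dots> \<le> a\<^sup>2 / 8 + b\<^sup>2 / 8" using sum_squares_bound[of a b] by simp
    finally have "exp \<bar>t\<bar> \<le> ?A * ?B" by (simp flip: exp_add)
    moreover have "cosh t \<le> exp \<bar>t\<bar>" by (cases "t \<ge> 0") (auto simp: cosh_field_def)
    ultimately show ?thesis by simp
  qed
  have AA: "?A * ?A = exp (a\<^sup>2 / 4)" "?B * ?B = exp (b\<^sup>2 / 4)" by (simp_all flip: exp_add)
  have "s\<^sup>2 = k ^ 4 / 4 * a ^ 4" by (simp add: s_def power_mult_distrib power_divide)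
  also have "\<dots> \<le> k ^ 4 / 4 * ((128 * ?A) * (?A * (?B * ?B)))"
    using p4[of a] mult_mono[OF p4[of a] mult_mono[OF one[of a] mult_mono[OF one[of b] one[of b]]]]
    by (intro mult_left_mono) auto
  finally have 1: "s\<^sup>2 \<le> 32 * k ^ 4 * ((?A * ?A) * (?B * ?B))" by (simp add: mult_ac)
  have "s * t\<^sup>2 \<le> (k\<^sup>2 * a\<^sup>2 / 2) * (k\<^sup>2 * (a\<^sup>2 * b\<^sup>2))"
    unfolding s_def by (intro mult_left_mono t2) auto
  also have "\<dots> = k ^ 4 / 2 * (a ^ 4 * b\<^sup>2)" by (simp add: power4_eq_xxxx power2_eq_square)
  also have "\<dots> \<le> k ^ 4 / 2 * ((128 * ?A * ?A) * (8 * ?B * ?B))"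
  proof (intro mult_left_mono mult_mono)
    show "a ^ 4 \<le> 128 * ?A * ?A" using mult_mono[OF p4[of a] one[of a]] by simp
    show "b\<^sup>2 \<le> 8 * ?B * ?B" using mult_mono[OF p2[of b] one[of b]] by simp
  qed auto
  finally have 2: "s * t\<^sup>2 \<le> 512 * k ^ 4 * ((?A * ?A) * (?B * ?B))" by (simp add: mult_ac)
  have "t ^ 4 * cosh t \<le> (k ^ 4 * ((128 * ?A) * (128 * ?B))) * (?A * ?B)"
    using p4[of a] p4[of b]
    by (intro mult_mono ch order.trans[OF t4] mult_left_mono) (auto simp: cosh_real_nonneg)
  then have 3: "t ^ 4 * cosh t \<le> 16384 * k ^ 4 * ((?A * ?A) * (?B * ?B))" by (simp add: mult_ac)
  have "1 - k\<^sup>2 / 2 * ((norm x)\<^sup>2 - (w \<bullet> x)\<^sup>2) = 1 - s + t\<^sup>2 / 2"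
    by (simp add: s_def t_def a_def power_mult_distrib field_simps)
  then have "\<bar>exp (- s) * cosh t - (1 - k\<^sup>2 / 2 * ((norm x)\<^sup>2 - (w \<bullet> x)\<^sup>2))\<bar> \<le> s\<^sup>2 + s * t\<^sup>2 + t ^ 4 * cosh t"
    using exp_minus_cosh_Taylor[of s t] by (simp add: s_def)
  also have "\<dots> \<le> 20000 * k ^ 4 * ((?A * ?A) * (?B * ?B))"
  proof -
    define X where "X = k ^ 4 * ((?A * ?A) * (?B * ?B))"
    have "0 \<le> X" by (simp add: X_def)
    then show ?thesis using 1 2 3 unfolding mult.assoc[of _ "k ^ 4"] X_def[symmetric] by linarith
  qed
  finally show ?thesis unfolding AA by (simp add: s_def t_def a_def b_def mult.assoc)
qed

section \<open>Moments of subgaussian measures\<close>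

text \<open>The moment generating function is compared with that of the standard Gaussian with
  constant exactly 1. This sharp form gives covariance at most the identity, and also error bounds
  depending only on the dimension.\<close>

definition subgaussian :: "'a::euclidean_space measure \<Rightarrow> bool" where
  "subgaussian M \<longleftrightarrow> prob_space M \<and> sets M = sets borel \<and>
    (\<forall>t. (\<integral>\<^sup>+x. ennreal (exp (t \<bullet> x)) \<partial>M) \<le> ennreal (exp ((norm t)\<^sup>2 / 2)))"

lemma subgaussian_std_gauss: "subgaussian std_gauss"
  by (simp add: subgaussian_def prob_space_std_gauss nn_integral_exp_std_gauss)

text \<open>The factor halves the exponent of the Gaussian, so that the integrand is the standard
  density dilated by \<open>sqrt 2\<close>.\<close>

lemma nn_integral_std_gauss_exp_norm:
  "(\<integral>\<^sup>+x. ennreal (exp ((norm x)\<^sup>2 / 4)) \<partial>(std_gauss :: 'a::euclidean_space measure)) = ennreal (sqrt 2 ^ DIM('a))"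
proof -
  have "(\<integral>\<^sup>+x. ennreal (exp ((norm x)\<^sup>2 / 4)) \<partial>(std_gauss :: 'a measure)) =
    (\<integral>\<^sup>+x. ennreal (std_gauss_density ((1 / sqrt 2) *\<^sub>R x)) \<partial>(lborel :: 'a measure))"
  proof (subst nn_integral_std_gauss, simp, intro nn_integral_cong)
    fix x :: 'a
    have "- (norm x)\<^sup>2 / 2 + (norm x)\<^sup>2 / 4 = - (norm ((1 / sqrt 2) *\<^sub>R x))\<^sup>2 / 2"
      by (simp add: power_divide)
    then show "ennreal (std_gauss_density x) * ennreal (exp ((norm x)\<^sup>2 / 4)) =
        ennreal (std_gauss_density ((1 / sqrt 2) *\<^sub>R x))"
      unfolding std_gauss_density_eq
      by (subst ennreal_mult[symmetric]) (simp_all only: mult.assoc exp_add[symmetric], simp_all)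
  qed
  also have "\<dots> = ennreal (sqrt 2 ^ DIM('a)) * (\<integral>\<^sup>+x. ennreal (std_gauss_density x) \<partial>(lborel :: 'a measure))"
    by (subst nn_integral_lborel_affine[of _ "sqrt 2" 0]) simp_all
  also have "(\<integral>\<^sup>+x. ennreal (std_gauss_density x) \<partial>(lborel :: 'a measure)) = 1"
    using std_gauss.emeasure_space_1[where 'a='a] nn_integral_std_gauss[of "\<lambda>_::'a. 1"] by simp
  finally show ?thesis by simp
qed

text \<open>The function \<open>exp ((norm x)\<^sup>2 / 4)\<close> is the Gaussian average over
  \<open>t\<close> of the exponential of the inner product of \<open>x / sqrt 2\<close> and
  \<open>t\<close>. After exchanging the integrals the defining bound applies for each
  \<open>t\<close>, and what remains is the Gaussian case.\<close>

lemma subgaussian_exp_norm: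
  fixes M :: "'a::euclidean_space measure"
  assumes M: "subgaussian M"
  shows "(\<integral>\<^sup>+x. ennreal (exp ((norm x)\<^sup>2 / 4)) \<partial>M) \<le> ennreal (sqrt 2 ^ DIM('a))"
proof -
  interpret prob_space M using M by (simp add: subgaussian_def)
  interpret pair_sigma_finite M "std_gauss :: 'a measure" ..
  have sM[measurable_cong]: "sets M = sets borel" using M by (simp add: subgaussian_def)
  have le: "(\<integral>\<^sup>+x. ennreal (exp (t \<bullet> x)) \<partial>M) \<le> ennreal (exp ((norm t)\<^sup>2 / 2))" for t
    using M by (simp add: subgaussian_def)
  have n2: "(norm ((1 / sqrt 2) *\<^sub>R x))\<^sup>2 / 2 = (norm x)\<^sup>2 / 4" for x :: 'a
    by (simp add: power_divide)
  have "(\<integral>\<^sup>+x. ennreal (exp ((norm x)\<^sup>2 / 4)) \<partial>M) =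
      (\<integral>\<^sup>+x. \<integral>\<^sup>+t. ennreal (exp (((1 / sqrt 2) *\<^sub>R x) \<bullet> t)) \<partial>std_gauss \<partial>M)"
    by (simp only: nn_integral_exp_std_gauss n2)
  also have "\<dots> = (\<integral>\<^sup>+t. \<integral>\<^sup>+x. ennreal (exp (((1 / sqrt 2) *\<^sub>R x) \<bullet> t)) \<partial>M \<partial>std_gauss)"
    by (rule Fubini'[symmetric]) measurable
  also have "\<dots> = (\<integral>\<^sup>+t. \<integral>\<^sup>+x. ennreal (exp (((1 / sqrt 2) *\<^sub>R t) \<bullet> x)) \<partial>M \<partial>std_gauss)"
    by (simp add: inner_commute)
  also have "\<dots> \<le> (\<integral>\<^sup>+t. ennreal (exp ((norm ((1 / sqrt 2) *\<^sub>R (t::'a)))\<^sup>2 / 2)) \<partial>std_gauss)"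
    by (rule nn_integral_mono) (rule le)
  also have "\<dots> = ennreal (sqrt 2 ^ DIM('a))"
    by (simp only: n2 nn_integral_std_gauss_exp_norm)
  finally show ?thesis .
qed

lemma subgaussian_integrable_exp_norm:
  fixes M :: "'a::euclidean_space measure"
  assumes M: "subgaussian M"
  shows "integrable M (\<lambda>x. exp ((norm x)\<^sup>2 / 4))" and "(\<integral>x. exp ((norm x)\<^sup>2 / 4) \<partial>M) \<le> sqrt 2 ^ DIM('a)"
proof -
  have sM[measurable_cong]: "sets M = sets borel" using M by (simp add: subgaussian_def)
  show i: "integrable M (\<lambda>x. exp ((norm x)\<^sup>2 / 4))"
    using subgaussian_exp_norm[OF M]
    by (intro integrableI_bounded) (auto simp: le_less_trans)
  show "(\<integral>x. exp ((norm x)\<^sup>2 / 4) \<partial>M) \<le> sqrt 2 ^ DIM('a)"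
    using subgaussian_exp_norm[OF M] by (subst (asm) nn_integral_eq_integral[OF i]) (simp_all)
qed

lemma subgaussian_integrable:
  fixes f :: "'a::euclidean_space \<Rightarrow> real"
  assumes M: "subgaussian M" and [measurable]: "f \<in> borel_measurable borel"
    and f: "\<And>x. \<bar>f x\<bar> \<le> K * exp ((norm x)\<^sup>2 / 4)"
  shows "integrable M f"
proof (rule Bochner_Integration.integrable_bound)
  have sM[measurable_cong]: "sets M = sets borel" using M by (simp add: subgaussian_def)
  show "integrable M (\<lambda>x. K * exp ((norm x)\<^sup>2 / 4))"
    using subgaussian_integrable_exp_norm[OF M] by simp
  show "f \<in> borel_measurable M" by measurable
  show "AE x in M. norm (f x) \<le> norm (K * exp ((norm x)\<^sup>2 / 4))"
    using f by (intro always_eventually allI) (metis abs_ge_self order.trans real_norm_def)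
qed

lemma norm2_le_exp_norm: "(norm x)\<^sup>2 \<le> 4 * exp ((norm x)\<^sup>2 / 4)"
  using exp_ge_add_one_self[of "(norm x)\<^sup>2 / 4"] by linarith

lemma inner2_le: "(t \<bullet> x)\<^sup>2 \<le> (norm t)\<^sup>2 * (norm x)\<^sup>2"
  using Cauchy_Schwarz_ineq[of t x] by (simp add: power2_norm_eq_inner)

lemma subgaussian_integrable_norm2:
  assumes M: "subgaussian M"
  shows "integrable M (\<lambda>x. (norm x)\<^sup>2)"
  using norm2_le_exp_norm by (intro subgaussian_integrable[OF M, of _ 4]) auto

lemma subgaussian_integrable_inner2:
  assumes M: "subgaussian M"
  shows "integrable M (\<lambda>x. (t \<bullet> x)\<^sup>2)"
proof (rule subgaussian_integrable[OF M, of _ "(norm t)\<^sup>2 * 4"])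
  show "\<bar>(t \<bullet> x)\<^sup>2\<bar> \<le> (norm t)\<^sup>2 * 4 * exp ((norm x)\<^sup>2 / 4)" for x
    using order.trans[OF inner2_le mult_left_mono[OF norm2_le_exp_norm]] by (simp add: mult.assoc)
qed measurable

lemma le_by_small_linear_error:
  fixes a b c d :: real
  assumes "0 < d" and "\<And>u. 0 < u \<Longrightarrow> u < d \<Longrightarrow> a \<le> b + c * u"
  shows "a \<le> b"
proof (rule tendsto_lowerbound)
  show "((\<lambda>u. b + c * u) \<longlongrightarrow> b) (at_right 0)" by (auto intro!: tendsto_eq_intros)
  show "eventually (\<lambda>u. a \<le> b + c * u) (at_right 0)"
    using assms by (auto simp: eventually_at_right_field intro!: exI[of _ d])
qed auto

lemma subgaussian_cosh:
  assumes M: "subgaussian M"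
  shows "integrable M (\<lambda>x. cosh (t \<bullet> x))" and "(\<integral>x. cosh (t \<bullet> x) \<partial>M) \<le> exp ((norm t)\<^sup>2 / 2)"
proof -
  have sM[measurable_cong]: "sets M = sets borel" using M by (simp add: subgaussian_def)
  have le: "(\<integral>\<^sup>+x. ennreal (exp (u \<bullet> x)) \<partial>M) \<le> ennreal (exp ((norm u)\<^sup>2 / 2))" for u
    using M by (simp add: subgaussian_def)
  have i: "integrable M (\<lambda>x. exp (u \<bullet> x))" for u
    using le[of u] by (intro integrableI_bounded) (auto simp: le_less_trans)
  have e: "(\<integral>x. exp (u \<bullet> x) \<partial>M) \<le> exp ((norm u)\<^sup>2 / 2)" for u
    using le[of u] by (subst (asm) nn_integral_eq_integral[OF i]) simp_all
  have eq: "cosh (t \<bullet> x) = (exp (t \<bullet> x) + exp ((- t) \<bullet> x)) / 2" for x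
    by (simp add: cosh_field_def)
  show "integrable M (\<lambda>x. cosh (t \<bullet> x))"
    unfolding eq using i by (intro integrable_divide Bochner_Integration.integrable_add)
  show "(\<integral>x. cosh (t \<bullet> x) \<partial>M) \<le> exp ((norm t)\<^sup>2 / 2)"
    unfolding eq using e[of t] e[of "- t"] i[of t] i[of "- t"] by simp
qed

text \<open>Coefficients of \<open>u\<close> are compared in the bound on the mean of
  \<open>cosh\<close> at the scaled vector \<open>sqrt u *\<^sub>R t\<close>; \<open>cosh\<close>
  keeps only even moments. Dividing by \<open>u\<close> leaves an error linear in
  \<open>u\<close>.\<close>

lemma subgaussian_variance_le:
  assumes M: "subgaussian M"
  shows "(\<integral>x. (t \<bullet> x)\<^sup>2 \<partial>M) \<le> (norm t)\<^sup>2"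
proof (rule le_by_small_linear_error)
  interpret prob_space M using M by (simp add: subgaussian_def)
  let ?a = "(norm t)\<^sup>2"
  \<comment> \<open>This range keeps the exponent \<open>u * ?a / 2\<close> below 1, as
    \<open>exp_bound\<close> requires.\<close>
  let ?d = "1 / (1 + ?a)"
  show "0 < ?d" by (simp add: add_pos_nonneg)
  fix u assume u: "0 < u" "u < ?d"
  have "1 + u / 2 * (\<integral>x. (t \<bullet> x)\<^sup>2 \<partial>M) = (\<integral>x. 1 + (sqrt u * (t \<bullet> x))\<^sup>2 / 2 \<partial>M)"
    using u subgaussian_integrable_inner2[OF M, of t] prob_space by (simp add: power_mult_distrib)
  also have "\<dots> \<le> (\<integral>x. cosh ((sqrt u *\<^sub>R t) \<bullet> x) \<partial>M)"
    using u subgaussian_integrable_inner2[OF M, of t] subgaussian_cosh[OF M, of "sqrt u *\<^sub>R t"]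
    by (intro integral_mono) (auto intro!: order.trans[OF _ cosh_Taylor(1)] simp del: power_mult_distrib simp: power_mult_distrib[of "sqrt u" "t \<bullet> _"])
  also have "\<dots> \<le> exp (u * ?a / 2)"
    using subgaussian_cosh(2)[OF M, of "sqrt u *\<^sub>R t"] u by (simp add: power_mult_distrib)
  also have "\<dots> \<le> 1 + u * ?a / 2 + (u * ?a / 2)\<^sup>2"
  proof (rule exp_bound)
    have "u * ?a \<le> ?d * ?a" using u by (intro mult_right_mono) auto
    also have "\<dots> \<le> 1" by (simp add: field_simps add_pos_nonneg)
    finally show "u * ?a / 2 \<le> 1" by simp
  qed (use u in auto)
  finally have "u / 2 * (\<integral>x. (t \<bullet> x)\<^sup>2 \<partial>M) \<le> u / 2 * (?a + ?a\<^sup>2 / 2 * u)"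
    by (simp add: power2_eq_square algebra_simps)
  then show "(\<integral>x. (t \<bullet> x)\<^sup>2 \<partial>M) \<le> ?a + ?a\<^sup>2 / 2 * u" using u by simp
qed

text \<open>One direction is the subgaussian bound. For the other, the mean of \<open>cosh\<close>
  is known exactly, and the upper Taylor bound for \<open>cosh\<close> has an integrable
  fourth-order remainder, so the coefficients of \<open>u\<close> can again be compared.\<close>

lemma std_gauss_variance:
  fixes t :: "'a::euclidean_space"
  shows "(\<integral>x. (t \<bullet> x)\<^sup>2 \<partial>std_gauss) = (norm t)\<^sup>2"
proof (rule antisym)
  show "(\<integral>x. (t \<bullet> x)\<^sup>2 \<partial>std_gauss) \<le> (norm t)\<^sup>2"
    by (rule subgaussian_variance_le[OF subgaussian_std_gauss])
  let ?G = "std_gauss :: 'a measure"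
  let ?a = "(norm t)\<^sup>2"
  let ?K = "128 * (?a\<^sup>2 * exp (2 * ?a))"
  define f where "f x = (t \<bullet> x) ^ 4 * cosh (t \<bullet> x)" for x
  \<comment> \<open>The exponent is split in two: one half bounds the fourth power, the other the
    \<open>cosh\<close>.\<close>
  have f_le: "f x \<le> ?K * exp ((norm x)\<^sup>2 / 4)" for x :: 'a
  proof -
    have "(t \<bullet> x) ^ 4 \<le> ?a\<^sup>2 * (norm x) ^ 4"
      using power_mono[OF inner2_le[of t x], of 2] by (simp add: power_mult_distrib)
    also have "\<dots> \<le> ?a\<^sup>2 * (128 * exp ((norm x)\<^sup>2 / 8))"
    proof (intro mult_left_mono)
      have "((norm x)\<^sup>2 / 8)\<^sup>2 = norm x ^ 4 / 64" by (simp add: power_divide)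
      moreover have "1 + (norm x)\<^sup>2 / 8 + ((norm x)\<^sup>2 / 8)\<^sup>2 / 2 \<le> exp ((norm x)\<^sup>2 / 8)"
        by (rule exp_lower_Taylor_quadratic) simp
      moreover have "0 \<le> (norm x)\<^sup>2" by simp
      ultimately show "norm x ^ 4 \<le> 128 * exp ((norm x)\<^sup>2 / 8)" by linarith
    qed simp
    finally have 1: "(t \<bullet> x) ^ 4 \<le> ?a\<^sup>2 * (128 * exp ((norm x)\<^sup>2 / 8))" .
    have "\<bar>t \<bullet> x\<bar> \<le> norm t * norm x" by (rule Cauchy_Schwarz_ineq2)
    also have "\<dots> \<le> 2 * ?a + (norm x)\<^sup>2 / 8"
      using sum_squares_bound[of "4 * norm t" "norm x"] by (simp add: power_mult_distrib)
    finally have "exp \<bar>t \<bullet> x\<bar> \<le> exp (2 * ?a) * exp ((norm x)\<^sup>2 / 8)" by (simp flip: exp_add)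
    moreover have "cosh (t \<bullet> x) \<le> exp \<bar>t \<bullet> x\<bar>" by (cases "t \<bullet> x \<ge> 0") (auto simp: cosh_field_def)
    ultimately have 2: "cosh (t \<bullet> x) \<le> exp (2 * ?a) * exp ((norm x)\<^sup>2 / 8)" by simp
    have "f x \<le> (?a\<^sup>2 * (128 * exp ((norm x)\<^sup>2 / 8))) * (exp (2 * ?a) * exp ((norm x)\<^sup>2 / 8))"
      unfolding f_def using 1 2 by (intro mult_mono) (auto simp: cosh_real_nonneg)
    also have "\<dots> = ?K * (exp ((norm x)\<^sup>2 / 8) * exp ((norm x)\<^sup>2 / 8))" by (simp add: mult_ac)
    also have "exp ((norm x)\<^sup>2 / 8) * exp ((norm x)\<^sup>2 / 8) = exp ((norm x)\<^sup>2 / 4)" by (simp flip: exp_add)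
    finally show ?thesis .
  qed
  have f0: "0 \<le> f x" for x by (simp add: f_def cosh_real_nonneg)
  have fi: "integrable ?G f"
  proof (rule subgaussian_integrable[OF subgaussian_std_gauss])
    show "f \<in> borel_measurable borel" unfolding f_def[abs_def] cosh_field_def by measurable
    show "\<bar>f x\<bar> \<le> ?K * exp ((norm x)\<^sup>2 / 4)" for x using f_le[of x] f0[of x] by simp
  qed
  define C where "C = (\<integral>x. f x \<partial>?G)"
  show "(norm t)\<^sup>2 \<le> (\<integral>x. (t \<bullet> x)\<^sup>2 \<partial>std_gauss)"
  proof (rule le_by_small_linear_error[of 1 _ _ "2 * C"])
    fix u :: real assume u: "0 < u" "u < 1"
    have n2: "(norm (sqrt u *\<^sub>R t))\<^sup>2 = u * ?a" using u by (simp add: power_mult_distrib)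
    have i1: "integrable ?G (\<lambda>x. exp (s \<bullet> x))" for s
      by (intro integrableI_bounded) (auto simp: nn_integral_exp_std_gauss)
    have "(\<integral>x. exp (s \<bullet> x) \<partial>?G) = exp ((norm s)\<^sup>2 / 2)" for s
      using nn_integral_exp_std_gauss[of s] by (subst (asm) nn_integral_eq_integral[OF i1]) simp_all
    note i2 = this[of "sqrt u *\<^sub>R t"] this[of "- (sqrt u *\<^sub>R t)"]
    have eq: "cosh (sqrt u * (t \<bullet> x)) = (exp ((sqrt u *\<^sub>R t) \<bullet> x) + exp ((- (sqrt u *\<^sub>R t)) \<bullet> x)) / 2" for x
      by (simp add: cosh_field_def)
    have ic: "integrable ?G (\<lambda>x. cosh (sqrt u * (t \<bullet> x)))"
      unfolding eq by (intro integrable_divide Bochner_Integration.integrable_add i1)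
    have "1 + u * ?a / 2 \<le> exp (u * ?a / 2)" by (rule exp_ge_add_one_self)
    also have "\<dots> = (\<integral>x. cosh (sqrt u * (t \<bullet> x)) \<partial>?G)"
      unfolding eq using i1 i2 n2 by (simp only: integral_divide_zero Bochner_Integration.integral_add norm_minus_cancel) simp
    also have "\<dots> \<le> (\<integral>x. 1 + u / 2 * (t \<bullet> x)\<^sup>2 + u\<^sup>2 * f x \<partial>?G)"
    proof (intro integral_mono ic)
      show "integrable ?G (\<lambda>x. 1 + u / 2 * (t \<bullet> x)\<^sup>2 + u\<^sup>2 * f x)"
        using fi subgaussian_integrable_inner2[OF subgaussian_std_gauss, of t] by simp
      fix x
      have "\<bar>sqrt u * (t \<bullet> x)\<bar> \<le> \<bar>t \<bullet> x\<bar>" using u by (simp add: abs_mult mult_left_le_one_le)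
      then have "cosh (sqrt u * (t \<bullet> x)) \<le> cosh (t \<bullet> x)"
        using cosh_real_nonneg_le_iff[of "\<bar>sqrt u * (t \<bullet> x)\<bar>" "\<bar>t \<bullet> x\<bar>"] by (simp only: cosh_real_abs abs_ge_zero)
      then have "(sqrt u * (t \<bullet> x)) ^ 4 * cosh (sqrt u * (t \<bullet> x)) \<le> (sqrt u * (t \<bullet> x)) ^ 4 * cosh (t \<bullet> x)"
        by (intro mult_left_mono) auto
      also have "\<dots> = u\<^sup>2 * f x"
      proof -
        have "sqrt u ^ 4 = u\<^sup>2" using u by (simp add: power4_eq_xxxx power2_eq_square mult.assoc[symmetric])
        then show ?thesis by (simp add: f_def power_mult_distrib)
      qed
      finally have "cosh (sqrt u * (t \<bullet> x)) \<le> 1 + (sqrt u * (t \<bullet> x))\<^sup>2 / 2 + u\<^sup>2 * f x"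
        using cosh_Taylor(2)[of "sqrt u * (t \<bullet> x)"] by linarith
      then show "cosh (sqrt u * (t \<bullet> x)) \<le> 1 + u / 2 * (t \<bullet> x)\<^sup>2 + u\<^sup>2 * f x"
        using u by (simp add: power_mult_distrib)
    qed
    also have "\<dots> = 1 + u / 2 * (\<integral>x. (t \<bullet> x)\<^sup>2 \<partial>?G) + u\<^sup>2 * C"
      using fi subgaussian_integrable_inner2[OF subgaussian_std_gauss, of t] std_gauss.prob_space
      by (simp add: C_def)
    finally have "u / 2 * ?a \<le> u / 2 * ((\<integral>x. (t \<bullet> x)\<^sup>2 \<partial>?G) + 2 * C * u)"
      by (simp add: power2_eq_square algebra_simps)
    then show "?a \<le> (\<integral>x. (t \<bullet> x)\<^sup>2 \<partial>?G) + 2 * C * u" using u by simp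
  qed simp
qed

text \<open>Gaussian elimination (completing the square) along the basis vectors in \<open>B\<close>; division by zero
  makes the elimination step trivial when \<open>b e e = 0\<close>.\<close>

lemma psd_form_sum_of_squares_aux:
  fixes b :: "'a::euclidean_space \<Rightarrow> 'a \<Rightarrow> real"
  assumes "finite B" "B \<subseteq> Basis"
    and "\<And>y. linear (\<lambda>x. b x y)" and "\<And>x y. b x y = b y x" and "\<And>x. 0 \<le> b x x"
    and "\<And>x e. e \<in> Basis - B \<Longrightarrow> b x e = 0"
  shows "\<exists>v. \<forall>x. b x x = (\<Sum>e\<in>B. (v e \<bullet> x)\<^sup>2)"
  using assms
proof (induction B arbitrary: b rule: finite_induct)
  case empty
  have "linear (b x)" for x
    using empty.prems(2)[of x] empty.prems(3)[of _ x] by (simp add: fun_eq_iff[symmetric] eta_contract_eq)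
  then have "b x x = (\<Sum>e\<in>Basis. (x \<bullet> e) * b x e)" for x
    using linear_sum[of "b x" "\<lambda>e. (x \<bullet> e) *\<^sub>R e" Basis]
    by (simp add: euclidean_representation linear_scale)
  then show ?case using empty.prems(5) by simp
next
  case (insert e B)
  note lin = insert.prems(2) and sym = insert.prems(3) and psd = insert.prems(4)
  have expand: "b (x + c *\<^sub>R e) (x + c *\<^sub>R e) = b x x + 2 * c * b x e + c\<^sup>2 * b e e" for x c
  proof -
    have l: "b (x + c *\<^sub>R e) y = b x y + c * b e y" for y
      using linear_add[OF lin, of x "c *\<^sub>R e" y] linear_scale[OF lin, of c e y] by simp
    have r: "b y (x + c *\<^sub>R e) = b y x + c * b y e" for y
      using l[of y] sym[of y "x + c *\<^sub>R e"] sym[of y x] sym[of y e] by simp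
    show ?thesis
      using sym[of e x] by (simp add: l r power2_eq_square algebra_simps)
  qed
  \<comment> \<open>Along the line through \<open>x\<close> in direction \<open>e\<close> the form
    is then affine; with nonzero slope it would take the value -1 at the chosen point.\<close>
  have CS0: "b x e = 0" if "b e e = 0" for x
  proof (rule ccontr)
    assume "b x e \<noteq> 0"
    then show False
      using psd[of "x + (- (b x x + 1) / (2 * b x e)) *\<^sub>R e"] that unfolding expand by (simp add: field_simps)
  qed
  \<comment> \<open>The Schur complement: \<open>e\<close> is split off, so that \<open>e\<close>
    joins the vectors annihilated by the form.\<close>
  define b' where "b' x y = b x y - b x e * b y e / b e e" for x y
  have "\<exists>v. \<forall>x. b' x x = (\<Sum>e\<in>B. (v e \<bullet> x)\<^sup>2)"
  proof (rule insert.IH[of b'])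
    show "linear (\<lambda>x. b' x y)" for y
      unfolding b'_def
      using linear_compose_sub[OF lin[of y] linear_compose_scale_right[OF lin[of e], of "b y e / b e e"]]
      by (simp add: mult.commute)
    show "b' x y = b' y x" for x y
      unfolding b'_def using sym[of x y] by (simp add: mult.commute)
    show "0 \<le> b' x x" for x
    proof (cases "b e e = 0")
      case False
      then show ?thesis
        using psd[of "x + (- b x e / b e e) *\<^sub>R e"] unfolding expand b'_def
        by (simp add: power2_eq_square field_simps)
    qed (use psd[of x] in \<open>simp add: b'_def\<close>)
    show "b' x d = 0" if "d \<in> Basis - B" for x d
    proof (cases "d = e")
      case True
      then show ?thesis using CS0[of x] by (cases "b e e = 0") (auto simp: b'_def)
    next
      case False
      then have "b y d = 0" for y using insert.prems(5) that by blast
      then show ?thesis using sym[of d e] by (simp add: b'_def)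
    qed
  qed (use insert.prems(1) in auto)
  then obtain v where v: "\<And>x. b' x x = (\<Sum>e\<in>B. (v e \<bullet> x)\<^sup>2)" by blast
  define w where "w = (\<Sum>i\<in>Basis. (b i e / sqrt (b e e)) *\<^sub>R i)"
  have w: "w \<bullet> x = b x e / sqrt (b e e)" for x
  proof -
    have "b x e = (\<Sum>i\<in>Basis. (x \<bullet> i) * b i e)"
      using linear_sum[OF lin[of e], of "\<lambda>i. (x \<bullet> i) *\<^sub>R i" Basis]
      by (simp add: euclidean_representation linear_scale[OF lin])
    then show ?thesis
      by (simp add: w_def inner_sum_left sum_divide_distrib inner_commute[of x] mult.commute)
  qed
  have "b x x = (\<Sum>d\<in>insert e B. ((v(e := w)) d \<bullet> x)\<^sup>2)" for x
  proof -
    have "(\<Sum>d\<in>insert e B. ((v(e := w)) d \<bullet> x)\<^sup>2) = (w \<bullet> x)\<^sup>2 + (\<Sum>d\<in>B. (v d \<bullet> x)\<^sup>2)"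
      using insert.hyps by (simp, intro sum.cong) auto
    also have "\<dots> = b x x"
      using psd[of e] by (simp add: v[symmetric] w power_divide) (simp add: b'_def power2_eq_square)
    finally show ?thesis ..
  qed
  then show ?case by blast
qed

lemma psd_form_sum_of_squares:
  fixes b :: "'a::euclidean_space \<Rightarrow> 'a \<Rightarrow> real"
  assumes "\<And>y. linear (\<lambda>x. b x y)" and "\<And>x y. b x y = b y x" and "\<And>x. 0 \<le> b x x"
  obtains v :: "'a \<Rightarrow> 'a" where "\<And>x. b x x = (\<Sum>e\<in>Basis. (v e \<bullet> x)\<^sup>2)"
proof -
  have "\<exists>v. \<forall>x. b x x = (\<Sum>e\<in>(Basis::'a set). (v e \<bullet> x)\<^sup>2)"
    by (rule psd_form_sum_of_squares_aux) (use assms in auto)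
  then show thesis using that by blast
qed

section \<open>Second-order comparison with the Gaussian\<close>

text \<open>The identity minus the covariance of \<open>N\<close> is positive semidefinite by
  \<open>subgaussian_variance_le\<close>. Writing it as a sum of squares turns its trace against
  another covariance into a sum of variances in fixed directions.\<close>

lemma subgaussian_covariance_defect:
  fixes N :: "'a::euclidean_space measure"
  assumes N: "subgaussian N"
  obtains v :: "'a \<Rightarrow> 'a" where "\<And>x. (norm x)\<^sup>2 - (\<integral>w. (w \<bullet> x)\<^sup>2 \<partial>N) = (\<Sum>e\<in>Basis. (v e \<bullet> x)\<^sup>2)"
proof -
  have i: "integrable N (\<lambda>w. (w \<bullet> x) * (w \<bullet> y))" for x y
  proof -
    have eq: "(w \<bullet> x) * (w \<bullet> y) = (((x + y) \<bullet> w)\<^sup>2 - (x \<bullet> w)\<^sup>2 - (y \<bullet> w)\<^sup>2) / 2" for w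
      by (simp add: inner_add_left inner_add_right power2_eq_square inner_commute algebra_simps)
    show ?thesis unfolding eq
      by (intro integrable_divide Bochner_Integration.integrable_diff subgaussian_integrable_inner2[OF N])
  qed
  define b where "b x y = x \<bullet> y - (\<integral>w. (w \<bullet> x) * (w \<bullet> y) \<partial>N)" for x y
  have lin: "linear (\<lambda>x. b x y)" for y
    by (rule linearI) (simp_all add: b_def inner_add_left inner_add_right ring_distribs i mult.assoc)
  have b: "b x x = (norm x)\<^sup>2 - (\<integral>w. (w \<bullet> x)\<^sup>2 \<partial>N)" for x
    by (simp add: b_def dot_square_norm) (simp add: power2_eq_square)
  have psd: "0 \<le> b x x" for x
    using subgaussian_variance_le[OF N, of x] b[of x] by (simp add: inner_commute)
  have sym: "b x y = b y x" for x y
    unfolding b_def inner_commute[of x y] by (simp only: mult.commute)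
  obtain v :: "'a \<Rightarrow> 'a" where "\<And>x. b x x = (\<Sum>e\<in>Basis. (v e \<bullet> x)\<^sup>2)"
    using psd_form_sum_of_squares[of b, OF lin sym psd] by blast
  then show ?thesis using that b by simp
qed

text \<open>After integration over \<open>N\<close>, the kernel is
  \<open>1 - k\<^sup>2 / 2 * q x\<close> up to order \<open>k ^ 4\<close>, where \<open>q\<close> is
  the covariance defect of \<open>N\<close>. Since \<open>q\<close> is a sum of squares, its mean
  under \<open>M\<close> is at most its Gaussian mean, so the second-order terms have the favourable
  sign.\<close>

theorem subgaussian_small_scale_comparison:
  fixes M N :: "'a::euclidean_space measure"
  assumes M: "subgaussian M" and N: "subgaussian N" and k: "0 \<le> k" "k \<le> 1 / 4"
  defines "E \<equiv> \<lambda>x w. exp (- (k\<^sup>2 * (norm x)\<^sup>2 / 2)) * cosh (k * (w \<bullet> x))"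
  shows "integrable M (\<lambda>x. \<integral>w. E x w \<partial>N)"
    and "\<And>x. integrable N (E x)"
    and "(\<integral>x. \<integral>w. E x w \<partial>N \<partial>std_gauss) \<le> (\<integral>x. \<integral>w. E x w \<partial>N \<partial>M) + 40000 * 2 ^ DIM('a) * k ^ 4"
proof -
  interpret N: prob_space N using N by (simp add: subgaussian_def)
  have sN[measurable_cong]: "sets N = sets borel" using N by (simp add: subgaussian_def)
  let ?m = "sqrt 2 ^ DIM('a) :: real"
  obtain v :: "'a \<Rightarrow> 'a" where v: "\<And>x. (norm x)\<^sup>2 - (\<integral>w. (w \<bullet> x)\<^sup>2 \<partial>N) = (\<Sum>e\<in>Basis. (v e \<bullet> x)\<^sup>2)"
    using subgaussian_covariance_defect[OF N] by blast
  define q where "q x = (\<Sum>e\<in>Basis. (v e \<bullet> x)\<^sup>2)" for x :: 'a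
  define H where "H x = (\<integral>w. E x w \<partial>N)" for x
  have [measurable]: "case_prod E \<in> borel_measurable (borel \<Otimes>\<^sub>M borel)"
    unfolding E_def cosh_field_def by measurable
  have [measurable]: "case_prod E \<in> borel_measurable (borel \<Otimes>\<^sub>M N)" by measurable
  have Hm[measurable]: "H \<in> borel_measurable borel"
    unfolding H_def[abs_def] by (rule N.borel_measurable_lebesgue_integral) measurable
  have i2: "integrable N (\<lambda>w. (w \<bullet> x)\<^sup>2)" for x
    using subgaussian_integrable_inner2[OF N, of x] by (simp add: inner_commute)
  have Tay: "\<bar>E x w - (1 - k\<^sup>2 / 2 * ((norm x)\<^sup>2 - (w \<bullet> x)\<^sup>2))\<bar> \<le>
      20000 * k ^ 4 * exp ((norm x)\<^sup>2 / 4) * exp ((norm w)\<^sup>2 / 4)" for x w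
    unfolding E_def by (rule exp_minus_cosh_inner_Taylor[OF k])
  have iD: "integrable N (\<lambda>w. E x w - (1 - k\<^sup>2 / 2 * ((norm x)\<^sup>2 - (w \<bullet> x)\<^sup>2)))" for x
    by (rule subgaussian_integrable[OF N _ Tay]) measurable
  have iT: "integrable N (\<lambda>w. 1 - k\<^sup>2 / 2 * ((norm x)\<^sup>2 - (w \<bullet> x)\<^sup>2))" for x
    using i2[of x] by simp
  show iE: "integrable N (E x)" for x
    using Bochner_Integration.integrable_add[OF iD[of x] iT[of x]] by simp
  have HT: "\<bar>H x - (1 - k\<^sup>2 / 2 * q x)\<bar> \<le> 20000 * k ^ 4 * ?m * exp ((norm x)\<^sup>2 / 4)" for x
  proof -
    have "1 - k\<^sup>2 / 2 * q x = (\<integral>w. 1 - k\<^sup>2 / 2 * ((norm x)\<^sup>2 - (w \<bullet> x)\<^sup>2) \<partial>N)"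
      using i2[of x] N.prob_space by (simp add: q_def v[symmetric])
    then have "H x - (1 - k\<^sup>2 / 2 * q x) = (\<integral>w. E x w - (1 - k\<^sup>2 / 2 * ((norm x)\<^sup>2 - (w \<bullet> x)\<^sup>2)) \<partial>N)"
      unfolding H_def by (simp only: Bochner_Integration.integral_diff[OF iE iT])
    also have "\<bar>\<dots>\<bar> \<le> (\<integral>w. \<bar>E x w - (1 - k\<^sup>2 / 2 * ((norm x)\<^sup>2 - (w \<bullet> x)\<^sup>2))\<bar> \<partial>N)"
      by (rule integral_abs_bound)
    also have "\<dots> \<le> (\<integral>w. 20000 * k ^ 4 * exp ((norm x)\<^sup>2 / 4) * exp ((norm w)\<^sup>2 / 4) \<partial>N)"
      using subgaussian_integrable_exp_norm(1)[OF N] by (intro integral_mono integrable_abs iD Tay) simp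
    also have "\<dots> = 20000 * k ^ 4 * exp ((norm x)\<^sup>2 / 4) * (\<integral>w. exp ((norm w)\<^sup>2 / 4) \<partial>N)" by simp
    also have "\<dots> \<le> 20000 * k ^ 4 * exp ((norm x)\<^sup>2 / 4) * ?m"
      by (intro mult_left_mono subgaussian_integrable_exp_norm N) auto
    finally show ?thesis by (simp add: mult_ac)
  qed
  \<comment> \<open>This is applied to \<open>M\<close> and to \<open>std_gauss\<close>. Integrating
    the exponential error over \<open>N\<close> and over \<open>L\<close> gives a factor
    \<open>?m\<close> each time, hence \<open>2 ^ DIM('a)\<close>, and the two applications together
    give 40000.\<close>
  have main: "integrable L H \<and> \<bar>(\<integral>x. H x \<partial>L) - (1 - k\<^sup>2 / 2 * (\<integral>x. q x \<partial>L))\<bar> \<le> 20000 * 2 ^ DIM('a) * k ^ 4"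
    if L: "subgaussian L" for L :: "'a measure"
  proof -
    interpret L: prob_space L using L by (simp add: subgaussian_def)
    have iq: "integrable L q"
      unfolding q_def[abs_def] by (intro Bochner_Integration.integrable_sum subgaussian_integrable_inner2[OF L])
    then have iq': "integrable L (\<lambda>x. 1 - k\<^sup>2 / 2 * q x)" by simp
    have [measurable]: "q \<in> borel_measurable borel" unfolding q_def[abs_def] by measurable
    have iD: "integrable L (\<lambda>x. H x - (1 - k\<^sup>2 / 2 * q x))"
      by (rule subgaussian_integrable[OF L _ HT]) measurable
    have iH: "integrable L H"
      using Bochner_Integration.integrable_add[OF iD iq'] by simp
    have "(1 - k\<^sup>2 / 2 * (\<integral>x. q x \<partial>L)) = (\<integral>x. 1 - k\<^sup>2 / 2 * q x \<partial>L)"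
      using iq L.prob_space by simp
    then have "(\<integral>x. H x \<partial>L) - (1 - k\<^sup>2 / 2 * (\<integral>x. q x \<partial>L)) = (\<integral>x. H x - (1 - k\<^sup>2 / 2 * q x) \<partial>L)"
      by (simp only: Bochner_Integration.integral_diff[OF iH iq'])
    also have "\<bar>\<dots>\<bar> \<le> (\<integral>x. \<bar>H x - (1 - k\<^sup>2 / 2 * q x)\<bar> \<partial>L)"
      by (rule integral_abs_bound)
    also have "\<dots> \<le> (\<integral>x. 20000 * k ^ 4 * ?m * exp ((norm x)\<^sup>2 / 4) \<partial>L)"
      using subgaussian_integrable_exp_norm(1)[OF L] by (intro integral_mono integrable_abs iD HT) simp
    also have "\<dots> = 20000 * k ^ 4 * ?m * (\<integral>x. exp ((norm x)\<^sup>2 / 4) \<partial>L)" by simp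
    also have "\<dots> \<le> 20000 * k ^ 4 * ?m * ?m"
      by (intro mult_left_mono subgaussian_integrable_exp_norm L) auto
    also have "\<dots> = 20000 * 2 ^ DIM('a) * k ^ 4"
      by (simp add: mult_ac flip: power_mult_distrib)
    finally show ?thesis using iH by simp
  qed
  show "integrable M (\<lambda>x. \<integral>w. E x w \<partial>N)" using main[OF M] by (simp add: H_def[abs_def])
  have "(\<integral>x. q x \<partial>M) \<le> (\<integral>x. q x \<partial>std_gauss)"
    unfolding q_def
    by (simp add: subgaussian_integrable_inner2 M subgaussian_std_gauss std_gauss_variance)
      (intro sum_mono subgaussian_variance_le M)
  then have "k\<^sup>2 / 2 * (\<integral>x. q x \<partial>M) \<le> k\<^sup>2 / 2 * (\<integral>x. q x \<partial>std_gauss)" by (intro mult_left_mono) auto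
  then have "(\<integral>x. H x \<partial>std_gauss) \<le> (\<integral>x. H x \<partial>M) + 40000 * 2 ^ DIM('a) * k ^ 4"
    using main[OF M] main[OF subgaussian_std_gauss] by linarith
  then show "(\<integral>x. \<integral>w. E x w \<partial>N \<partial>std_gauss) \<le> (\<integral>x. \<integral>w. E x w \<partial>N \<partial>M) + 40000 * 2 ^ DIM('a) * k ^ 4"
    by (simp add: H_def)
qed

section \<open>Even log-concave functions\<close>

lemma emeasure_std_gauss_UNIV[simp]: "emeasure std_gauss UNIV = 1"
  using std_gauss.emeasure_space_1 by simp

text \<open>Log-concavity is stated for midpoints, the form that the Prekopa-Leindler inequality
  passes to marginals. Finiteness at 0 gives a finite bound everywhere, because 0 is a maximum point
  (\<open>even_log_concave_le_0\<close>).\<close>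

definition even_log_concave :: "('a::euclidean_space \<Rightarrow> ennreal) \<Rightarrow> bool" where
  "even_log_concave f \<longleftrightarrow> f \<in> borel_measurable borel \<and> (\<forall>x. f (- x) = f x) \<and>
    (\<forall>x y. f x * f y \<le> (f (midpoint x y))\<^sup>2) \<and> f 0 < top"

lemma even_log_concaveD:
  assumes "even_log_concave f"
  shows "f \<in> borel_measurable borel" "f (- x) = f x" "f x * f y \<le> (f (midpoint x y))\<^sup>2" "f 0 < top"
  using assms by (auto simp: even_log_concave_def)

lemma even_log_concave_le_0:
  assumes f: "even_log_concave f"
  shows "f x \<le> f 0"
proof -
  \<comment> \<open>The origin is the midpoint of \<open>x\<close> and \<open>- x\<close>, where
    \<open>f\<close> takes equal values.\<close>
  have "(f x)\<^sup>2 \<le> (f 0)\<^sup>2"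
    using even_log_concaveD(3)[OF f, of x "- x"] even_log_concaveD(2)[OF f, of x]
    by (simp add: power2_eq_square midpoint_def)
  then show ?thesis by (simp add: ennreal_power2_le_iff)
qed

lemma even_log_concave_const: "c < top \<Longrightarrow> even_log_concave (\<lambda>_. c)"
  by (simp add: even_log_concave_def power2_eq_square)

abbreviation mass :: "('a::euclidean_space \<Rightarrow> ennreal) \<Rightarrow> ennreal" where
  "mass f \<equiv> (\<integral>\<^sup>+x. f x \<partial>std_gauss)"

lemma mass_le: "(\<And>x. f x \<le> c) \<Longrightarrow> mass f \<le> c"
  using nn_integral_mono[of std_gauss f "\<lambda>_. c"] by (simp add: emeasure_std_gauss_UNIV)

lemma mass_finite:
  assumes "even_log_concave f"
  shows "mass f < top"
  using mass_le[OF even_log_concave_le_0[OF assms]] even_log_concaveD(4)[OF assms]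
  by (rule order.strict_trans1)

lemma midpoint_linear:
  assumes "linear h"
  shows "midpoint (h x) (h y) = h (midpoint x y)"
  using assms by (simp add: midpoint_def linear_add linear_scale)

text \<open>Prekopa-Leindler is applied to the sections of \<open>F\<close>; evenness follows by
  reflecting the integration variable.\<close>

lemma even_log_concave_marginal:
  fixes F :: "'a::euclidean_space \<Rightarrow> 'b::euclidean_space \<Rightarrow> ennreal"
  assumes [measurable]: "case_prod F \<in> borel_measurable (borel \<Otimes>\<^sub>M borel)"
    and even: "\<And>u v. F (- u) (- v) = F u v"
    and lc: "\<And>u u' v v'. F u v * F u' v' \<le> (F (midpoint u u') (midpoint v v'))\<^sup>2"
    and fin: "mass (F 0) < top"
  shows "even_log_concave (\<lambda>u. mass (F u))"
  unfolding even_log_concave_def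
proof (intro conjI allI)
  show "(\<lambda>u. mass (F u)) \<in> borel_measurable borel" by measurable
  fix u u'
  show "mass (F (- u)) = mass (F u)"
    using nn_integral_std_gauss_uminus[of "F (- u)"] by (simp add: even)
  show "mass (F u) * mass (F u') \<le> (mass (F (midpoint u u')))\<^sup>2"
    by (rule Prekopa_Leindler_std_gauss) (simp_all add: lc)
qed (fact fin)

lemma even_log_concave_comp_linear:
  assumes f: "even_log_concave f" and h: "linear h"
  shows "even_log_concave (\<lambda>x. f (h x))"
proof -
  have [measurable]: "h \<in> borel_measurable borel"
    using h by (intro borel_measurable_continuous_onI linear_continuous_on) (simp add: linear_conv_bounded_linear)
  have [measurable]: "f \<in> borel_measurable borel" by (rule even_log_concaveD[OF f])
  show ?thesis
    unfolding even_log_concave_def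
    using even_log_concaveD[OF f] h
    by (auto simp: linear_neg linear_0 midpoint_linear[OF h, symmetric])
qed

section \<open>Rotated pairs, self-convolution and smearing\<close>

definition rotation_pair :: "('a::euclidean_space \<Rightarrow> ennreal) \<Rightarrow> 'a \<Rightarrow> 'a \<Rightarrow> ennreal" where
  "rotation_pair f u v = f ((1 / sqrt 2) *\<^sub>R (u + v)) * f ((1 / sqrt 2) *\<^sub>R (u - v))"

text \<open>The operator \<open>T\<close> of the overview without normalisation: integrating out the
  second rotated variable gives the density of the normalised sum with respect to the Gaussian
  measure.\<close>

definition self_conv :: "('a::euclidean_space \<Rightarrow> ennreal) \<Rightarrow> 'a \<Rightarrow> ennreal" where
  "self_conv f u = mass (rotation_pair f u)"

text \<open>A Gaussian average around \<open>k *\<^sub>R x\<close> with unit noise. The noise keeps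
  unit size while \<open>k\<close> shrinks, so a small \<open>k\<close> means a small influence of
  \<open>x\<close>.\<close>

definition smear :: "real \<Rightarrow> ('a::euclidean_space \<Rightarrow> ennreal) \<Rightarrow> 'a \<Rightarrow> ennreal" where
  "smear k g x = (\<integral>\<^sup>+w. g (k *\<^sub>R x + w) \<partial>std_gauss)"

text \<open>This absorbs a summand with weight \<open>f\<close> into the test function
  \<open>g\<close>; taking \<open>f\<close> constant 1 makes that summand Gaussian.\<close>

definition mix :: "real \<Rightarrow> ('a::euclidean_space \<Rightarrow> ennreal) \<Rightarrow> ('a \<Rightarrow> ennreal) \<Rightarrow> 'a \<Rightarrow> ennreal" where
  "mix k f g w = (\<integral>\<^sup>+y. f y * g (w + k *\<^sub>R y) \<partial>std_gauss)"

lemma nn_integral_std_gauss_rotate45: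
  fixes F :: "'a::euclidean_space \<Rightarrow> 'a \<Rightarrow> ennreal"
  assumes [measurable]: "case_prod F \<in> borel_measurable (borel \<Otimes>\<^sub>M borel)"
  shows "(\<integral>\<^sup>+u. \<integral>\<^sup>+v. F ((1 / sqrt 2) *\<^sub>R (u + v)) ((1 / sqrt 2) *\<^sub>R (u - v)) \<partial>std_gauss \<partial>std_gauss) =
    (\<integral>\<^sup>+x. \<integral>\<^sup>+y. F x y \<partial>std_gauss \<partial>std_gauss)"
proof -
  let ?c = "1 / sqrt 2 :: real"
  have "(\<integral>\<^sup>+u. \<integral>\<^sup>+v. F (?c *\<^sub>R (u + v)) (?c *\<^sub>R (u - v)) \<partial>std_gauss \<partial>std_gauss) =
      (\<integral>\<^sup>+u. \<integral>\<^sup>+v. F (?c *\<^sub>R u + ?c *\<^sub>R v) (- (?c *\<^sub>R v - ?c *\<^sub>R u)) \<partial>std_gauss \<partial>std_gauss)"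
    by (simp add: scaleR_add_right scaleR_diff_right)
  \<comment> \<open>The map is a reflection, so it is factored into a rotation and a sign change of
    the second variable.\<close>
  also have "\<dots> = (\<integral>\<^sup>+x. \<integral>\<^sup>+y. F x (- y) \<partial>std_gauss \<partial>std_gauss)"
    by (rule nn_integral_std_gauss_rotate[of "\<lambda>x y. F x (- y)" ?c ?c])
      (simp_all add: power_divide)
  also have "\<dots> = (\<integral>\<^sup>+x. \<integral>\<^sup>+y. F x y \<partial>std_gauss \<partial>std_gauss)"
    by (intro nn_integral_cong nn_integral_std_gauss_uminus) measurable
  finally show ?thesis .
qed

lemma std_gauss_Fubini:
  fixes F :: "'a::euclidean_space \<Rightarrow> 'b::euclidean_space \<Rightarrow> ennreal"
  assumes "case_prod F \<in> borel_measurable (borel \<Otimes>\<^sub>M borel)"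
  shows "(\<integral>\<^sup>+x. \<integral>\<^sup>+y. F x y \<partial>std_gauss \<partial>std_gauss) = (\<integral>\<^sup>+y. \<integral>\<^sup>+x. F x y \<partial>std_gauss \<partial>std_gauss)"
proof -
  interpret pair_sigma_finite "std_gauss :: 'b measure" "std_gauss :: 'a measure" ..
  show ?thesis by (rule Fubini') (use assms in measurable)
qed

lemma log_concave_mult:
  fixes a b c d :: ennreal
  assumes "a * b \<le> p\<^sup>2" "c * d \<le> q\<^sup>2"
  shows "(a * c) * (b * d) \<le> (p * q)\<^sup>2"
proof -
  have "(a * c) * (b * d) = (a * b) * (c * d)" by (simp add: ac_simps)
  also have "\<dots> \<le> p\<^sup>2 * q\<^sup>2" by (intro mult_mono assms) auto
  finally show ?thesis by (simp add: power_mult_distrib)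
qed

lemma measurable_rotation_pair[measurable]:
  fixes f :: "'a::euclidean_space \<Rightarrow> ennreal"
  assumes [measurable]: "f \<in> borel_measurable borel"
  shows "case_prod (rotation_pair f) \<in> borel_measurable (borel \<Otimes>\<^sub>M borel)"
  unfolding rotation_pair_def by measurable

lemma rotation_pair_log_concave:
  assumes f: "even_log_concave f"
  shows "rotation_pair f u v * rotation_pair f u' v' \<le> (rotation_pair f (midpoint u u') (midpoint v v'))\<^sup>2"
proof -
  have "(1 / sqrt 2) *\<^sub>R (midpoint u u' + midpoint v v') = midpoint ((1 / sqrt 2) *\<^sub>R (u + v)) ((1 / sqrt 2) *\<^sub>R (u' + v'))"
    "(1 / sqrt 2) *\<^sub>R (midpoint u u' - midpoint v v') = midpoint ((1 / sqrt 2) *\<^sub>R (u - v)) ((1 / sqrt 2) *\<^sub>R (u' - v'))"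
    by (simp_all add: midpoint_def algebra_simps)
  then show ?thesis
    unfolding rotation_pair_def
    by (simp only:) (intro log_concave_mult even_log_concaveD(3) f)
qed

lemma rotation_pair_0: "even_log_concave f \<Longrightarrow> rotation_pair f u v \<le> (f 0)\<^sup>2"
  unfolding rotation_pair_def power2_eq_square by (intro mult_mono even_log_concave_le_0) auto

lemma ennreal_power_less_top: "(a::ennreal) < top \<Longrightarrow> a ^ n < top"
  by (simp add: power_less_top_ennreal)

lemma even_log_concave_rotation_pair:
  assumes f: "even_log_concave f"
  shows "even_log_concave (rotation_pair f u)"
proof -
  have [measurable]: "f \<in> borel_measurable borel" by (rule even_log_concaveD[OF f])
  show ?thesis
    unfolding even_log_concave_def
  proof (intro conjI allI)
    show "rotation_pair f u \<in> borel_measurable borel" by measurable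
    show "rotation_pair f u (- v) = rotation_pair f u v" for v
      by (simp add: rotation_pair_def mult.commute)
    show "rotation_pair f u v * rotation_pair f u v' \<le> (rotation_pair f u (midpoint v v'))\<^sup>2" for v v'
      using rotation_pair_log_concave[OF f, of u v u v'] by simp
    show "rotation_pair f u 0 < top"
      using rotation_pair_0[OF f] ennreal_power_less_top[OF even_log_concaveD(4)[OF f]]
      by (rule order.strict_trans1)
  qed
qed

lemma even_log_concave_self_conv:
  assumes f: "even_log_concave f"
  shows "even_log_concave (self_conv f)"
proof -
  have [measurable]: "f \<in> borel_measurable borel" by (rule even_log_concaveD[OF f])
  have "even_log_concave (\<lambda>u. mass (rotation_pair f u))"
  proof (rule even_log_concave_marginal)
    show "rotation_pair f (- u) (- v) = rotation_pair f u v" for u v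
      using even_log_concaveD(2)[OF f, of "(1 / sqrt 2) *\<^sub>R (u + v)"] even_log_concaveD(2)[OF f, of "(1 / sqrt 2) *\<^sub>R (u - v)"]
      by (simp add: rotation_pair_def algebra_simps)
  qed (simp_all add: rotation_pair_log_concave[OF f] mass_finite[OF even_log_concave_rotation_pair[OF f]])
  then show ?thesis by (simp add: self_conv_def[abs_def])
qed

lemma mass_self_conv:
  assumes f: "even_log_concave f"
  shows "mass (self_conv f) = (mass f)\<^sup>2"
proof -
  have [measurable]: "f \<in> borel_measurable borel" by (rule even_log_concaveD[OF f])
  have "mass (self_conv f) = (\<integral>\<^sup>+x. \<integral>\<^sup>+y. f x * f y \<partial>std_gauss \<partial>std_gauss)"
    unfolding self_conv_def rotation_pair_def
    by (rule nn_integral_std_gauss_rotate45) measurable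
  also have "\<dots> = (mass f)\<^sup>2"
    by (simp add: nn_integral_cmult nn_integral_multc power2_eq_square)
  finally show ?thesis .
qed

lemma even_log_concave_self_conv_iter:
  "even_log_concave f \<Longrightarrow> even_log_concave ((self_conv ^^ n) f)"
  by (induction n) (auto intro: even_log_concave_self_conv)

lemma mass_self_conv_iter:
  assumes f: "even_log_concave f"
  shows "mass ((self_conv ^^ n) f) = mass f ^ 2 ^ n"
proof (induction n)
  case (Suc n)
  then show ?case
    using mass_self_conv[OF even_log_concave_self_conv_iter[OF f, of n]]
    by (simp add: power_mult[symmetric] mult.commute)
qed simp

lemma measurable_smear[measurable]:
  fixes f :: "'a::euclidean_space \<Rightarrow> ennreal"
  assumes [measurable]: "f \<in> borel_measurable borel"
  shows "smear k f \<in> borel_measurable borel"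
  unfolding smear_def[abs_def] by measurable

lemma even_log_concave_mix:
  assumes f: "even_log_concave f" and g: "even_log_concave g"
  shows "even_log_concave (mix k f g)"
proof -
  have [measurable]: "f \<in> borel_measurable borel" "g \<in> borel_measurable borel"
    using f g by (auto intro: even_log_concaveD)
  have "even_log_concave (\<lambda>w. mass (\<lambda>y. f y * g (w + k *\<^sub>R y)))"
  proof (rule even_log_concave_marginal)
    fix w w' y y'
    show "f (- y) * g (- w + k *\<^sub>R - y) = f y * g (w + k *\<^sub>R y)"
      using even_log_concaveD(2)[OF f, of y] even_log_concaveD(2)[OF g, of "w + k *\<^sub>R y"] by simp
    have "midpoint w w' + k *\<^sub>R midpoint y y' = midpoint (w + k *\<^sub>R y) (w' + k *\<^sub>R y')"
      by (simp add: midpoint_def algebra_simps)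
    then show "f y * g (w + k *\<^sub>R y) * (f y' * g (w' + k *\<^sub>R y')) \<le>
        (f (midpoint y y') * g (midpoint w w' + k *\<^sub>R midpoint y y'))\<^sup>2"
      by (simp only:) (intro log_concave_mult even_log_concaveD(3) f g)
  next
    have "mass (\<lambda>y. f y * g (0 + k *\<^sub>R y)) \<le> f 0 * g 0"
      by (intro mass_le mult_mono even_log_concave_le_0 f g) auto
    also have "\<dots> < top" using even_log_concaveD(4)[OF f] even_log_concaveD(4)[OF g]
      by (simp add: ennreal_mult_less_top)
    finally show "mass (\<lambda>y. f y * g (0 + k *\<^sub>R y)) < top" .
  qed measurable
  then show ?thesis by (simp add: mix_def[abs_def])
qed

lemma smear_eq_mix: "smear k g = (\<lambda>x. mix 1 (\<lambda>_. 1) g (k *\<^sub>R x))"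
  by (simp add: smear_def mix_def fun_eq_iff)

lemma even_log_concave_smear:
  assumes g: "even_log_concave g"
  shows "even_log_concave (smear k g)"
  unfolding smear_eq_mix
proof (rule even_log_concave_comp_linear)
  show "even_log_concave (mix 1 (\<lambda>_. 1) g)"
    by (intro even_log_concave_mix even_log_concave_const g) simp
qed (rule linear_scaleR)

lemma smear_0: "smear k g 0 = mass g"
  by (simp add: smear_def)

lemma smear_le_mass: "even_log_concave g \<Longrightarrow> smear k g x \<le> mass g"
  using even_log_concave_le_0[OF even_log_concave_smear, of g k x] by (simp add: smear_0)

lemma mass_mix:
  fixes f g :: "'a::euclidean_space \<Rightarrow> ennreal"
  assumes [measurable]: "f \<in> borel_measurable borel" "g \<in> borel_measurable borel"
  shows "mass (mix k f g) = (\<integral>\<^sup>+y. f y * smear k g y \<partial>std_gauss)"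
proof -
  have "mass (mix k f g) = (\<integral>\<^sup>+y. \<integral>\<^sup>+w. f y * g (w + k *\<^sub>R y) \<partial>std_gauss \<partial>std_gauss)"
    unfolding mix_def by (rule std_gauss_Fubini) measurable
  also have "\<dots> = (\<integral>\<^sup>+y. f y * smear k g y \<partial>std_gauss)"
    by (simp add: smear_def nn_integral_cmult add.commute)
  finally show ?thesis .
qed

text \<open>At scale \<open>k / sqrt 2\<close> the two summands \<open>x\<close> and
  \<open>y\<close> enter symmetrically through their normalised sum, and the Gaussian noise can be
  integrated first.\<close>

lemma smear_mix:
  fixes f g :: "'a::euclidean_space \<Rightarrow> ennreal"
  assumes [measurable]: "f \<in> borel_measurable borel" "g \<in> borel_measurable borel"
  shows "smear (k / sqrt 2) (mix (k / sqrt 2) f g) x =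
    (\<integral>\<^sup>+y. f y * smear k g ((1 / sqrt 2) *\<^sub>R (x + y)) \<partial>std_gauss)"
proof -
  have "smear (k / sqrt 2) (mix (k / sqrt 2) f g) x =
      (\<integral>\<^sup>+y. \<integral>\<^sup>+w. f y * g ((k / sqrt 2) *\<^sub>R x + w + (k / sqrt 2) *\<^sub>R y) \<partial>std_gauss \<partial>std_gauss)"
    unfolding mix_def smear_def by (rule std_gauss_Fubini) measurable
  also have "\<dots> = (\<integral>\<^sup>+y. f y * smear k g ((1 / sqrt 2) *\<^sub>R (x + y)) \<partial>std_gauss)"
    by (simp add: smear_def nn_integral_cmult algebra_simps)
  finally show ?thesis .
qed

text \<open>Undoing the rotation writes \<open>u\<close> as the normalised sum of two independent
  summands. One of them is then absorbed into \<open>g\<close>, and each carries the smaller scale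
  \<open>k / sqrt 2\<close>.\<close>

lemma nn_integral_self_conv_smear:
  fixes f g :: "'a::euclidean_space \<Rightarrow> ennreal"
  assumes [measurable]: "f \<in> borel_measurable borel" "g \<in> borel_measurable borel"
  shows "(\<integral>\<^sup>+u. self_conv f u * smear k g u \<partial>std_gauss) =
    (\<integral>\<^sup>+x. f x * smear (k / sqrt 2) (mix (k / sqrt 2) f g) x \<partial>std_gauss)"
proof -
  let ?c = "1 / sqrt 2 :: real"
  have c: "?c *\<^sub>R (?c *\<^sub>R (u + v) + ?c *\<^sub>R (u - v)) = u" for u v :: 'a
  proof -
    have "?c *\<^sub>R (?c *\<^sub>R (u + v) + ?c *\<^sub>R (u - v)) = (?c * ?c * 2) *\<^sub>R u"
      by (simp add: scaleR_add_right[symmetric] scaleR_2[symmetric] del: scaleR_add_right)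
    then show ?thesis by simp
  qed
  have "(\<integral>\<^sup>+u. self_conv f u * smear k g u \<partial>std_gauss) =
      (\<integral>\<^sup>+u. \<integral>\<^sup>+v. (f (?c *\<^sub>R (u + v)) * f (?c *\<^sub>R (u - v))) * smear k g (?c *\<^sub>R (?c *\<^sub>R (u + v) + ?c *\<^sub>R (u - v))) \<partial>std_gauss \<partial>std_gauss)"
    unfolding c by (simp add: self_conv_def rotation_pair_def nn_integral_multc)
  also have "\<dots> = (\<integral>\<^sup>+x. \<integral>\<^sup>+y. (f x * f y) * smear k g (?c *\<^sub>R (x + y)) \<partial>std_gauss \<partial>std_gauss)"
    by (rule nn_integral_std_gauss_rotate45) measurable
  also have "\<dots> = (\<integral>\<^sup>+x. f x * smear (k / sqrt 2) (mix (k / sqrt 2) f g) x \<partial>std_gauss)"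
    by (subst smear_mix) (simp_all add: mult.assoc nn_integral_cmult)
  finally show ?thesis .
qed

section \<open>A central limit estimate by replacing summands\<close>

text \<open>By the Cameron-Martin formula the moment generating function at \<open>t\<close> is
  \<open>exp ((norm t)\<^sup>2 / 2)\<close> times \<open>smear 1 f t\<close>, up to normalisation.
  As a function of \<open>t\<close> this smear is even and log-concave, so it is at most its value
  at 0, the mass of \<open>f\<close>.\<close>

lemma even_log_concave_subgaussian:
  fixes f :: "'a::euclidean_space \<Rightarrow> ennreal"
  assumes f: "even_log_concave f" and a: "mass f = ennreal a" "0 < a"
  shows "subgaussian (density std_gauss (\<lambda>x. ennreal (1 / a) * f x))"
proof -
  have [measurable]: "f \<in> borel_measurable borel" by (rule even_log_concaveD[OF f])
  have aa: "ennreal (1 / a) * ennreal a = 1" using a by (simp flip: ennreal_mult)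
  show ?thesis
    unfolding subgaussian_def
  proof (intro conjI allI)
    show "prob_space (density std_gauss (\<lambda>x. ennreal (1 / a) * f x))"
      by (rule prob_spaceI) (simp add: emeasure_density nn_integral_cmult a aa)
    fix t :: 'a
    let ?e = "exp ((norm t)\<^sup>2 / 2)"
    have "(\<integral>\<^sup>+x. ennreal (exp (t \<bullet> x)) \<partial>density std_gauss (\<lambda>x. ennreal (1 / a) * f x)) =
        (\<integral>\<^sup>+x. ennreal (1 / a) * (ennreal (exp (t \<bullet> x)) * f x) \<partial>std_gauss)"
      by (subst nn_integral_density) (simp_all add: ac_simps)
    also have "\<dots> = (\<integral>\<^sup>+x. (ennreal (1 / a) * ennreal ?e) * (ennreal (exp (t \<bullet> x - (norm t)\<^sup>2 / 2)) * f x) \<partial>std_gauss)"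
    proof (rule nn_integral_cong)
      fix x
      have "ennreal (exp (t \<bullet> x)) = ennreal ?e * ennreal (exp (t \<bullet> x - (norm t)\<^sup>2 / 2))"
        by (simp flip: ennreal_mult exp_add)
      then show "ennreal (1 / a) * (ennreal (exp (t \<bullet> x)) * f x) =
          (ennreal (1 / a) * ennreal ?e) * (ennreal (exp (t \<bullet> x - (norm t)\<^sup>2 / 2)) * f x)"
        by (simp only: mult.assoc)
    qed
    also have "\<dots> = ennreal (1 / a) * (ennreal ?e * smear 1 f t)"
      by (subst nn_integral_cmult)
        (simp_all add: nn_integral_std_gauss_shift[symmetric] smear_def add.commute mult.assoc)
    also have "\<dots> \<le> ennreal (1 / a) * (ennreal ?e * mass f)"
      by (intro mult_left_mono smear_le_mass f) auto
    also have "\<dots> = ennreal ?e"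
      unfolding a(1) using a(2) by (simp flip: ennreal_mult)
    finally show "(\<integral>\<^sup>+x. ennreal (exp (t \<bullet> x)) \<partial>density std_gauss (\<lambda>x. ennreal (1 / a) * f x)) \<le> ennreal ?e" .
  qed simp
qed

text \<open>The shift is moved into an exponential weight, and averaging with the reflected
  variable, allowed because \<open>g\<close> is even, turns the exponential into
  \<open>cosh\<close>.\<close>

lemma smear_cosh:
  fixes g :: "'a::euclidean_space \<Rightarrow> ennreal"
  assumes g: "even_log_concave g"
  shows "smear k g x = (\<integral>\<^sup>+w. ennreal (exp (- (k\<^sup>2 * (norm x)\<^sup>2 / 2)) * cosh (k * (w \<bullet> x))) * g w \<partial>std_gauss)"
proof -
  have [measurable]: "g \<in> borel_measurable borel" by (rule even_log_concaveD[OF g])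
  define e where "e = exp (- (k\<^sup>2 * (norm x)\<^sup>2 / 2))"
  have split: "exp ((k *\<^sub>R x) \<bullet> w - (norm (k *\<^sub>R x))\<^sup>2 / 2) = e * exp (k * (w \<bullet> x))" for w
    by (simp add: e_def power_mult_distrib inner_commute flip: exp_add)
  have 1: "smear k g x = (\<integral>\<^sup>+w. ennreal (e * exp (k * (w \<bullet> x))) * g w \<partial>std_gauss)"
    unfolding smear_def split[symmetric]
    by (subst nn_integral_std_gauss_shift[symmetric]) (simp_all add: add.commute)
  have 2: "smear k g x = (\<integral>\<^sup>+w. ennreal (e * exp (- k * (w \<bullet> x))) * g w \<partial>std_gauss)"
    unfolding 1
    by (subst nn_integral_std_gauss_uminus[symmetric]) (simp_all add: even_log_concaveD(2)[OF g])
  have "ennreal (1 / 2) * smear k g x + ennreal (1 / 2) * smear k g x =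
      (\<integral>\<^sup>+w. ennreal (1 / 2) * (ennreal (e * exp (k * (w \<bullet> x))) * g w) + ennreal (1 / 2) * (ennreal (e * exp (- k * (w \<bullet> x))) * g w) \<partial>std_gauss)"
    by (subst nn_integral_add, measurable, subst (1 2) nn_integral_cmult, measurable)
      (simp only: 1[symmetric] 2[symmetric])
  also have "\<dots> = (\<integral>\<^sup>+w. ennreal (e * cosh (k * (w \<bullet> x))) * g w \<partial>std_gauss)"
  proof (rule nn_integral_cong)
    fix w
    have "ennreal (1 / 2) * ennreal (e * exp (k * (w \<bullet> x))) + ennreal (1 / 2) * ennreal (e * exp (- k * (w \<bullet> x))) =
        ennreal (e * cosh (k * (w \<bullet> x)))"
    proof -
      have "0 \<le> (1 / 2 :: real)" by simp
      then show ?thesis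
        by (simp only: ennreal_mult'[symmetric], subst ennreal_plus[symmetric])
          (auto simp: e_def cosh_field_def field_simps)
    qed
    then show "ennreal (1 / 2) * (ennreal (e * exp (k * (w \<bullet> x))) * g w) + ennreal (1 / 2) * (ennreal (e * exp (- k * (w \<bullet> x))) * g w) =
        ennreal (e * cosh (k * (w \<bullet> x))) * g w"
      by (simp add: mult.assoc[symmetric] distrib_right[symmetric])
  qed
  also have "ennreal (1 / 2) * smear k g x + ennreal (1 / 2) * smear k g x = smear k g x"
  proof -
    have "ennreal (1 / 2) + ennreal (1 / 2) = ennreal (1 / 2 + 1 / 2)"
      by (rule ennreal_plus[symmetric]) auto
    also have "\<dots> = 1" by simp
    finally show ?thesis by (simp only: distrib_right[symmetric] mult_1)
  qed
  finally show ?thesis by (simp add: e_def)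
qed

text \<open>This is \<open>subgaussian_small_scale_comparison\<close> for the normalised densities,
  with \<open>smear_cosh\<close> identifying the kernel; if one of the masses is 0, the left side
  vanishes.\<close>

lemma smear_small_scale_comparison:
  fixes f g :: "'a::euclidean_space \<Rightarrow> ennreal"
  assumes f: "even_log_concave f" and g: "even_log_concave g" and k: "0 \<le> k" "k \<le> 1 / 4"
  shows "mass f * mass (smear k g) \<le>
    (\<integral>\<^sup>+x. f x * smear k g x \<partial>std_gauss) + ennreal (40000 * 2 ^ DIM('a) * k ^ 4) * (mass f * mass g)"
proof -
  have [measurable]: "f \<in> borel_measurable borel" "g \<in> borel_measurable borel"
    using f g by (auto intro: even_log_concaveD)
  obtain a where a: "mass f = ennreal a" "0 \<le> a" using mass_finite[OF f] by (cases "mass f") auto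
  obtain b where b: "mass g = ennreal b" "0 \<le> b" using mass_finite[OF g] by (cases "mass g") auto
  show ?thesis
  proof (cases "a = 0 \<or> b = 0")
    case True
    have "mass (smear k g) \<le> mass g" by (intro mass_le smear_le_mass g)
    then show ?thesis using True a b by auto
  next
    case False
    then have ab: "0 < a" "0 < b" using a b by auto
    define M where "M = density std_gauss (\<lambda>x. ennreal (1 / a) * f x)"
    define N where "N = density std_gauss (\<lambda>x. ennreal (1 / b) * g x)"
    have M: "subgaussian M" and N: "subgaussian N"
      unfolding M_def N_def using f g a b ab by (auto intro: even_log_concave_subgaussian)
    define E where "E x w = exp (- (k\<^sup>2 * (norm x)\<^sup>2 / 2)) * cosh (k * (w \<bullet> x))" for x w :: 'a
    have E0: "0 \<le> E x w" for x w by (simp add: E_def cosh_real_nonneg)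
    have Em: "E x \<in> borel_measurable borel" for x unfolding E_def[abs_def] cosh_field_def by measurable
    note cmp = subgaussian_small_scale_comparison[OF _ N k, folded E_def]
    have NE: "ennreal (\<integral>w. E x w \<partial>N) = ennreal (1 / b) * smear k g x" for x
    proof -
      have "ennreal (\<integral>w. E x w \<partial>N) = (\<integral>\<^sup>+w. ennreal (E x w) \<partial>N)"
        using cmp(2)[OF M] E0 by (intro nn_integral_eq_integral[symmetric]) (auto simp: E_def[abs_def])
      also have "\<dots> = ennreal (1 / b) * smear k g x"
        unfolding N_def smear_cosh[OF g, of k x] E_def[symmetric] using Em[of x]
        by (subst nn_integral_density, simp, simp, subst nn_integral_cmult[symmetric])
          (simp_all add: ac_simps)
      finally show ?thesis .
    qed
    have nn: "0 \<le> (\<integral>w. E x w \<partial>N)" for x using E0 by simp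
    have LE: "ennreal (\<integral>x. \<integral>w. E x w \<partial>N \<partial>L) = (\<integral>\<^sup>+x. ennreal (1 / b) * smear k g x \<partial>L)" if L: "subgaussian L" for L
      unfolding NE[symmetric]
      using cmp(1)[OF L] nn by (intro nn_integral_eq_integral[symmetric]) (auto simp: E_def[abs_def])
    have "ennreal (\<integral>x. \<integral>w. E x w \<partial>N \<partial>std_gauss) \<le>
        ennreal (\<integral>x. \<integral>w. E x w \<partial>N \<partial>M) + ennreal (40000 * 2 ^ DIM('a) * k ^ 4)"
    proof -
      have "(\<integral>x. \<integral>w. E x w \<partial>N \<partial>std_gauss) \<le> (\<integral>x. \<integral>w. E x w \<partial>N \<partial>M) + 40000 * 2 ^ DIM('a) * k ^ 4"
        using cmp(3)[OF M] by (simp only: E_def)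
      then have "ennreal (\<integral>x. \<integral>w. E x w \<partial>N \<partial>std_gauss) \<le>
          ennreal ((\<integral>x. \<integral>w. E x w \<partial>N \<partial>M) + 40000 * 2 ^ DIM('a) * k ^ 4)"
        by (rule ennreal_leI)
      also have "\<dots> = ennreal (\<integral>x. \<integral>w. E x w \<partial>N \<partial>M) + ennreal (40000 * 2 ^ DIM('a) * k ^ 4)"
        using nn by (intro ennreal_plus) simp_all
      finally show ?thesis .
    qed
    also have "ennreal (\<integral>x. \<integral>w. E x w \<partial>N \<partial>M) = ennreal (1 / a) * (ennreal (1 / b) * (\<integral>\<^sup>+x. f x * smear k g x \<partial>std_gauss))"
      unfolding LE[OF M] unfolding M_def
      by (subst nn_integral_density, simp, simp, subst nn_integral_cmult[symmetric], simp,
          subst nn_integral_cmult[symmetric]) (simp_all add: ac_simps)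
    also have "ennreal (\<integral>x. \<integral>w. E x w \<partial>N \<partial>std_gauss) = ennreal (1 / b) * mass (smear k g)"
      unfolding LE[OF subgaussian_std_gauss] by (simp add: nn_integral_cmult)
    finally have le: "ennreal (a * b) * (ennreal (1 / b) * mass (smear k g)) \<le>
        ennreal (a * b) * (ennreal (1 / a) * (ennreal (1 / b) * (\<integral>\<^sup>+x. f x * smear k g x \<partial>std_gauss)) + ennreal (40000 * 2 ^ DIM('a) * k ^ 4))"
      by (rule mult_left_mono) simp
    have e1: "ennreal (a * b) * (ennreal (1 / b) * X) = ennreal a * X" for X
      using ab by (simp add: mult.assoc[symmetric] flip: ennreal_mult)
    have e2: "ennreal (a * b) * (ennreal (1 / a) * (ennreal (1 / b) * X)) = X" for X
      using ab by (simp add: mult.assoc[symmetric] flip: ennreal_mult)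
    have e3: "ennreal (a * b) = ennreal a * mass g" using a b by (simp add: ennreal_mult)
    show ?thesis
      using le unfolding distrib_left e1 e2 unfolding e3 a(1)
      by (simp only: mult.commute[of "ennreal (40000 * 2 ^ DIM('a) * k ^ 4)"])
  qed
qed

text \<open>Lindeberg replacement organised by halving. The sum of \<open>2 ^ Suc n\<close> summands
  is two halves at scale \<open>k / sqrt 2\<close>, replaced one after the other. The assumption on
  \<open>k\<close> brings the scale of a single summand down to at most 1/4.\<close>

theorem self_conv_central_limit:
  fixes f g :: "'a::euclidean_space \<Rightarrow> ennreal"
  assumes f: "even_log_concave f" and g: "even_log_concave g" and k: "0 \<le> k" "k\<^sup>2 \<le> 2 ^ n / 16"
  shows "mass f ^ 2 ^ n * mass (smear k g) \<le>
    (\<integral>\<^sup>+x. (self_conv ^^ n) f x * smear k g x \<partial>std_gauss) +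
    ennreal (40000 * 2 ^ DIM('a) * k ^ 4 / 2 ^ n) * (mass f ^ 2 ^ n * mass g)"
  using g k
proof (induction n arbitrary: g k)
  case 0
  then have "k \<le> 1 / 4" using power2_le_imp_le[of k "1 / 4"] by (simp add: power_divide)
  then show ?case using smear_small_scale_comparison[OF f] 0 by simp
next
  case (Suc n)
  define F where "F = (self_conv ^^ n) f"
  define a where "a = mass f ^ 2 ^ n"
  have F: "even_log_concave F" unfolding F_def by (rule even_log_concave_self_conv_iter[OF f])
  have aF: "a = mass F" unfolding a_def F_def by (rule mass_self_conv_iter[OF f, symmetric])
  note g = Suc.prems(1)
  have [measurable]: "F \<in> borel_measurable borel" "g \<in> borel_measurable borel"
    using F g by (auto intro: even_log_concaveD)
  define l where "l = k / sqrt 2"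
  define e where "e = ennreal (40000 * 2 ^ DIM('a) * l ^ 4 / 2 ^ n)"
  have l: "0 \<le> l" "l\<^sup>2 \<le> 2 ^ n / 16" using Suc.prems by (auto simp: l_def power_divide)
  define one where "one = (\<lambda>_::'a. 1 :: ennreal)"
  have one: "even_log_concave one" unfolding one_def by (rule even_log_concave_const) simp
  \<comment> \<open>The half not being replaced sits inside the test function: distributed by
    \<open>F\<close> in \<open>?g1\<close>, already Gaussian in \<open>?g2\<close>.\<close>
  let ?g1 = "mix l F g" and ?g2 = "mix l one g"
  note IH = Suc.IH[OF _ l, folded F_def a_def e_def]
  have IH1: "a * mass (smear l ?g1) \<le> (\<integral>\<^sup>+x. F x * smear l ?g1 x \<partial>std_gauss) + e * (a * mass ?g1)"
    by (intro IH even_log_concave_mix F g)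
  have IH2: "a * mass (smear l ?g2) \<le> (\<integral>\<^sup>+x. F x * smear l ?g2 x \<partial>std_gauss) + e * (a * mass ?g2)"
    by (intro IH even_log_concave_mix one g)
  have m: "mass (mix l h g) \<le> mass h * mass g" if h: "even_log_concave h" for h
  proof -
    have [measurable]: "h \<in> borel_measurable borel" by (rule even_log_concaveD[OF h])
    have "mass (mix l h g) \<le> (\<integral>\<^sup>+x. h x * mass g \<partial>std_gauss)"
      by (subst mass_mix) (auto intro!: nn_integral_mono mult_left_mono smear_le_mass g)
    then show ?thesis by (simp add: nn_integral_multc)
  qed
  have m1: "mass ?g1 \<le> a * mass g" unfolding aF by (rule m[OF F])
  have m2: "mass ?g2 \<le> mass g" using m[OF one] by (simp add: one_def emeasure_std_gauss_UNIV)
  \<comment> \<open>A normalised sum of two Gaussian halves is Gaussian again.\<close>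
  have s2: "mass (smear l ?g2) = mass (smear k g)"
  proof -
    have "self_conv one u = 1" for u
      by (simp add: self_conv_def rotation_pair_def one_def emeasure_std_gauss_UNIV)
    then show ?thesis
      using nn_integral_self_conv_smear[of one g k] by (simp add: one_def l_def)
  qed
  \<comment> \<open>The intermediate stage, with one half of each kind, is the same whichever half
    is put into the test function.\<close>
  have s12: "(\<integral>\<^sup>+x. F x * smear l ?g2 x \<partial>std_gauss) = mass (smear l ?g1)"
  proof -
    have "mass (smear l ?g1) = (\<integral>\<^sup>+x. \<integral>\<^sup>+y. F y * smear k g ((1 / sqrt 2) *\<^sub>R (x + y)) \<partial>std_gauss \<partial>std_gauss)"
      unfolding l_def by (simp add: smear_mix)
    also have "\<dots> = (\<integral>\<^sup>+y. \<integral>\<^sup>+x. F y * smear k g ((1 / sqrt 2) *\<^sub>R (x + y)) \<partial>std_gauss \<partial>std_gauss)"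
      by (rule std_gauss_Fubini) measurable
    also have "\<dots> = (\<integral>\<^sup>+x. F x * smear l ?g2 x \<partial>std_gauss)"
      unfolding l_def by (simp add: smear_mix one_def nn_integral_cmult add.commute)
    finally show ?thesis ..
  qed
  have "mass f ^ 2 ^ Suc n * mass (smear k g) = a * (a * mass (smear l ?g2))"
    by (simp add: a_def s2 power_add mult.assoc[symmetric] mult_2)
  also have "\<dots> \<le> a * (mass (smear l ?g1) + e * (a * mass g))"
    using IH2 m2 unfolding s12
    by (intro mult_left_mono) (auto intro!: order.trans[OF IH2[unfolded s12]] add_mono mult_left_mono)
  also have "\<dots> = a * mass (smear l ?g1) + e * (a * (a * mass g))"
    by (simp add: distrib_left ac_simps)
  also have "\<dots> \<le> ((\<integral>\<^sup>+x. F x * smear l ?g1 x \<partial>std_gauss) + e * (a * (a * mass g))) + e * (a * (a * mass g))"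
    using m1 by (intro add_mono order_refl order.trans[OF IH1] mult_left_mono) auto
  also have "\<dots> = (\<integral>\<^sup>+x. (self_conv ^^ Suc n) f x * smear k g x \<partial>std_gauss) + (e + e) * (a * a * mass g)"
    by (simp add: nn_integral_self_conv_smear F_def[symmetric] l_def[symmetric] distrib_right add.assoc mult.assoc)
  \<comment> \<open>The fourth power of the scale drops by a factor 4 while the number of errors
    doubles, so the total error halves.\<close>
  also have "e + e = ennreal (40000 * 2 ^ DIM('a) * k ^ 4 / 2 ^ Suc n)"
  proof -
    have "l ^ 4 = k ^ 4 / 4"
      by (simp add: l_def power_divide power4_eq_xxxx)
    then show ?thesis unfolding e_def by (simp flip: ennreal_plus)
  qed
  also have "a * a = mass f ^ 2 ^ Suc n" by (simp add: a_def power_add[symmetric] mult_2)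
  finally show ?case .
qed

section \<open>The Gaussian correlation inequality\<close>

text \<open>The functional \<open>J\<close> of the overview; when
  \<open>r\<^sup>2 + s\<^sup>2 = 1\<close>, the two arguments are standard Gaussian vectors with
  correlation \<open>r\<close>.\<close>

definition noise_corr :: "real \<Rightarrow> real \<Rightarrow> ('a::euclidean_space \<Rightarrow> ennreal) \<Rightarrow> ('a \<Rightarrow> ennreal) \<Rightarrow> ennreal" where
  "noise_corr r s f g = (\<integral>\<^sup>+x. f x * (\<integral>\<^sup>+z. g (r *\<^sub>R x + s *\<^sub>R z) \<partial>std_gauss) \<partial>std_gauss)"

lemma noise_corr_self_conv:
  fixes f g :: "'a::euclidean_space \<Rightarrow> ennreal"
  assumes c: "\<And>f g :: 'a \<Rightarrow> ennreal. even_log_concave f \<Longrightarrow> even_log_concave g \<Longrightarrow>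
      c * (mass f * mass g) \<le> noise_corr r s f g"
    and f: "even_log_concave f" and g: "even_log_concave g"
  shows "c * noise_corr r s (self_conv f) (self_conv g) \<le> (noise_corr r s f g)\<^sup>2"
proof -
  have [measurable]: "f \<in> borel_measurable borel" "g \<in> borel_measurable borel"
    using f g by (auto intro: even_log_concaveD)
  note [measurable] = measurable_rotation_pair[of f] measurable_rotation_pair[of g]
  let ?a = "1 / sqrt 2 :: real"
  define Q where "Q x y = (\<integral>\<^sup>+z. \<integral>\<^sup>+z'. g (r *\<^sub>R x + s *\<^sub>R z) * g (r *\<^sub>R y + s *\<^sub>R z') \<partial>std_gauss \<partial>std_gauss)" for x y
  have [measurable]: "case_prod Q \<in> borel_measurable (borel \<Otimes>\<^sub>M borel)"
    unfolding Q_def by measurable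
  have Q_prod: "Q x y = (\<integral>\<^sup>+z. g (r *\<^sub>R x + s *\<^sub>R z) \<partial>std_gauss) * (\<integral>\<^sup>+z. g (r *\<^sub>R y + s *\<^sub>R z) \<partial>std_gauss)" for x y
    unfolding Q_def by (simp add: nn_integral_cmult nn_integral_multc)
  \<comment> \<open>The 45 degree rotation commutes with forming \<open>r x + s z\<close>, so
    rotating \<open>z\<close> and \<open>z'\<close> along with \<open>x\<close> and \<open>y\<close>
    brings the factors of \<open>g\<close> into rotated form.\<close>
  have Q_rot: "Q (?a *\<^sub>R (u + v)) (?a *\<^sub>R (u - v)) =
      (\<integral>\<^sup>+w. \<integral>\<^sup>+t. rotation_pair g (r *\<^sub>R u + s *\<^sub>R w) (r *\<^sub>R v + s *\<^sub>R t) \<partial>std_gauss \<partial>std_gauss)" for u v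
    unfolding Q_def
    by (subst nn_integral_std_gauss_rotate45[symmetric], measurable)
      (simp add: rotation_pair_def algebra_simps)
  have "(noise_corr r s f g)\<^sup>2 = (\<integral>\<^sup>+x. \<integral>\<^sup>+y. (f x * f y) * Q x y \<partial>std_gauss \<partial>std_gauss)"
  proof -
    define h where "h x = f x * (\<integral>\<^sup>+z. g (r *\<^sub>R x + s *\<^sub>R z) \<partial>std_gauss)" for x
    have [measurable]: "h \<in> borel_measurable borel" unfolding h_def[abs_def] by measurable
    have "(f x * f y) * Q x y = h x * h y" for x y
      by (simp add: Q_prod h_def ac_simps)
    moreover have "noise_corr r s f g = mass h" by (simp add: noise_corr_def h_def)
    ultimately show ?thesis by (simp add: nn_integral_cmult nn_integral_multc power2_eq_square)
  qed
  also have "\<dots> = (\<integral>\<^sup>+u. \<integral>\<^sup>+v. (f (?a *\<^sub>R (u + v)) * f (?a *\<^sub>R (u - v))) * Q (?a *\<^sub>R (u + v)) (?a *\<^sub>R (u - v)) \<partial>std_gauss \<partial>std_gauss)"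
    by (rule nn_integral_std_gauss_rotate45[symmetric]) measurable
  also have "\<dots> = (\<integral>\<^sup>+u. \<integral>\<^sup>+v. \<integral>\<^sup>+w. rotation_pair f u v *
      (\<integral>\<^sup>+t. rotation_pair g (r *\<^sub>R u + s *\<^sub>R w) (r *\<^sub>R v + s *\<^sub>R t) \<partial>std_gauss) \<partial>std_gauss \<partial>std_gauss \<partial>std_gauss)"
    unfolding Q_rot rotation_pair_def[of f, symmetric] by (simp add: nn_integral_cmult)
  also have "\<dots> = (\<integral>\<^sup>+u. \<integral>\<^sup>+w. noise_corr r s (rotation_pair f u) (rotation_pair g (r *\<^sub>R u + s *\<^sub>R w)) \<partial>std_gauss \<partial>std_gauss)"
    unfolding noise_corr_def by (rule nn_integral_cong, rule std_gauss_Fubini) measurable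
  \<comment> \<open>With \<open>u\<close> and \<open>w\<close> frozen the sections are even and
    log-concave, so the assumed constant applies; their masses are the values of
    \<open>self_conv\<close>.\<close>
  also have "\<dots> \<ge> (\<integral>\<^sup>+u. \<integral>\<^sup>+w. c * (self_conv f u * self_conv g (r *\<^sub>R u + s *\<^sub>R w)) \<partial>std_gauss \<partial>std_gauss)"
    unfolding self_conv_def by (intro nn_integral_mono c even_log_concave_rotation_pair f g)
  also have "(\<integral>\<^sup>+u. \<integral>\<^sup>+w. c * (self_conv f u * self_conv g (r *\<^sub>R u + s *\<^sub>R w)) \<partial>std_gauss \<partial>std_gauss) =
      c * noise_corr r s (self_conv f) (self_conv g)"
  proof -
    have [measurable]: "self_conv f \<in> borel_measurable borel" "self_conv g \<in> borel_measurable borel"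
      using f g by (auto intro: even_log_concaveD even_log_concave_self_conv)
    show ?thesis unfolding noise_corr_def by (simp add: nn_integral_cmult)
  qed
  finally show ?thesis .
qed

text \<open>Each step squares the previous inequality and gains one factor \<open>c\<close>, so the
  exponent goes from \<open>m\<close> to \<open>2 * m + 1\<close>.\<close>

lemma noise_corr_self_conv_iter:
  fixes f g :: "'a::euclidean_space \<Rightarrow> ennreal"
  assumes c: "\<And>f g :: 'a \<Rightarrow> ennreal. even_log_concave f \<Longrightarrow> even_log_concave g \<Longrightarrow>
      c * (mass f * mass g) \<le> noise_corr r s f g"
    and f: "even_log_concave f" and g: "even_log_concave g"
  shows "c ^ (2 ^ n - 1) * noise_corr r s ((self_conv ^^ n) f) ((self_conv ^^ n) g) \<le> noise_corr r s f g ^ 2 ^ n"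
proof (induction n)
  case (Suc n)
  let ?J = "\<lambda>n. noise_corr r s ((self_conv ^^ n) f) ((self_conv ^^ n) g)"
  have "1 \<le> (2::nat) ^ n" by simp
  then have "(2::nat) ^ Suc n - 1 = (2 ^ n - 1) * 2 + 1" unfolding power_Suc by arith
  then have "c ^ (2 ^ Suc n - 1) * ?J (Suc n) = (c ^ (2 ^ n - 1))\<^sup>2 * (c * ?J (Suc n))"
    by (simp only: power_add power_mult power_one_right mult.assoc)
  also have "\<dots> \<le> (c ^ (2 ^ n - 1))\<^sup>2 * (?J n)\<^sup>2"
  proof (rule mult_left_mono)
    show "c * ?J (Suc n) \<le> (?J n)\<^sup>2"
      unfolding funpow.simps comp_def
      by (rule noise_corr_self_conv[of c r s, OF c])
        (assumption | rule even_log_concave_self_conv_iter f g)+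
  qed simp
  also have "\<dots> = (c ^ (2 ^ n - 1) * ?J n)\<^sup>2" by (simp add: power_mult_distrib)
  also have "\<dots> \<le> (noise_corr r s f g ^ 2 ^ n)\<^sup>2" by (intro power_mono Suc.IH) auto
  also have "\<dots> = noise_corr r s f g ^ 2 ^ Suc n" by (simp add: power_mult[symmetric] mult.commute)
  finally show ?case .
qed simp

lemma noise_corr_smear:
  assumes "s \<noteq> 0"
  shows "noise_corr r s f g = (\<integral>\<^sup>+x. f x * smear (r / s) (\<lambda>w. g (s *\<^sub>R w)) x \<partial>std_gauss)"
  using assms by (simp add: noise_corr_def smear_def scaleR_add_right)

lemma even_log_concave_scale:
  "even_log_concave g \<Longrightarrow> even_log_concave (\<lambda>w. g (s *\<^sub>R w))"
  by (rule even_log_concave_comp_linear[OF _ linear_scaleR])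

text \<open>Rotation invariance: \<open>r x + s z\<close> is again a standard Gaussian
  vector.\<close>

lemma mass_smear_scale:
  fixes g :: "'a::euclidean_space \<Rightarrow> ennreal"
  assumes [measurable]: "g \<in> borel_measurable borel" and rs: "r\<^sup>2 + s\<^sup>2 = 1" "s \<noteq> 0"
  shows "mass (smear (r / s) (\<lambda>w. g (s *\<^sub>R w))) = mass g"
proof -
  have "mass (smear (r / s) (\<lambda>w. g (s *\<^sub>R w))) = (\<integral>\<^sup>+x. \<integral>\<^sup>+z. g (r *\<^sub>R x + s *\<^sub>R z) \<partial>std_gauss \<partial>std_gauss)"
    using rs by (simp add: smear_def scaleR_add_right)
  also have "\<dots> = (\<integral>\<^sup>+x. \<integral>\<^sup>+y. g x \<partial>(std_gauss :: 'a measure) \<partial>std_gauss)"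
    by (rule nn_integral_std_gauss_rotate[of "\<lambda>x y. g x"]) (use rs in simp_all)
  finally show ?thesis by simp
qed

lemma noise_corr_finite:
  assumes f: "even_log_concave f" and g: "even_log_concave g"
  shows "noise_corr r s f g < top"
proof -
  have "noise_corr r s f g \<le> f 0 * g 0"
    unfolding noise_corr_def by (intro mass_le mult_mono even_log_concave_le_0 f g) auto
  also have "\<dots> < top" using even_log_concaveD(4)[OF f] even_log_concaveD(4)[OF g]
    by (simp add: ennreal_mult_less_top)
  finally show ?thesis .
qed

text \<open>The improvement argument needs some positive constant to start from.
  \<open>exp (- u) \<ge> exp (- m) * (1 + m - u)\<close> is integrated with \<open>m\<close> an upper bound for the mean of \<open>u\<close>.\<close>

lemma noise_corr_lower_bound:
  fixes f g :: "'a::euclidean_space \<Rightarrow> ennreal"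
  assumes f: "even_log_concave f" and g: "even_log_concave g" and rs: "r\<^sup>2 + s\<^sup>2 = 1" "s \<noteq> 0"
  shows "ennreal (exp (- (2 * (r / s)\<^sup>2 * sqrt 2 ^ DIM('a)))) * (mass f * mass g) \<le> noise_corr r s f g"
proof -
  have [measurable]: "f \<in> borel_measurable borel" "g \<in> borel_measurable borel"
    using f g by (auto intro: even_log_concaveD)
  define k where "k = r / s"
  \<comment> \<open>A bound for the mean of \<open>u\<close>, obtained from
    \<open>norm2_le_exp_norm\<close> and the exponential moment of a subgaussian measure.\<close>
  define m where "m = 2 * k\<^sup>2 * sqrt 2 ^ DIM('a)"
  define u where "u x = k\<^sup>2 * (norm x)\<^sup>2 / 2" for x :: 'a
  define h where "h = (\<lambda>w. g (s *\<^sub>R w))"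
  have h: "even_log_concave h" unfolding h_def by (rule even_log_concave_scale[OF g])
  have [measurable]: "h \<in> borel_measurable borel" by (rule even_log_concaveD[OF h])
  have "mass g = mass (smear k h)"
    unfolding k_def h_def using rs by (subst mass_smear_scale) simp_all
  also have "\<dots> \<le> mass h" by (intro mass_le smear_le_mass h)
  finally have gh: "mass g \<le> mass h" .
  \<comment> \<open>The factor \<open>cosh\<close> in \<open>smear_cosh\<close> is bounded below by
    1.\<close>
  have low: "ennreal (exp (- u x)) * mass g \<le> smear k h x" for x
  proof -
    have "ennreal (exp (- u x)) * mass g \<le> ennreal (exp (- u x)) * mass h"
      by (intro mult_left_mono gh) auto
    also have "\<dots> = (\<integral>\<^sup>+w. ennreal (exp (- u x)) * h w \<partial>std_gauss)" by (simp add: nn_integral_cmult)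
    also have "\<dots> \<le> (\<integral>\<^sup>+w. ennreal (exp (- u x) * cosh (k * (w \<bullet> x))) * h w \<partial>std_gauss)"
      by (intro nn_integral_mono mult_right_mono ennreal_leI) (auto simp: cosh_real_ge_1)
    also have "\<dots> = smear k h x" unfolding smear_cosh[OF h] u_def ..
    finally show ?thesis .
  qed
  obtain a where a: "mass f = ennreal a" "0 \<le> a" using mass_finite[OF f] by (cases "mass f") auto
  have "ennreal (exp (- m)) * mass f \<le> (\<integral>\<^sup>+x. f x * ennreal (exp (- u x)) \<partial>std_gauss)"
  proof (cases "a = 0")
    case False
    then have a0: "0 < a" using a by simp
    define M where "M = density std_gauss (\<lambda>x. ennreal (1 / a) * f x)"
    have M: "subgaussian M" unfolding M_def using f a a0 by (intro even_log_concave_subgaussian) auto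
    interpret M: prob_space M using M by (simp add: subgaussian_def)
    have iu: "integrable M u"
      unfolding u_def[abs_def] using subgaussian_integrable_norm2[OF M] by simp
    have ie: "integrable M (\<lambda>x. exp (- u x))"
    proof (rule subgaussian_integrable[OF M, of _ 1])
      show "\<bar>exp (- u x)\<bar> \<le> 1 * exp ((norm x)\<^sup>2 / 4)" for x
      proof -
        have "- u x \<le> (norm x)\<^sup>2 / 4" by (simp add: u_def) (smt (verit) mult_nonneg_nonneg zero_le_power2)
        then show ?thesis by simp
      qed
    qed (simp add: u_def[abs_def])
    have "(\<integral>x. u x \<partial>M) \<le> (\<integral>x. 2 * k\<^sup>2 * exp ((norm x)\<^sup>2 / 4) \<partial>M)"
    proof (intro integral_mono iu)
      show "integrable M (\<lambda>x. 2 * k\<^sup>2 * exp ((norm x)\<^sup>2 / 4))"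
        using subgaussian_integrable_exp_norm[OF M] by simp
      show "u x \<le> 2 * k\<^sup>2 * exp ((norm x)\<^sup>2 / 4)" for x
        using mult_left_mono[OF norm2_le_exp_norm[of x], of "k\<^sup>2 / 2"] by (simp add: u_def)
    qed
    also have "\<dots> \<le> m"
      unfolding m_def using subgaussian_integrable_exp_norm[OF M]
      by (simp add: mult_left_mono)
    finally have um: "(\<integral>x. u x \<partial>M) \<le> m" .
    have "exp (- m) \<le> exp (- m) * (1 + m - (\<integral>x. u x \<partial>M))" using um by simp
    also have "\<dots> = (\<integral>x. exp (- m) * (1 + m - u x) \<partial>M)"
      using iu M.prob_space by simp
    also have "\<dots> \<le> (\<integral>x. exp (- u x) \<partial>M)"
    proof (intro integral_mono ie)
      show "integrable M (\<lambda>x. exp (- m) * (1 + m - u x))" using iu by simp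
      show "exp (- m) * (1 + m - u x) \<le> exp (- u x)" for x
      proof -
        have "exp (- m) * (1 + (m - u x)) \<le> exp (- m) * exp (m - u x)"
          by (intro mult_left_mono exp_ge_add_one_self) auto
        then show ?thesis by (simp add: algebra_simps flip: exp_add)
      qed
    qed
    finally have "ennreal (exp (- m)) \<le> ennreal (\<integral>x. exp (- u x) \<partial>M)" by (rule ennreal_leI)
    also have "\<dots> = (\<integral>\<^sup>+x. ennreal (exp (- u x)) \<partial>M)"
      by (intro nn_integral_eq_integral[symmetric] ie) auto
    also have "\<dots> = ennreal (1 / a) * (\<integral>\<^sup>+x. f x * ennreal (exp (- u x)) \<partial>std_gauss)"
      unfolding M_def
      by (subst nn_integral_density, simp, simp add: u_def[abs_def], subst nn_integral_cmult[symmetric])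
        (simp_all add: u_def[abs_def] ac_simps)
    finally have "ennreal a * ennreal (exp (- m)) \<le> ennreal a * (ennreal (1 / a) * (\<integral>\<^sup>+x. f x * ennreal (exp (- u x)) \<partial>std_gauss))"
      by (rule mult_left_mono) simp
    also have "ennreal a * (ennreal (1 / a) * X) = X" for X
      using a0 by (simp add: mult.assoc[symmetric] flip: ennreal_mult)
    finally show ?thesis by (simp only: a(1) mult.commute)
  qed (use a in simp)
  then have "ennreal (exp (- m)) * mass f * mass g \<le> (\<integral>\<^sup>+x. f x * ennreal (exp (- u x)) \<partial>std_gauss) * mass g"
    by (rule mult_right_mono) simp
  also have "\<dots> = (\<integral>\<^sup>+x. f x * (ennreal (exp (- u x)) * mass g) \<partial>std_gauss)"
    by (subst nn_integral_multc[symmetric]) (simp_all add: u_def[abs_def] mult.assoc)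
  also have "\<dots> \<le> (\<integral>\<^sup>+x. f x * smear k h x \<partial>std_gauss)"
    by (intro nn_integral_mono mult_left_mono low) auto
  also have "\<dots> = noise_corr r s f g"
    using rs by (simp add: noise_corr_smear k_def h_def)
  finally show ?thesis by (simp add: m_def k_def mult.assoc)
qed

text \<open>The central limit estimate is applied to the iterates of \<open>f\<close>, with the
  iterate of \<open>g\<close>, rescaled by \<open>s\<close>, as test function. Rescaling raises the
  mass by at most \<open>1 / s ^ DIM('a)\<close>, which explains that factor in the error.\<close>

lemma noise_corr_limit:
  fixes f g :: "'a::euclidean_space \<Rightarrow> ennreal"
  assumes f: "even_log_concave f" and g: "even_log_concave g"
    and rs: "r\<^sup>2 + s\<^sup>2 = 1" "0 \<le> r" "0 < s" and n: "(r / s)\<^sup>2 \<le> 2 ^ n / 16"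
  shows "(mass f * mass g) ^ 2 ^ n \<le> noise_corr r s ((self_conv ^^ n) f) ((self_conv ^^ n) g) +
    ennreal (40000 * 2 ^ DIM('a) * (r / s) ^ 4 / s ^ DIM('a) / 2 ^ n) * (mass f * mass g) ^ 2 ^ n"
proof -
  define G where "G = (self_conv ^^ n) g"
  have G: "even_log_concave G" unfolding G_def by (rule even_log_concave_self_conv_iter[OF g])
  have [measurable]: "G \<in> borel_measurable borel" by (rule even_log_concaveD[OF G])
  have mG: "mass G = mass g ^ 2 ^ n" unfolding G_def by (rule mass_self_conv_iter[OF g])
  define h where "h = (\<lambda>w. G (s *\<^sub>R w))"
  have h: "even_log_concave h" unfolding h_def by (rule even_log_concave_scale[OF G])
  have s1: "s \<le> 1" using rs power2_le_imp_le[of s 1] zero_le_power2[of r] by (simp add: algebra_simps)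
  have sinv: "ennreal (1 / s ^ DIM('a)) * ennreal (s ^ DIM('a)) = 1"
    using rs by (simp flip: ennreal_mult)
  have "mass h = ennreal (1 / s ^ DIM('a)) * (ennreal (s ^ DIM('a)) * mass h)"
    by (simp only: mult.assoc[symmetric] sinv mult_1)
  also have "\<dots> \<le> ennreal (1 / s ^ DIM('a)) * mass G"
    unfolding h_def using rs s1 by (intro mult_left_mono nn_integral_std_gauss_scale_le) auto
  finally have mh: "mass h \<le> ennreal (1 / s ^ DIM('a)) * mass G" .
  let ?C = "40000 * 2 ^ DIM('a) * (r / s) ^ 4 / 2 ^ n"
  have "(mass f * mass g) ^ 2 ^ n = mass f ^ 2 ^ n * mass (smear (r / s) h)"
    unfolding h_def using rs by (subst mass_smear_scale) (simp_all add: power_mult_distrib mG)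
  also have "\<dots> \<le> (\<integral>\<^sup>+x. (self_conv ^^ n) f x * smear (r / s) h x \<partial>std_gauss) +
      ennreal ?C * (mass f ^ 2 ^ n * mass h)"
    by (rule self_conv_central_limit[OF f h _ n]) (use rs in simp)
  also have "\<dots> \<le> (\<integral>\<^sup>+x. (self_conv ^^ n) f x * smear (r / s) h x \<partial>std_gauss) +
      ennreal ?C * (mass f ^ 2 ^ n * (ennreal (1 / s ^ DIM('a)) * mass G))"
    by (intro add_mono order_refl mult_left_mono mh) auto
  also have "ennreal ?C * (mass f ^ 2 ^ n * (ennreal (1 / s ^ DIM('a)) * mass G)) =
      (ennreal ?C * ennreal (1 / s ^ DIM('a))) * (mass f * mass g) ^ 2 ^ n"
    by (simp add: mG power_mult_distrib ac_simps)
  also have "ennreal ?C * ennreal (1 / s ^ DIM('a)) = ennreal (40000 * 2 ^ DIM('a) * (r / s) ^ 4 / s ^ DIM('a) / 2 ^ n)"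
    using rs by (subst ennreal_mult[symmetric]) simp_all
  also have "(\<integral>\<^sup>+x. (self_conv ^^ n) f x * smear (r / s) h x \<partial>std_gauss) =
      noise_corr r s ((self_conv ^^ n) f) ((self_conv ^^ n) g)"
    using rs by (subst noise_corr_smear) (simp_all add: h_def G_def)
  finally show ?thesis .
qed

theorem Gaussian_correlation_functional:
  fixes f g :: "'a::euclidean_space \<Rightarrow> ennreal"
  assumes f: "even_log_concave f" and g: "even_log_concave g"
    and rs: "r\<^sup>2 + s\<^sup>2 = 1" "0 \<le> r" "0 < s"
  shows "mass f * mass g \<le> noise_corr r s f g"
proof -
  define P where "P c \<longleftrightarrow> 0 \<le> c \<and> (\<forall>f g :: 'a \<Rightarrow> ennreal. even_log_concave f \<longrightarrow> even_log_concave g \<longrightarrow>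
      ennreal c * (mass f * mass g) \<le> noise_corr r s f g)" for c :: real
  define S where "S = Collect P"
  define c where "c = Sup S"
  \<comment> \<open>The pair of constant functions 1 shows that no admissible constant exceeds
    1.\<close>
  have le1: "x \<le> 1" if "P x" for x
  proof -
    have "even_log_concave (\<lambda>_::'a. 1)" by (rule even_log_concave_const) simp
    then have "ennreal x \<le> 1" using that unfolding P_def noise_corr_def by fastforce
    then show ?thesis by simp
  qed
  define c0 where "c0 = exp (- (2 * (r / s)\<^sup>2 * sqrt 2 ^ DIM('a)))"
  have c0: "P c0" unfolding P_def c0_def using noise_corr_lower_bound[OF _ _ rs(1)] rs by auto
  have ne: "S \<noteq> {}" and bdd: "bdd_above S"
    using c0 le1 by (auto simp: S_def intro!: bdd_aboveI[of _ 1])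
  have c_pos: "0 < c"
  proof -
    have "0 < c0" by (simp add: c0_def)
    also have "c0 \<le> c" unfolding c_def using c0 bdd by (intro cSup_upper) (auto simp: S_def)
    finally show ?thesis .
  qed
  \<comment> \<open>The supremum is itself admissible, since for each pair of functions the
    condition is a closed one on the constant.\<close>
  have Pc: "P c"
    unfolding P_def
  proof (intro conjI allI impI)
    show "0 \<le> c" using c_pos by simp
    fix f g :: "'a \<Rightarrow> ennreal" assume fg: "even_log_concave f" "even_log_concave g"
    obtain m where m: "mass f * mass g = ennreal m" "0 \<le> m"
      using mass_finite[OF fg(1)] mass_finite[OF fg(2)]
      by (cases "mass f"; cases "mass g") (auto simp flip: ennreal_mult)
    obtain j where j: "noise_corr r s f g = ennreal j" "0 \<le> j"
      using noise_corr_finite[OF fg, of r s] by (cases "noise_corr r s f g") auto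
    have le: "x * m \<le> j" if "x \<in> S" for x
    proof -
      have "0 \<le> x" "ennreal x * (mass f * mass g) \<le> noise_corr r s f g"
        using that fg by (auto simp: S_def P_def)
      then show ?thesis using m j by (simp flip: ennreal_mult)
    qed
    have "c * m \<le> j"
    proof (cases "m = 0")
      case False
      then have "c \<le> j / m" unfolding c_def using le m by (intro cSup_least[OF ne]) (auto simp: field_simps)
      then show ?thesis using False m by (simp add: field_simps)
    qed (use j in simp)
    then show "ennreal c * (mass f * mass g) \<le> noise_corr r s f g"
      using m j c_pos by (simp add: ennreal_leI flip: ennreal_mult)
  qed
  define D where "D = 40000 * 2 ^ DIM('a) * (r / s) ^ 4 / s ^ DIM('a)"
  have D0: "0 \<le> D" using rs by (simp add: D_def)
  have improve: "1 - D / 2 ^ n \<le> c" if n: "(r / s)\<^sup>2 \<le> 2 ^ n / 16" "D \<le> 2 ^ n" for n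
  proof -
    define N :: nat where "N = 2 ^ n"
    have N: "0 < N" by (simp add: N_def)
    define d where "d = 1 - D / 2 ^ n"
    have d: "0 \<le> d" using n by (simp add: d_def)
    \<comment> \<open>The constant obtained by taking the \<open>N\<close>-th root in the iterated
      inequality. It is admissible, hence at most \<open>c\<close>; cancelling
      \<open>c ^ (N - 1)\<close>, possible as \<open>c > 0\<close>, leaves
      \<open>d \<le> c\<close>.\<close>
    define c' where "c' = root N (c ^ (N - 1) * d)"
    have c': "0 \<le> c'" "c' ^ N = c ^ (N - 1) * d"
      using c_pos d N by (auto simp: c'_def real_root_pow_pos2)
    have "P c'"
      unfolding P_def
    proof (intro conjI allI impI c')
      fix f g :: "'a \<Rightarrow> ennreal" assume fg: "even_log_concave f" "even_log_concave g"
      obtain m where m: "mass f * mass g = ennreal m" "0 \<le> m"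
        using mass_finite[OF fg(1)] mass_finite[OF fg(2)]
        by (cases "mass f"; cases "mass g") (auto simp flip: ennreal_mult)
      obtain j where j: "noise_corr r s f g = ennreal j" "0 \<le> j"
        using noise_corr_finite[OF fg, of r s] by (cases "noise_corr r s f g") auto
      let ?J = "noise_corr r s ((self_conv ^^ n) f) ((self_conv ^^ n) g)"
      obtain i where i: "?J = ennreal i" "0 \<le> i"
        using noise_corr_finite[OF even_log_concave_self_conv_iter[OF fg(1)] even_log_concave_self_conv_iter[OF fg(2)], of r s n n]
        by (cases ?J) auto
      have "ennreal (m ^ N) \<le> ennreal i + ennreal (D / 2 ^ n) * ennreal (m ^ N)"
        using noise_corr_limit[OF fg rs n(1)] m i
        unfolding D_def[symmetric] N_def[symmetric] by (simp add: ennreal_power)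
      also have "\<dots> = ennreal (i + D / 2 ^ n * m ^ N)"
        using m i D0 by (subst ennreal_mult[symmetric], simp, simp, subst ennreal_plus) auto
      finally have "m ^ N \<le> i + D / 2 ^ n * m ^ N"
        using m i D0 by (subst (asm) ennreal_le_iff) auto
      then have 1: "d * m ^ N \<le> i" by (simp add: d_def left_diff_distrib)
      have "ennreal c ^ (N - 1) * ?J \<le> noise_corr r s f g ^ N"
        unfolding N_def using Pc fg by (intro noise_corr_self_conv_iter) (auto simp: P_def)
      then have 2: "c ^ (N - 1) * i \<le> j ^ N"
        using i j c_pos by (simp add: ennreal_power flip: ennreal_mult)
      have "(c' * m) ^ N = c ^ (N - 1) * (d * m ^ N)" by (simp add: power_mult_distrib c')
      also have "\<dots> \<le> c ^ (N - 1) * i" using 1 c_pos by (intro mult_left_mono) auto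
      also have "\<dots> \<le> j ^ N" by (rule 2)
      finally have "c' * m \<le> j" using j N by (simp add: power_mono_iff c' m)
      then show "ennreal c' * (mass f * mass g) \<le> noise_corr r s f g"
        using m j c' by (simp add: ennreal_leI flip: ennreal_mult)
    qed
    then have "c' \<le> c" unfolding c_def using bdd by (intro cSup_upper) (auto simp: S_def)
    then have "c' ^ N \<le> c ^ N" using c' by (intro power_mono) auto
    then have "c ^ (N - 1) * d \<le> c ^ (N - 1) * c"
      using c' N by (simp add: power_eq_if[of c N] mult.commute)
    then show ?thesis using c_pos by (simp add: d_def)
  qed
  have "1 \<le> c"
  proof (rule tendsto_upperbound)
    show "(\<lambda>n. 1 - D / 2 ^ n) \<longlonglongrightarrow> 1"
    proof -
      have "(\<lambda>n. 1 - D * (1 / 2) ^ n) \<longlonglongrightarrow> 1 - D * 0"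
        by (intro tendsto_intros LIMSEQ_realpow_zero) auto
      then show ?thesis by (simp add: power_one_over)
    qed
    obtain n0 where n0: "max (16 * (r / s)\<^sup>2) D < 2 ^ n0"
      using real_arch_pow[of 2 "max (16 * (r / s)\<^sup>2) D"] by auto
    have "16 * (r / s)\<^sup>2 \<le> 2 ^ n \<and> D \<le> 2 ^ n" if "n0 \<le> n" for n
    proof -
      have "(2::real) ^ n0 \<le> 2 ^ n" using that by (intro power_increasing) auto
      then show ?thesis using n0 by linarith
    qed
    then have "eventually (\<lambda>n. 16 * (r / s)\<^sup>2 \<le> 2 ^ n \<and> D \<le> 2 ^ n) sequentially"
      unfolding eventually_sequentially by blast
    then show "eventually (\<lambda>n. 1 - D / 2 ^ n \<le> c) sequentially"
      by eventually_elim (rule improve, auto simp: field_simps)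
  qed simp
  moreover have "c \<le> 1" using le1 Pc by blast
  ultimately have "c = 1" by simp
  then show ?thesis using Pc f g unfolding P_def by (metis ennreal_1 mult_1)
qed

section \<open>The strong form for convex sets\<close>

lemma symmetric_set_uminus_iff: "symmetric_set A \<Longrightarrow> - x \<in> A \<longleftrightarrow> x \<in> A"
  unfolding symmetric_set_def by (metis image_iff minus_minus)

lemma convex_midpoint: "convex A \<Longrightarrow> x \<in> A \<Longrightarrow> y \<in> A \<Longrightarrow> midpoint x y \<in> A"
  using convexD[of A x y "1 / 2" "1 / 2"] by (simp add: midpoint_def scaleR_add_right)

lemma indicator_log_concave:
  assumes "convex A"
  shows "indicator A x * indicator A y \<le> ((indicator A (midpoint x y))\<^sup>2 :: ennreal)"
  using convex_midpoint[OF assms, of x y] by (auto simp: indicator_def)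

lemma even_log_concave_indicator:
  assumes "convex A" "symmetric_set A" "A \<in> sets borel"
  shows "even_log_concave (indicator A :: 'a::euclidean_space \<Rightarrow> ennreal)"
  unfolding even_log_concave_def
  using assms indicator_log_concave[OF assms(1)]
  by (auto simp: indicator_def symmetric_set_uminus_iff)

section \<open>Coupled Gaussian weights\<close>

text \<open>Leaving the weight unnormalised allows the coupling \<open>t\<close> to be raised while
  \<open>b\<close> stays fixed.\<close>

definition tilted_mass :: "real \<Rightarrow> real \<Rightarrow> 'a::euclidean_space set \<Rightarrow> 'a set \<Rightarrow> ennreal" where
  "tilted_mass b t A B = (\<integral>\<^sup>+x. \<integral>\<^sup>+y. ennreal (exp (- (b / 2) * ((norm x)\<^sup>2 + (norm y)\<^sup>2) + b * t * (x \<bullet> y))) *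
    (indicator A x * indicator B y) \<partial>lborel \<partial>lborel)"

text \<open>Averaging over \<open>x\<close> and \<open>- x\<close>, with \<open>A\<close> symmetric,
  replaces the exponential of the coupling by \<open>cosh\<close>, which increases with the absolute
  value of its argument.\<close>

lemma tilted_mass_mono:
  fixes A B :: "'a::euclidean_space set"
  assumes [measurable]: "A \<in> sets borel" "B \<in> sets borel" and A: "symmetric_set A"
    and b: "0 \<le> b" and t: "0 \<le> t" "t \<le> t'"
  shows "tilted_mass b t A B \<le> tilted_mass b t' A B"
proof -
  define q where "q x y = exp (- (b / 2) * ((norm x)\<^sup>2 + (norm y)\<^sup>2))" for x y :: 'a
  have [measurable]: "case_prod q \<in> borel_measurable (borel \<Otimes>\<^sub>M borel)"
    unfolding q_def by measurable
  define F where "F u x y = ennreal (q x y * exp (b * u * (x \<bullet> y))) * (indicator A x * indicator B y)" for u x y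
  have [measurable]: "case_prod (F u) \<in> borel_measurable (borel \<Otimes>\<^sub>M borel)" for u
    unfolding F_def by measurable
  have T: "tilted_mass b u A B = (\<integral>\<^sup>+x. \<integral>\<^sup>+y. F u x y \<partial>lborel \<partial>lborel)" for u
    unfolding tilted_mass_def F_def q_def by (simp only: exp_add)
  have sym: "tilted_mass b (- u) A B = tilted_mass b u A B" for u
  proof -
    have "F (- u) (- x) y = F u x y" for x y
      by (simp add: F_def q_def indicator_def symmetric_set_uminus_iff[OF A])
    then show ?thesis
      using nn_integral_lborel_affine[of "\<lambda>x. \<integral>\<^sup>+y. F (- u) x y \<partial>lborel" "- 1" 0] by (simp add: T)
  qed
  have two: "2 * tilted_mass b u A B =
      (\<integral>\<^sup>+x. \<integral>\<^sup>+y. ennreal (q x y * (2 * cosh (b * u * (x \<bullet> y)))) * (indicator A x * indicator B y) \<partial>lborel \<partial>lborel)" for u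
  proof -
    have "2 * tilted_mass b u A B = tilted_mass b u A B + tilted_mass b (- u) A B"
      by (simp add: sym mult_2)
    also have "\<dots> = (\<integral>\<^sup>+x. \<integral>\<^sup>+y. F u x y + F (- u) x y \<partial>lborel \<partial>lborel)"
      unfolding T by (simp add: nn_integral_add)
    also have "\<dots> = (\<integral>\<^sup>+x. \<integral>\<^sup>+y. ennreal (q x y * (2 * cosh (b * u * (x \<bullet> y)))) * (indicator A x * indicator B y) \<partial>lborel \<partial>lborel)"
    proof -
      have "F u x y + F (- u) x y = ennreal (q x y * (2 * cosh (b * u * (x \<bullet> y)))) * (indicator A x * indicator B y)" for x y
      proof -
        have "ennreal (q x y * exp (b * u * (x \<bullet> y))) + ennreal (q x y * exp (b * - u * (x \<bullet> y))) =
            ennreal (q x y * exp (b * u * (x \<bullet> y)) + q x y * exp (b * - u * (x \<bullet> y)))"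
          by (rule ennreal_plus[symmetric]) (auto simp: q_def)
        also have "q x y * exp (b * u * (x \<bullet> y)) + q x y * exp (b * - u * (x \<bullet> y)) = q x y * (2 * cosh (b * u * (x \<bullet> y)))"
          by (simp add: cosh_field_def algebra_simps)
        finally show ?thesis unfolding F_def distrib_right[symmetric] by simp
      qed
      then show ?thesis by simp
    qed
    finally show ?thesis .
  qed
  have "2 * tilted_mass b t A B \<le> 2 * tilted_mass b t' A B"
    unfolding two
  proof (intro nn_integral_mono mult_right_mono ennreal_leI mult_left_mono)
    fix x y :: 'a
    have "\<bar>b * t * (x \<bullet> y)\<bar> \<le> \<bar>b * t' * (x \<bullet> y)\<bar>"
      using b t by (simp add: abs_mult mult_right_mono mult_left_mono)
    then show "cosh (b * t * (x \<bullet> y)) \<le> cosh (b * t' * (x \<bullet> y))"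
      using cosh_real_nonneg_le_iff[of "\<bar>b * t * (x \<bullet> y)\<bar>" "\<bar>b * t' * (x \<bullet> y)\<bar>"]
      by (simp only: cosh_real_abs abs_ge_zero)
  qed (auto simp: q_def)
  then show ?thesis by (subst (asm) ennreal_mult_le_mult_iff) auto
qed

text \<open>Substituting \<open>y = r x + s z\<close> produces the joint density of the correlated
  pair; \<open>r\<^sup>2 + s\<^sup>2 = 1\<close> makes its exponent symmetric in \<open>x\<close>
  and \<open>y\<close>.\<close>

lemma noise_corr_indicator:
  fixes A B :: "'a::euclidean_space set"
  assumes [measurable]: "A \<in> sets borel" "B \<in> sets borel" and rs: "r\<^sup>2 + s\<^sup>2 = 1" "0 < s"
  shows "noise_corr r s (indicator A) (indicator B) =
    ennreal (((1 / sqrt (2 * pi)) ^ DIM('a))\<^sup>2 / s ^ DIM('a)) * tilted_mass (1 / s\<^sup>2) r A B"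
proof -
  let ?n = "DIM('a)"
  let ?k = "(1 / sqrt (2 * pi)) ^ ?n :: real"
  define G where "G x y = ennreal (std_gauss_density ((1 / s) *\<^sub>R (y - r *\<^sub>R x))) * indicator B y" for x y :: 'a
  have [measurable]: "case_prod G \<in> borel_measurable (borel \<Otimes>\<^sub>M borel)"
    unfolding G_def by measurable
  have inner: "(\<integral>\<^sup>+z. indicator B (r *\<^sub>R x + s *\<^sub>R z) \<partial>std_gauss) = ennreal (1 / s ^ ?n) * (\<integral>\<^sup>+y. G x y \<partial>lborel)" for x
  proof -
    have "(\<integral>\<^sup>+y. G x y \<partial>lborel) = ennreal (s ^ ?n) * (\<integral>\<^sup>+z. G x (r *\<^sub>R x + s *\<^sub>R z) \<partial>lborel)"
      using rs nn_integral_lborel_affine[of "G x" s "r *\<^sub>R x"] by simp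
    also have "(\<integral>\<^sup>+z. G x (r *\<^sub>R x + s *\<^sub>R z) \<partial>lborel) = (\<integral>\<^sup>+z. indicator B (r *\<^sub>R x + s *\<^sub>R z) \<partial>std_gauss)"
      using rs by (subst nn_integral_std_gauss) (simp_all add: G_def)
    also have "ennreal (1 / s ^ ?n) * (ennreal (s ^ ?n) * X) = X" for X
      using rs by (simp add: mult.assoc[symmetric] flip: ennreal_mult)
    finally show ?thesis
      by (metis \<open>\<And>X. ennreal (1 / s ^ DIM('a)) * (ennreal (s ^ DIM('a)) * X) = X\<close>)
  qed
  have dens: "ennreal (std_gauss_density x) * ennreal (std_gauss_density ((1 / s) *\<^sub>R (y - r *\<^sub>R x))) =
      ennreal (?k\<^sup>2) * ennreal (exp (- ((1 / s\<^sup>2) / 2) * ((norm x)\<^sup>2 + (norm y)\<^sup>2) + (1 / s\<^sup>2) * r * (x \<bullet> y)))" for x y :: 'a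
  proof -
    have n2: "(norm (y - r *\<^sub>R x))\<^sup>2 = (norm y)\<^sup>2 - 2 * r * (x \<bullet> y) + r\<^sup>2 * (norm x)\<^sup>2"
      unfolding power2_norm_eq_inner
      by (simp add: inner_diff_left inner_diff_right inner_commute power2_eq_square algebra_simps)
    have r2: "r\<^sup>2 = 1 - s\<^sup>2" using rs by simp
    have n3: "(norm ((1 / s) *\<^sub>R (y - r *\<^sub>R x)))\<^sup>2 = (norm (y - r *\<^sub>R x))\<^sup>2 / s\<^sup>2"
      by (simp only: norm_scaleR power_mult_distrib) (simp add: power_divide)
    have "- (norm x)\<^sup>2 / 2 + - (norm ((1 / s) *\<^sub>R (y - r *\<^sub>R x)))\<^sup>2 / 2 =
      - ((1 / s\<^sup>2) / 2) * ((norm x)\<^sup>2 + (norm y)\<^sup>2) + (1 / s\<^sup>2) * r * (x \<bullet> y)"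
      unfolding n3 n2 r2 using rs(2) by (simp add: field_simps)
    then have e: "exp (- (norm x)\<^sup>2 / 2) * exp (- (norm ((1 / s) *\<^sub>R (y - r *\<^sub>R x)))\<^sup>2 / 2) =
      exp (- ((1 / s\<^sup>2) / 2) * ((norm x)\<^sup>2 + (norm y)\<^sup>2) + (1 / s\<^sup>2) * r * (x \<bullet> y))"
      by (simp only: exp_add[symmetric])
    have "std_gauss_density x * std_gauss_density ((1 / s) *\<^sub>R (y - r *\<^sub>R x)) =
      ?k\<^sup>2 * exp (- ((1 / s\<^sup>2) / 2) * ((norm x)\<^sup>2 + (norm y)\<^sup>2) + (1 / s\<^sup>2) * r * (x \<bullet> y))"
      unfolding std_gauss_density_eq e[symmetric] power2_eq_square[of ?k] by (simp only: mult_ac)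
    then show ?thesis
      by (simp add: less_imp_le[OF std_gauss_density_pos] flip: ennreal_mult)
  qed
  have "noise_corr r s (indicator A) (indicator B) =
      (\<integral>\<^sup>+x. ennreal (std_gauss_density x) * (indicator A x * (ennreal (1 / s ^ ?n) * (\<integral>\<^sup>+y. G x y \<partial>lborel))) \<partial>lborel)"
    unfolding noise_corr_def inner by (rule nn_integral_std_gauss) measurable
  also have "\<dots> = (\<integral>\<^sup>+x. \<integral>\<^sup>+y. ennreal (1 / s ^ ?n) * (ennreal (?k\<^sup>2) *
      (ennreal (exp (- ((1 / s\<^sup>2) / 2) * ((norm x)\<^sup>2 + (norm y)\<^sup>2) + (1 / s\<^sup>2) * r * (x \<bullet> y))) *
      (indicator A x * indicator B y))) \<partial>lborel \<partial>lborel)"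
  proof (rule nn_integral_cong)
    fix x :: 'a
    have "ennreal (std_gauss_density x) * (indicator A x * (ennreal (1 / s ^ ?n) * (\<integral>\<^sup>+y. G x y \<partial>lborel))) =
      (\<integral>\<^sup>+y. ennreal (1 / s ^ ?n) * (ennreal (std_gauss_density x) * ennreal (std_gauss_density ((1 / s) *\<^sub>R (y - r *\<^sub>R x))) * (indicator A x * indicator B y)) \<partial>lborel)"
      unfolding G_def
      by (subst nn_integral_cmult[symmetric], measurable, subst nn_integral_cmult[symmetric], measurable,
          subst nn_integral_cmult[symmetric], measurable) (simp add: ac_simps)
    then show "ennreal (std_gauss_density x) * (indicator A x * (ennreal (1 / s ^ ?n) * (\<integral>\<^sup>+y. G x y \<partial>lborel))) =
      (\<integral>\<^sup>+y. ennreal (1 / s ^ ?n) * (ennreal (?k\<^sup>2) *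
      (ennreal (exp (- ((1 / s\<^sup>2) / 2) * ((norm x)\<^sup>2 + (norm y)\<^sup>2) + (1 / s\<^sup>2) * r * (x \<bullet> y))) *
      (indicator A x * indicator B y))) \<partial>lborel)"
      unfolding dens mult.assoc .
  qed
  also have "\<dots> = ennreal (1 / s ^ ?n) * (ennreal (?k\<^sup>2) * tilted_mass (1 / s\<^sup>2) r A B)"
    unfolding tilted_mass_def by (simp add: nn_integral_cmult)
  also have "\<dots> = ennreal (?k\<^sup>2 / s ^ ?n) * tilted_mass (1 / s\<^sup>2) r A B"
    unfolding mult.assoc[symmetric] using rs by (subst ennreal_mult[symmetric]) simp_all
  finally show ?thesis .
qed

lemma open_set_plus:
  fixes A B :: "'a::real_normed_vector set"
  assumes "open A"
  shows "open (A + B)"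
proof -
  have "A + B = (\<Union>b\<in>B. (+) b ` A)" by (force simp: set_plus_def image_iff add.commute)
  then show ?thesis using assms by (auto intro: open_translation)
qed

text \<open>For \<open>r\<close> with \<open>p / \<alpha> + r / \<beta> \<in> A\<close> and \<open>r / \<beta> - p / \<alpha> \<in> B\<close> the point \<open>p\<close> lies in a multiple of \<open>A + B\<close>,
  and the mass of these \<open>r\<close> is an even log-concave function of \<open>p\<close>, hence largest at \<open>p = 0\<close>.\<close>

lemma tilted_mass_le:
  fixes A B :: "'a::euclidean_space set"
  assumes A: "convex A" "symmetric_set A" "open A" and B: "convex B" "symmetric_set B" "open B"
    and \<alpha>: "0 < \<alpha>" "\<alpha>\<^sup>2 = 2 * b * (1 + t)" and \<beta>: "0 < \<beta>" "\<beta>\<^sup>2 = 2 * b * (1 - t)"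
  shows "ennreal (((1 / sqrt (2 * pi)) ^ DIM('a))\<^sup>2) * tilted_mass b t A B \<le>
    ennreal ((2 / (\<alpha> * \<beta>)) ^ DIM('a)) *
    (emeasure std_gauss ((\<lambda>x. \<beta> *\<^sub>R x) ` (A \<inter> B)) * emeasure std_gauss ((\<lambda>x. (\<alpha> / 2) *\<^sub>R x) ` (A + B)))"
proof -
  let ?n = "DIM('a)"
  let ?k = "(1 / sqrt (2 * pi)) ^ ?n :: real"
  have [measurable]: "A \<in> sets borel" "B \<in> sets borel" using A B by auto
  define H where "H x y = ennreal (exp (- (b / 2) * ((norm x)\<^sup>2 + (norm y)\<^sup>2) + b * t * (x \<bullet> y))) *
    (indicator A x * indicator B y)" for x y
  have [measurable]: "case_prod H \<in> borel_measurable (borel \<Otimes>\<^sub>M borel)" unfolding H_def by measurable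
  define \<Phi> :: "'a \<Rightarrow> 'a \<Rightarrow> ennreal" where
    "\<Phi> p r = indicator A ((1 / \<alpha>) *\<^sub>R p + (1 / \<beta>) *\<^sub>R r) * indicator B ((1 / \<beta>) *\<^sub>R r - (1 / \<alpha>) *\<^sub>R p)" for p r
  have [measurable]: "case_prod \<Phi> \<in> borel_measurable (borel \<Otimes>\<^sub>M borel)" unfolding \<Phi>_def by measurable
  \<comment> \<open>The coordinates \<open>p = \<alpha> (x - y) / 2\<close> and
    \<open>r = \<beta> (x + y) / 2\<close> diagonalise the quadratic form, and
    \<open>\<alpha>\<close>, \<open>\<beta>\<close> are chosen to make both of them standard
    Gaussian.\<close>
  let ?x = "\<lambda>p r. (1 / \<alpha>) *\<^sub>R p + (1 / \<beta>) *\<^sub>R r" and ?y = "\<lambda>p r. (1 / \<beta>) *\<^sub>R r - (1 / \<alpha>) *\<^sub>R p"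
  have H\<Phi>: "ennreal (?k\<^sup>2) * H (?x p r) (?y p r) = ennreal (std_gauss_density p) * (ennreal (std_gauss_density r) * \<Phi> p r)" for p r
  proof -
    define P R where "P = (1 / \<alpha>) *\<^sub>R p" and "R = (1 / \<beta>) *\<^sub>R r"
    have n1: "(norm p)\<^sup>2 = \<alpha>\<^sup>2 * (norm P)\<^sup>2" "(norm r)\<^sup>2 = \<beta>\<^sup>2 * (norm R)\<^sup>2"
      using \<alpha>(1) \<beta>(1) by (simp_all add: P_def R_def power_divide)
    have "- (b / 2) * ((norm (P + R))\<^sup>2 + (norm (R - P))\<^sup>2) + b * t * ((P + R) \<bullet> (R - P)) =
        - (norm p)\<^sup>2 / 2 + - (norm r)\<^sup>2 / 2"
      unfolding n1 \<alpha> \<beta> unfolding power2_norm_eq_inner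
      by (simp add: inner_add_left inner_add_right inner_diff_left inner_diff_right inner_commute field_simps)
    then have e: "exp (- (b / 2) * ((norm (P + R))\<^sup>2 + (norm (R - P))\<^sup>2) + b * t * ((P + R) \<bullet> (R - P))) =
        exp (- (norm p)\<^sup>2 / 2) * exp (- (norm r)\<^sup>2 / 2)"
      by (simp only: exp_add)
    have "?k\<^sup>2 * exp (- (b / 2) * ((norm (P + R))\<^sup>2 + (norm (R - P))\<^sup>2) + b * t * ((P + R) \<bullet> (R - P))) = std_gauss_density p * std_gauss_density r"
      unfolding std_gauss_density_eq e power2_eq_square[of ?k] by (simp only: mult_ac)
    then have "ennreal (?k\<^sup>2) * ennreal (exp (- (b / 2) * ((norm (P + R))\<^sup>2 + (norm (R - P))\<^sup>2) + b * t * ((P + R) \<bullet> (R - P)))) =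
        ennreal (std_gauss_density p) * ennreal (std_gauss_density r)"
      by (simp add: less_imp_le[OF std_gauss_density_pos] flip: ennreal_mult)
    then show ?thesis unfolding H_def \<Phi>_def P_def R_def by (simp only: mult.assoc[symmetric])
  qed
  have "tilted_mass b t A B = (\<integral>\<^sup>+x. ennreal ((2 / \<alpha>) ^ ?n) * (\<integral>\<^sup>+p. H x (x - (2 / \<alpha>) *\<^sub>R p) \<partial>lborel) \<partial>lborel)"
    unfolding tilted_mass_def H_def[symmetric]
  proof (rule nn_integral_cong)
    show "(\<integral>\<^sup>+y. H x y \<partial>lborel) = ennreal ((2 / \<alpha>) ^ ?n) * (\<integral>\<^sup>+p. H x (x - (2 / \<alpha>) *\<^sub>R p) \<partial>lborel)" for x
      using \<alpha>(1) nn_integral_lborel_affine[of "H x" "- 2 / \<alpha>" x] by (simp add: abs_divide)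
  qed
  also have "\<dots> = ennreal ((2 / \<alpha>) ^ ?n) * (\<integral>\<^sup>+p. \<integral>\<^sup>+x. H x (x - (2 / \<alpha>) *\<^sub>R p) \<partial>lborel \<partial>lborel)"
    by (subst nn_integral_cmult, simp, subst lborel_pair.Fubini', simp_all)
  also have "(\<integral>\<^sup>+p. \<integral>\<^sup>+x. H x (x - (2 / \<alpha>) *\<^sub>R p) \<partial>lborel \<partial>lborel) =
      (\<integral>\<^sup>+p. ennreal ((1 / \<beta>) ^ ?n) * (\<integral>\<^sup>+r. H (?x p r) (?y p r) \<partial>lborel) \<partial>lborel)"
  proof (rule nn_integral_cong)
    fix p :: 'a
    have y: "?x p r - (2 / \<alpha>) *\<^sub>R p = ?y p r" for r
      by (simp add: algebra_simps scaleR_2[symmetric] flip: scaleR_add_left)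
    show "(\<integral>\<^sup>+x. H x (x - (2 / \<alpha>) *\<^sub>R p) \<partial>lborel) = ennreal ((1 / \<beta>) ^ ?n) * (\<integral>\<^sup>+r. H (?x p r) (?y p r) \<partial>lborel)"
      using \<beta>(1) nn_integral_lborel_affine[of "\<lambda>x. H x (x - (2 / \<alpha>) *\<^sub>R p)" "1 / \<beta>" "(1 / \<alpha>) *\<^sub>R p"]
      by (simp only: y) simp
  qed
  also have "\<dots> = ennreal ((1 / \<beta>) ^ ?n) * (\<integral>\<^sup>+p. \<integral>\<^sup>+r. H (?x p r) (?y p r) \<partial>lborel \<partial>lborel)"
    by (rule nn_integral_cmult) measurable
  finally have "ennreal (?k\<^sup>2) * tilted_mass b t A B =
      (ennreal ((2 / \<alpha>) ^ ?n) * ennreal ((1 / \<beta>) ^ ?n)) * (ennreal (?k\<^sup>2) * (\<integral>\<^sup>+p. \<integral>\<^sup>+r. H (?x p r) (?y p r) \<partial>lborel \<partial>lborel))"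
    by (simp only: ac_simps)
  also have "ennreal (?k\<^sup>2) * (\<integral>\<^sup>+p. \<integral>\<^sup>+r. H (?x p r) (?y p r) \<partial>lborel \<partial>lborel) =
      (\<integral>\<^sup>+p. \<integral>\<^sup>+r. ennreal (?k\<^sup>2) * H (?x p r) (?y p r) \<partial>lborel \<partial>lborel)"
    by (simp add: nn_integral_cmult)
  also have "\<dots> = (\<integral>\<^sup>+p. \<integral>\<^sup>+r. \<Phi> p r \<partial>std_gauss \<partial>std_gauss)"
    unfolding H\<Phi> by (simp add: nn_integral_std_gauss nn_integral_cmult)
  also have "ennreal ((2 / \<alpha>) ^ ?n) * ennreal ((1 / \<beta>) ^ ?n) = ennreal ((2 / (\<alpha> * \<beta>)) ^ ?n)"
    using \<alpha>(1) \<beta>(1) by (subst ennreal_mult[symmetric]) (simp_all flip: power_mult_distrib)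
  also have "(\<integral>\<^sup>+p. \<integral>\<^sup>+r. \<Phi> p r \<partial>std_gauss \<partial>std_gauss) \<le>
      emeasure std_gauss ((\<lambda>x. \<beta> *\<^sub>R x) ` (A \<inter> B)) * emeasure std_gauss ((\<lambda>x. (\<alpha> / 2) *\<^sub>R x) ` (A + B))"
  proof -
    let ?I = "(\<lambda>x. \<beta> *\<^sub>R x) ` (A \<inter> B)" and ?S = "(\<lambda>x. (\<alpha> / 2) *\<^sub>R x) ` (A + B)"
    have [measurable]: "?I \<in> sets borel"
      using A B \<beta> by (intro borel_open open_scaling open_Int) auto
    have [measurable]: "?S \<in> sets borel"
      using A B \<alpha> by (intro borel_open open_scaling open_set_plus) auto
    have "even_log_concave (\<lambda>p. mass (\<Phi> p))"
    proof (rule even_log_concave_marginal)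
      fix p r p' r' :: 'a
      show "\<Phi> (- p) (- r) = \<Phi> p r"
        using symmetric_set_uminus_iff[OF A(2), of "?x p r"] symmetric_set_uminus_iff[OF B(2), of "?y p r"]
        by (simp add: \<Phi>_def indicator_def)
      have "?x (midpoint p p') (midpoint r r') = midpoint (?x p r) (?x p' r')"
        "?y (midpoint p p') (midpoint r r') = midpoint (?y p r) (?y p' r')"
        by (simp_all add: midpoint_def algebra_simps)
      then show "\<Phi> p r * \<Phi> p' r' \<le> (\<Phi> (midpoint p p') (midpoint r r'))\<^sup>2"
        unfolding \<Phi>_def by (simp only:) (intro log_concave_mult indicator_log_concave A B)
    next
      have "mass (\<Phi> 0) \<le> 1" by (rule mass_le) (simp add: \<Phi>_def indicator_def)
      then show "mass (\<Phi> 0) < top" by (rule order.strict_trans1) simp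
    qed measurable
    then have le: "mass (\<Phi> p) \<le> mass (\<Phi> 0)" for p by (rule even_log_concave_le_0)
    \<comment> \<open>If the section is not zero, then \<open>x - y = (2 / \<alpha>) p\<close> lies
      in \<open>A + B\<close>, because \<open>B\<close> is symmetric.\<close>
    have supp: "mass (\<Phi> p) = mass (\<Phi> p) * indicator ?S p" for p
    proof (cases "p \<in> ?S")
      case False
      have "\<Phi> p r = 0" for r
      proof (rule ccontr)
        assume "\<Phi> p r \<noteq> 0"
        then have "?x p r \<in> A" "?y p r \<in> B" by (auto simp: \<Phi>_def indicator_def split: if_splits)
        then have "?x p r + - ?y p r \<in> A + B"
          using symmetric_set_uminus_iff[OF B(2), of "?y p r"] by (intro set_plus_intro) auto
        moreover have "?x p r + - ?y p r = (2 / \<alpha>) *\<^sub>R p"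
          by (simp add: algebra_simps flip: scaleR_add_left)
        ultimately have "(2 / \<alpha>) *\<^sub>R p \<in> A + B" by simp
        then have "(\<alpha> / 2) *\<^sub>R ((2 / \<alpha>) *\<^sub>R p) \<in> ?S" by (rule imageI)
        then show False using False \<alpha>(1) by simp
      qed
      then show ?thesis using False by simp
    qed simp
    \<comment> \<open>At \<open>p = 0\<close> the two points coincide, which is where the
      intersection comes from.\<close>
    have "mass (\<Phi> 0) = (\<integral>\<^sup>+r. indicator ?I r \<partial>std_gauss)"
    proof (rule nn_integral_cong)
      fix r :: 'a
      have "r \<in> ?I \<longleftrightarrow> (1 / \<beta>) *\<^sub>R r \<in> A \<and> (1 / \<beta>) *\<^sub>R r \<in> B"
        using \<beta>(1) by (auto simp: image_iff intro!: bexI[of _ "(1 / \<beta>) *\<^sub>R r"])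
      then show "\<Phi> 0 r = indicator ?I r" by (simp add: \<Phi>_def indicator_def)
    qed
    then have m0: "mass (\<Phi> 0) = emeasure std_gauss ?I" by simp
    have "(\<integral>\<^sup>+p. mass (\<Phi> p) \<partial>std_gauss) \<le> (\<integral>\<^sup>+p. emeasure std_gauss ?I * indicator ?S p \<partial>std_gauss)"
      by (subst supp) (intro nn_integral_mono mult_right_mono, auto simp: le[unfolded m0])
    also have "\<dots> = emeasure std_gauss ?I * emeasure std_gauss ?S"
      by (simp add: nn_integral_cmult_indicator)
    finally show ?thesis .
  qed
  finally show ?thesis by (simp add: mult_left_mono)
qed

theorem strong_Gaussian_correlation_open:
  fixes A B :: "'a::euclidean_space set"
  assumes A: "convex A" "symmetric_set A" "open A" and B: "convex B" "symmetric_set B" "open B"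
    and s: "0 \<le> s" "sqrt s \<le> t" "t < 1"
  shows "emeasure std_gauss A * emeasure std_gauss B \<le>
    ennreal ((1 / sqrt (1 - s)) ^ DIM('a)) *
    (emeasure std_gauss ((\<lambda>x. sqrt (2 * (1 - s) / (1 + t)) *\<^sub>R x) ` (A \<inter> B)) *
     emeasure std_gauss ((\<lambda>x. sqrt ((1 - s) / (2 * (1 - t))) *\<^sub>R x) ` (A + B)))"
proof -
  let ?n = "DIM('a)"
  have [measurable]: "A \<in> sets borel" "B \<in> sets borel" using A B by auto
  have t0: "0 \<le> t" using s real_sqrt_ge_zero[of s] by linarith
  have st: "s \<le> t\<^sup>2" using s by (simp add: sqrt_le_D)
  have t1: "t\<^sup>2 < 1" using t0 s by (simp add: power_less_one_iff)
  have s1: "s < 1" using st t1 by simp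
  \<comment> \<open>This correlation gives the weight \<open>b = (1 - s) / (1 - t\<^sup>2)\<close>.
    With coupling \<open>t\<close> the scalings \<open>\<beta>\<close> and
    \<open>\<alpha> / 2\<close> of \<open>tilted_mass_le\<close> are then exactly the factors in the
    claim.\<close>
  define r where "r = sqrt ((t\<^sup>2 - s) / (1 - s))"
  define u where "u = sqrt ((1 - t\<^sup>2) / (1 - s))"
  define b where "b = 1 / u\<^sup>2"
  have u2: "u\<^sup>2 = (1 - t\<^sup>2) / (1 - s)" using t1 s1 by (simp add: u_def)
  have r2: "r\<^sup>2 = (t\<^sup>2 - s) / (1 - s)" using st s1 by (simp add: r_def)
  have ru: "r\<^sup>2 + u\<^sup>2 = 1" using s1 unfolding u2 r2 by (simp add: add_divide_distrib[symmetric])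
  have r0: "0 \<le> r" using st s1 by (simp add: r_def)
  have u0: "0 < u" using t1 s1 by (simp add: u_def)
  have b: "b = (1 - s) / (1 - t\<^sup>2)" by (simp add: b_def u2)
  have b0: "0 < b" using t1 s1 by (simp add: b)
  have rt: "r \<le> t"
  proof (rule power2_le_imp_le)
    have "s * t\<^sup>2 \<le> s * 1" using s t1 by (intro mult_left_mono) auto
    then show "r\<^sup>2 \<le> t\<^sup>2" using s1 unfolding r2 by (simp add: field_simps)
  qed (rule t0)
  define \<alpha> where "\<alpha> = 2 * sqrt ((1 - s) / (2 * (1 - t)))"
  define \<beta> where "\<beta> = sqrt (2 * (1 - s) / (1 + t))"
  have ft: "1 - t\<^sup>2 = (1 - t) * (1 + t)" by (simp add: power2_eq_square algebra_simps)
  have \<alpha>: "0 < \<alpha>" "\<alpha>\<^sup>2 = 2 * b * (1 + t)"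
    using s1 s t0 by (simp_all add: \<alpha>_def power_mult_distrib b ft) (simp add: field_simps)
  have \<beta>: "0 < \<beta>" "\<beta>\<^sup>2 = 2 * b * (1 - t)"
    using s1 s t0 by (simp_all add: \<beta>_def b ft)
  \<comment> \<open>Per dimension, the Jacobian of the diagonalising coordinates times that of the
    noise variable; it is checked after squaring to avoid nested roots.\<close>
  have const: "2 / (\<alpha> * \<beta>) / u = 1 / sqrt (1 - s)"
  proof (rule power2_eq_imp_eq)
    have "(2 / (\<alpha> * \<beta>) / u)\<^sup>2 = 4 / (\<alpha>\<^sup>2 * \<beta>\<^sup>2 * u\<^sup>2)" by (simp add: power_mult_distrib power_divide)
    also have "\<alpha>\<^sup>2 * \<beta>\<^sup>2 * u\<^sup>2 = 4 * (b * (1 - t\<^sup>2)) * (b * u\<^sup>2)" unfolding \<alpha> \<beta> ft by (simp only: mult_ac)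
    also have "b * (1 - t\<^sup>2) = 1 - s" using t1 by (simp add: b)
    also have "b * u\<^sup>2 = 1" using u0 by (simp add: b_def)
    finally show "(2 / (\<alpha> * \<beta>) / u)\<^sup>2 = (1 / sqrt (1 - s))\<^sup>2"
      using s1 by (simp add: power_divide) (simp add: field_simps)
  qed (use \<alpha> \<beta> u0 s1 in auto)
  let ?k = "(1 / sqrt (2 * pi)) ^ ?n :: real"
  let ?X = "emeasure std_gauss ((\<lambda>x. \<beta> *\<^sub>R x) ` (A \<inter> B)) * emeasure std_gauss ((\<lambda>x. (\<alpha> / 2) *\<^sub>R x) ` (A + B))"
  have "emeasure std_gauss A * emeasure std_gauss B = mass (indicator A) * mass (indicator B)" by simp
  also have "\<dots> \<le> noise_corr r u (indicator A) (indicator B)"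
    by (intro Gaussian_correlation_functional even_log_concave_indicator A B ru r0 u0) measurable
  also have "\<dots> = ennreal (?k\<^sup>2 / u ^ ?n) * tilted_mass b r A B"
    unfolding b_def by (intro noise_corr_indicator ru u0) measurable
  also have "\<dots> \<le> ennreal (?k\<^sup>2 / u ^ ?n) * tilted_mass b t A B"
    using b0 r0 rt A by (intro mult_left_mono tilted_mass_mono) auto
  also have "ennreal (?k\<^sup>2 / u ^ ?n) = ennreal (1 / u ^ ?n) * ennreal (?k\<^sup>2)"
    using u0 by (subst ennreal_mult[symmetric]) simp_all
  also have "\<dots> * tilted_mass b t A B \<le> ennreal (1 / u ^ ?n) * (ennreal ((2 / (\<alpha> * \<beta>)) ^ ?n) * ?X)"
    unfolding mult.assoc[of _ "ennreal (?k\<^sup>2)"] by (intro mult_left_mono tilted_mass_le A B \<alpha> \<beta>) simp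
  also have "\<dots> = ennreal ((1 / sqrt (1 - s)) ^ ?n) * ?X"
    unfolding const[symmetric] mult.assoc[symmetric] using u0 \<alpha> \<beta>
    by (subst ennreal_mult[symmetric]) (simp_all add: power_divide power_mult_distrib mult_ac)
  also have "\<alpha> / 2 = sqrt ((1 - s) / (2 * (1 - t)))" by (simp add: \<alpha>_def)
  finally show ?thesis unfolding \<beta>_def .
qed

section \<open>From open convex sets to arbitrary convex sets\<close>

lemma emeasure_gaussian_borel:
  fixes S :: "(real ^ 'n) set"
  assumes S: "S \<in> sets borel"
  shows "emeasure gaussian S = emeasure std_gauss S"
proof -
  let ?d = "\<lambda>x :: real ^ 'n. (2 * pi) powr (- real CARD('n) / 2) * exp (- (1 / 2) * (norm x)\<^sup>2)"
  have d: "?d x = std_gauss_density x" for x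
  proof -
    have "(2 * pi) powr (- real CARD('n) / 2) = ((2 * pi) powr (- 1 / 2)) powr real CARD('n)"
      by (simp add: powr_powr)
    also have "\<dots> = (1 / sqrt (2 * pi)) ^ CARD('n)"
      by (simp add: powr_realpow powr_minus_divide powr_half_sqrt)
    finally show ?thesis by (simp add: std_gauss_density_eq)
  qed
  have "emeasure gaussian S = (\<integral>\<^sup>+x. ennreal (std_gauss_density x) * indicator S x \<partial>lebesgue)"
    unfolding gaussian_def d using S
    by (intro emeasure_density measurable_completion) (auto intro: sets_completionI_sets)
  also have "\<dots> = (\<integral>\<^sup>+x. ennreal (std_gauss_density x) * indicator S x \<partial>lborel)"
    by (rule nn_integral_completion)
  also have "\<dots> = emeasure std_gauss S"
    unfolding std_gauss_def using S by (intro emeasure_density[symmetric]) auto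
  finally show ?thesis .
qed

text \<open>The frontier of a convex set is Lebesgue null, so the set differs from its open interior
  by a null set, which is also null for the Gaussian measure.\<close>

lemma emeasure_gaussian_convex:
  fixes S :: "(real ^ 'n) set"
  assumes S: "convex S"
  shows "S \<in> sets lebesgue" and "emeasure gaussian S = emeasure std_gauss (interior S)"
proof -
  have "negligible (frontier S)" by (rule negligible_convex_frontier[OF S])
  then have "negligible (S - interior S)"
    by (rule negligible_subset) (auto simp: frontier_def closure_def)
  then have null: "S - interior S \<in> null_sets lebesgue" by (simp add: negligible_iff_null_sets)
  have i: "interior S \<in> sets lebesgue" by (auto intro: sets_completionI_sets)
  have eq: "interior S \<union> (S - interior S) = S" using interior_subset by blast
  show "S \<in> sets lebesgue"
    using sets.Un[OF i null_setsD2[OF null]] unfolding eq .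
  let ?d = "\<lambda>x :: real ^ 'n. ennreal ((2 * pi) powr (- real CARD('n) / 2) * exp (- (1 / 2) * (norm x)\<^sup>2))"
  have d: "?d \<in> borel_measurable lebesgue" by (rule measurable_completion) simp
  have "AE x in lebesgue. x \<in> S - interior S \<longrightarrow> ?d x = 0"
    using AE_not_in[OF null] by (rule AE_mp) simp
  then have "S - interior S \<in> null_sets gaussian"
    unfolding gaussian_def
    by (rule null_sets_density_iff[OF d, THEN iffD2, OF conjI[OF null_setsD2[OF null]]])
  then have "emeasure gaussian (interior S \<union> (S - interior S)) = emeasure gaussian (interior S)"
    using i by (intro emeasure_Un_null_set) auto
  then show "emeasure gaussian S = emeasure std_gauss (interior S)"
    unfolding eq by (simp add: emeasure_gaussian_borel)
qed

theorem theorem1p2: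
  fixes A B :: "(real ^ 'n) set" and s t :: real
  assumes "convex A" and "symmetric_set A"
    and "convex B" and "symmetric_set B"
    and "0 \<le> s" and "sqrt s \<le> t" and "t < 1"
  shows "measure gaussian A * measure gaussian B
    \<le> (1 - s) powr (- real CARD('n) / 2)
      * measure gaussian ((\<lambda>x. sqrt (2 * (1 - s) / (1 + t)) *\<^sub>R x) ` (A \<inter> B))
      * measure gaussian ((\<lambda>x. sqrt ((1 - s) / (2 * (1 - t))) *\<^sub>R x) ` (A + B))"
proof -
  let ?c = "sqrt (2 * (1 - s) / (1 + t))" and ?d = "sqrt ((1 - s) / (2 * (1 - t)))"
  have t0: "0 \<le> t" using assms(5,6) real_sqrt_ge_zero[of s] by linarith
  have s1: "s < 1"
    using assms(5-7) by (metis le_less_trans not_less real_sqrt_ge_1_iff)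
  have sym: "symmetric_set (interior S)" if "symmetric_set S" for S :: "(real ^ 'n) set"
    using that interior_negations[of S] by (simp add: symmetric_set_def)
  define const where "const = (1 / sqrt (1 - s)) ^ CARD('n)"
  have const: "(1 - s) powr (- real CARD('n) / 2) = const"
  proof -
    have "(1 - s) powr (- real CARD('n) / 2) = ((1 - s) powr (- 1 / 2)) powr real CARD('n)"
      by (simp add: powr_powr)
    also have "\<dots> = const"
      using s1 by (simp add: powr_realpow powr_minus_divide powr_half_sqrt const_def)
    finally show ?thesis .
  qed
  have const0: "0 \<le> const" using s1 by (simp add: const_def)
  have cd: "?c \<noteq> 0" "?d \<noteq> 0" using s1 t0 assms(7) by auto
  \<comment> \<open>Finiteness, needed to pass from \<open>emeasure\<close> to
    \<open>measure\<close>, is inherited from the probability measure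
    \<open>std_gauss\<close>.\<close>
  have measure: "ennreal (measure gaussian S) = emeasure std_gauss (interior S)" if "convex S" for S :: "(real ^ 'n) set"
    using emeasure_gaussian_convex(2)[OF that] by (simp add: measure_def less_top[symmetric])
  have "ennreal (measure gaussian A * measure gaussian B) =
      emeasure std_gauss (interior A) * emeasure std_gauss (interior B)"
    using assms by (simp add: ennreal_mult measure)
  also have "\<dots> \<le> ennreal const *
    (emeasure std_gauss ((\<lambda>x. ?c *\<^sub>R x) ` (interior A \<inter> interior B)) *
     emeasure std_gauss ((\<lambda>x. ?d *\<^sub>R x) ` (interior A + interior B)))"
    using strong_Gaussian_correlation_open[of "interior A" "interior B" s t] assms
    by (simp add: sym convex_interior const_def)
  \<comment> \<open>Scaling by a nonzero factor and adding a set preserve openness, so the sets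
    built from the interiors are open and lie in the interiors of the sets built from
    \<open>A\<close> and \<open>B\<close>.\<close>
  also have "\<dots> \<le> ennreal const *
    (emeasure std_gauss (interior ((\<lambda>x. ?c *\<^sub>R x) ` (A \<inter> B))) *
     emeasure std_gauss (interior ((\<lambda>x. ?d *\<^sub>R x) ` (A + B))))"
  proof (intro mult_left_mono mult_mono emeasure_mono interior_maximal)
    show "(\<lambda>x. ?c *\<^sub>R x) ` (interior A \<inter> interior B) \<subseteq> (\<lambda>x. ?c *\<^sub>R x) ` (A \<inter> B)"
      using interior_subset by blast
    show "(\<lambda>x. ?d *\<^sub>R x) ` (interior A + interior B) \<subseteq> (\<lambda>x. ?d *\<^sub>R x) ` (A + B)"
      by (intro image_mono set_plus_mono2 interior_subset)
    show "open ((\<lambda>x. ?c *\<^sub>R x) ` (interior A \<inter> interior B))"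
      using cd by (intro open_scaling) auto
    show "open ((\<lambda>x. ?d *\<^sub>R x) ` (interior A + interior B))"
      using cd by (intro open_scaling open_set_plus) auto
  qed auto
  also have "\<dots> = ennreal (const * measure gaussian ((\<lambda>x. ?c *\<^sub>R x) ` (A \<inter> B)) * measure gaussian ((\<lambda>x. ?d *\<^sub>R x) ` (A + B)))"
    using assms const0
    by (simp add: ennreal_mult measure convex_scaling convex_Int convex_set_plus mult.assoc)
  finally show ?thesis
    unfolding const using const0 by (subst (asm) ennreal_le_iff) (auto intro!: mult_nonneg_nonneg)
qed

end
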